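(* Let $\mathcal{S}$ be a quasitopos. Subquasitoposes of $\mathcal{S}$ are in bijection with pairs $(h,k)$, where $k$ is a strict universal closure operator on $\mathcal{S}$, and $h$ is a proper universal closure operator on $\mathrm{Sep}(\mathcal{S},k)$ with the property that every $h$-dense subobject (in $\mathrm{Sep}(\mathcal{S},k)$) is also $k$-dense (in $\mathcal{S}$). Under this bijection, the subquasitopos corresponding to the pair $(h,k)$ is $\mathrm{Sh}(\mathrm{Sep}(\mathcal{S},k),h)$.
   Context: A monomorphism $m\colon X\to Y$ is strong if it has the unique right lifting property against all epimorphisms; a strong subobject is one represented by a strong monomorphism. A quasitopos is a category with finite limits and finite colimits which, along with each of its slice categories, is cartesian closed, and which has a classifier $t\colon 1\to\Omega$ for strong subobjects (every strong monomorphism $X\to Y$ is the pullback of $t$ along a unique $Y\to\Omega$). A subquasitopos of a quasitopos $\mathcal{S}$ is a full, replete, reflective subcategory $\mathcal{E}$ of $\mathcal{S}$ whose reflection $L\colon\mathcal{S}\to\mathcal{E}$ preserves monomorphisms and has stable units, i.e. preserves all pullbacks in $\mathcal{S}$ over objects of $\mathcal{E}$ (pullbacks of cospans $X\to B\leftarrow Y$ with $B\in\mathcal{E}$). A closure operator $j$ on a category $\mathcal{C}$ with finite limits assigns to each subobject $A'\le A$ a subobject $j(A')\le A$ such that $A'\le j(A')=j(j(A'))$, and $A_1\le A_2\le A$ implies $j(A_1)\le j(A_2)\le A$. It is universal if $f^*(j(A'))=j(f^*(A'))$ for each $f\colon B\to A$ and each $A'\le A$. It is proper if $j(A')\le A$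 is a strong subobject whenever $A'\le A$ is a strong subobject. It is strict if $j(A')\le A$ is a strong subobject for all subobjects $A'\le A$. A subobject $A'\le A$ (or a monomorphism representing it) is $j$-dense if $j(A')=A$. An object $X$ is a $j$-sheaf if for every $j$-dense monomorphism $m\colon A'\to A$ each map $A'\to X$ factorizes uniquely through $m$; it is $j$-separated if each such map factorizes in at most one way. $\mathrm{Sep}(\mathcal{C},j)$ and $\mathrm{Sh}(\mathcal{C},j)$ denote the full subcategories of $j$-separated objects and of $j$-sheaves. *)

theory Defs
  imports "HOL-Library.FuncSet"
begin

section \<open>Categories\<close>

record ('o, 'a) cat =
  Obj :: "'o set"
  Arr :: "'a set"
  Dom :: "'a \<Rightarrow> 'o"
  Cod :: "'a \<Rightarrow> 'o"
  Ident :: "'o \<Rightarrow> 'a"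
  Comp :: "'a \<Rightarrow> 'a \<Rightarrow> 'a"  (infixl "\<cdot>\<index>" 70)

definition hom :: "('o, 'a) cat \<Rightarrow> 'o \<Rightarrow> 'o \<Rightarrow> 'a set" where
  "hom C A B = {f \<in> Arr C. Dom C f = A \<and> Cod C f = B}"

locale category =
  fixes C :: "('o, 'a) cat" (structure)
  assumes dom_obj: "f \<in> Arr C \<Longrightarrow> Dom C f \<in> Obj C"
    and cod_obj: "f \<in> Arr C \<Longrightarrow> Cod C f \<in> Obj C"
    and ident_hom: "A \<in> Obj C \<Longrightarrow> Ident C A \<in> hom C A A"
    and comp_hom: "f \<in> hom C A B \<Longrightarrow> g \<in> hom C B D \<Longrightarrow> g \<cdot> f \<in> hom C A D"
    and comp_ident: "f \<in> hom C A B \<Longrightarrow> f \<cdot> Ident C A = f"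
    and ident_comp: "f \<in> hom C A B \<Longrightarrow> Ident C B \<cdot> f = f"
    and comp_assoc: "f \<in> hom C A B \<Longrightarrow> g \<in> hom C B D \<Longrightarrow> h \<in> hom C D E \<Longrightarrow>
        (h \<cdot> g) \<cdot> f = h \<cdot> (g \<cdot> f)"

definition op_cat :: "('o, 'a) cat \<Rightarrow> ('o, 'a) cat" where
  "op_cat C = \<lparr>Obj = Obj C, Arr = Arr C, Dom = Cod C, Cod = Dom C, Ident = Ident C,
     Comp = (\<lambda>g f. f \<cdot>\<^bsub>C\<^esub> g)\<rparr>"

definition full_sub :: "('o, 'a) cat \<Rightarrow> 'o set \<Rightarrow> ('o, 'a) cat" where
  "full_sub C X = \<lparr>Obj = X, Arr = {f \<in> Arr C. Dom C f \<in> X \<and> Cod C f \<in> X},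
     Dom = Dom C, Cod = Cod C, Ident = Ident C, Comp = Comp C\<rparr>"

text \<open>An arrow of the slice over \<open>B\<close> is a commuting triangle \<open>(f, h, g)\<close> with
  \<open>g \<cdot> h = f\<close>, regarded as an arrow from \<open>f\<close> to \<open>g\<close>.\<close>

definition slice :: "('o, 'a) cat \<Rightarrow> 'o \<Rightarrow> ('a, 'a \<times> 'a \<times> 'a) cat" where
  "slice C B = \<lparr>Obj = {f \<in> Arr C. Cod C f = B},
     Arr = {(f, h, g). f \<in> Arr C \<and> Cod C f = B \<and> g \<in> Arr C \<and> Cod C g = B \<and>
              h \<in> hom C (Dom C f) (Dom C g) \<and> g \<cdot>\<^bsub>C\<^esub> h = f},
     Dom = (\<lambda>(f, h, g). f), Cod = (\<lambda>(f, h, g). g),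
     Ident = (\<lambda>f. (f, Ident C (Dom C f), f)),
     Comp = (\<lambda>(g', h', k) (f, h, g). (f, h' \<cdot>\<^bsub>C\<^esub> h, k))\<rparr>"

context category
begin

lemma arr_simps:
  "A \<in> Obj C \<Longrightarrow> Ident C A \<in> Arr C"
  "A \<in> Obj C \<Longrightarrow> Dom C (Ident C A) = A"
  "A \<in> Obj C \<Longrightarrow> Cod C (Ident C A) = A"
  "f \<in> Arr C \<Longrightarrow> g \<in> Arr C \<Longrightarrow> Cod C f = Dom C g \<Longrightarrow> g \<cdot> f \<in> Arr C"
  "f \<in> Arr C \<Longrightarrow> g \<in> Arr C \<Longrightarrow> Cod C f = Dom C g \<Longrightarrow> Dom C (g \<cdot> f) = Dom C f"
  "f \<in> Arr C \<Longrightarrow> g \<in> Arr C \<Longrightarrow> Cod C f = Dom C g \<Longrightarrow> Cod C (g \<cdot> f) = Cod C g"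
  "f \<in> Arr C \<Longrightarrow> f \<cdot> Ident C (Dom C f) = f"
  "f \<in> Arr C \<Longrightarrow> Ident C (Cod C f) \<cdot> f = f"
  "f \<in> Arr C \<Longrightarrow> g \<in> Arr C \<Longrightarrow> h \<in> Arr C \<Longrightarrow> Cod C f = Dom C g \<Longrightarrow> Cod C g = Dom C h \<Longrightarrow>
     (h \<cdot> g) \<cdot> f = h \<cdot> (g \<cdot> f)"
  using ident_hom[of A] comp_hom[of f "Dom C f" "Dom C g" g "Cod C g"]
    comp_ident[of f "Dom C f" "Cod C f"] ident_comp[of f "Dom C f" "Cod C f"]
    comp_assoc[of f "Dom C f" "Cod C f" g "Cod C g" h "Cod C h"]
  unfolding hom_def by auto

lemmas obj_simps = dom_obj cod_obj

end

lemma category_op_cat: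
  assumes "category C" shows "category (op_cat C)"
proof -
  interpret category C by fact
  show ?thesis
    by unfold_locales (auto simp: op_cat_def hom_def arr_simps obj_simps)
qed

lemma category_full_sub:
  assumes "category C" "X \<subseteq> Obj C" shows "category (full_sub C X)"
proof -
  interpret category C by fact
  show ?thesis
    using assms(2) by unfold_locales (auto simp: full_sub_def hom_def arr_simps obj_simps subset_iff)
qed

lemma category_slice:
  assumes "category C" shows "category (slice C B)"
proof -
  interpret category C by fact
  have eq: "g \<cdot>\<^bsub>C\<^esub> (k \<cdot>\<^bsub>C\<^esub> h) = (g \<cdot>\<^bsub>C\<^esub> k) \<cdot>\<^bsub>C\<^esub> h"
    if "h \<in> Arr C" "k \<in> Arr C" "g \<in> Arr C" "Cod C h = Dom C k" "Cod C k = Dom C g" for g h k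
    using that by (simp add: arr_simps)
  show ?thesis
  proof (unfold_locales, goal_cases)
    case 4
    then show ?case
      by (simp add: slice_def hom_def split_beta mem_Times_iff arr_simps(1-8))
        (metis eq)
  next
    case (5 f A B)
    obtain a h b where "f = (a, h, b)" by (cases f)
    with 5 show ?case
      by (simp add: slice_def hom_def) (metis arr_simps(7))
  next
    case (6 f A B)
    obtain a h b where "f = (a, h, b)" by (cases f)
    with 6 show ?case
      by (simp add: slice_def hom_def) (metis arr_simps(8))
  next
    case (7 f A B g D h E)
    obtain a f' b c g' d a' h' b' where "f = (a, f', b)" "g = (c, g', d)" "h = (a', h', b')"
      by (cases f; cases g; cases h)
    with 7 show ?case
      by (simp add: slice_def hom_def) (metis arr_simps(9))
  qed (auto simp: slice_def hom_def arr_simps obj_simps)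
qed


section \<open>Monomorphisms, epimorphisms, strong monomorphisms\<close>

definition mono_arr :: "('o, 'a) cat \<Rightarrow> 'a \<Rightarrow> bool" where
  "mono_arr C m \<longleftrightarrow> m \<in> Arr C \<and>
     (\<forall>A. \<forall>f \<in> hom C A (Dom C m). \<forall>g \<in> hom C A (Dom C m).
        m \<cdot>\<^bsub>C\<^esub> f = m \<cdot>\<^bsub>C\<^esub> g \<longrightarrow> f = g)"

definition epi_arr :: "('o, 'a) cat \<Rightarrow> 'a \<Rightarrow> bool" where
  "epi_arr C e \<longleftrightarrow> e \<in> Arr C \<and>
     (\<forall>B. \<forall>f \<in> hom C (Cod C e) B. \<forall>g \<in> hom C (Cod C e) B.
        f \<cdot>\<^bsub>C\<^esub> e = g \<cdot>\<^bsub>C\<^esub> e \<longrightarrow> f = g)"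

definition iso_arr :: "('o, 'a) cat \<Rightarrow> 'a \<Rightarrow> bool" where
  "iso_arr C f \<longleftrightarrow> f \<in> Arr C \<and>
     (\<exists>g \<in> hom C (Cod C f) (Dom C f).
        g \<cdot>\<^bsub>C\<^esub> f = Ident C (Dom C f) \<and> f \<cdot>\<^bsub>C\<^esub> g = Ident C (Cod C f))"

definition strong_mono :: "('o, 'a) cat \<Rightarrow> 'a \<Rightarrow> bool" where
  "strong_mono C m \<longleftrightarrow> mono_arr C m \<and>
     (\<forall>e u v. epi_arr C e \<and> u \<in> hom C (Dom C e) (Dom C m) \<and> v \<in> hom C (Cod C e) (Cod C m) \<and>
        m \<cdot>\<^bsub>C\<^esub> u = v \<cdot>\<^bsub>C\<^esub> e \<longrightarrow>
        (\<exists>!d. d \<in> hom C (Cod C e) (Dom C m) \<and> d \<cdot>\<^bsub>C\<^esub> e = u \<and> m \<cdot>\<^bsub>C\<^esub> d = v))"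


section \<open>Functors, limits, colimits\<close>

record ('o, 'a, 'p, 'b) functor_data =
  on_obj :: "'o \<Rightarrow> 'p"
  on_arr :: "'a \<Rightarrow> 'b"

definition is_functor ::
  "('o, 'a) cat \<Rightarrow> ('p, 'b) cat \<Rightarrow> ('o, 'a, 'p, 'b) functor_data \<Rightarrow> bool" where
  "is_functor C D F \<longleftrightarrow>
     (\<forall>A \<in> Obj C. on_obj F A \<in> Obj D \<and> on_arr F (Ident C A) = Ident D (on_obj F A)) \<and>
     (\<forall>f \<in> Arr C. on_arr F f \<in> hom D (on_obj F (Dom C f)) (on_obj F (Cod C f))) \<and>
     (\<forall>f \<in> Arr C. \<forall>g \<in> Arr C. Cod C f = Dom C g \<longrightarrow>
        on_arr F (g \<cdot>\<^bsub>C\<^esub> f) = on_arr F g \<cdot>\<^bsub>D\<^esub> on_arr F f)"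

definition is_cone :: "('i, 'j) cat \<Rightarrow> ('o, 'a) cat \<Rightarrow> ('i, 'j, 'o, 'a) functor_data \<Rightarrow>
    'o \<Rightarrow> ('i \<Rightarrow> 'a) \<Rightarrow> bool" where
  "is_cone J C F N p \<longleftrightarrow> N \<in> Obj C \<and>
     (\<forall>i \<in> Obj J. p i \<in> hom C N (on_obj F i)) \<and>
     (\<forall>u \<in> Arr J. on_arr F u \<cdot>\<^bsub>C\<^esub> p (Dom J u) = p (Cod J u))"

definition is_limit :: "('i, 'j) cat \<Rightarrow> ('o, 'a) cat \<Rightarrow> ('i, 'j, 'o, 'a) functor_data \<Rightarrow>
    'o \<Rightarrow> ('i \<Rightarrow> 'a) \<Rightarrow> bool" where
  "is_limit J C F N p \<longleftrightarrow> is_cone J C F N p \<and>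
     (\<forall>M q. is_cone J C F M q \<longrightarrow>
        (\<exists>!g. g \<in> hom C M N \<and> (\<forall>i \<in> Obj J. p i \<cdot>\<^bsub>C\<^esub> g = q i)))"

text \<open>Every finite category is isomorphic to one whose objects and arrows are natural numbers,
  so indexing diagrams by the latter loses no generality.\<close>

definition has_finite_limits :: "('o, 'a) cat \<Rightarrow> bool" where
  "has_finite_limits C \<longleftrightarrow>
     (\<forall>(J :: (nat, nat) cat) F. category J \<and> finite (Obj J) \<and> finite (Arr J) \<and> is_functor J C F \<longrightarrow>
        (\<exists>N p. is_limit J C F N p))"

definition has_finite_colimits :: "('o, 'a) cat \<Rightarrow> bool" where
  "has_finite_colimits C \<longleftrightarrow> has_finite_limits (op_cat C)"

definition is_terminal :: "('o, 'a) cat \<Rightarrow> 'o \<Rightarrow> bool" where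
  "is_terminal C T \<longleftrightarrow> T \<in> Obj C \<and> (\<forall>A \<in> Obj C. \<exists>!f. f \<in> hom C A T)"

definition is_product :: "('o, 'a) cat \<Rightarrow> 'o \<Rightarrow> 'o \<Rightarrow> 'o \<Rightarrow> 'a \<Rightarrow> 'a \<Rightarrow> bool" where
  "is_product C A B P p q \<longleftrightarrow> P \<in> Obj C \<and> p \<in> hom C P A \<and> q \<in> hom C P B \<and>
     (\<forall>X. \<forall>f \<in> hom C X A. \<forall>g \<in> hom C X B.
        \<exists>!h. h \<in> hom C X P \<and> p \<cdot>\<^bsub>C\<^esub> h = f \<and> q \<cdot>\<^bsub>C\<^esub> h = g)"

text \<open>\<open>is_pullback C p q f g\<close>: the square \<open>f \<cdot> p = g \<cdot> q\<close> over the cospan \<open>(f, g)\<close> is a pullback.\<close>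

definition is_pullback :: "('o, 'a) cat \<Rightarrow> 'a \<Rightarrow> 'a \<Rightarrow> 'a \<Rightarrow> 'a \<Rightarrow> bool" where
  "is_pullback C p q f g \<longleftrightarrow> f \<in> Arr C \<and> g \<in> Arr C \<and> p \<in> Arr C \<and> q \<in> Arr C \<and>
     Cod C f = Cod C g \<and> Dom C p = Dom C q \<and> Cod C p = Dom C f \<and> Cod C q = Dom C g \<and>
     f \<cdot>\<^bsub>C\<^esub> p = g \<cdot>\<^bsub>C\<^esub> q \<and>
     (\<forall>X. \<forall>u \<in> hom C X (Dom C f). \<forall>v \<in> hom C X (Dom C g). f \<cdot>\<^bsub>C\<^esub> u = g \<cdot>\<^bsub>C\<^esub> v \<longrightarrow>
        (\<exists>!w. w \<in> hom C X (Dom C p) \<and> p \<cdot>\<^bsub>C\<^esub> w = u \<and> q \<cdot>\<^bsub>C\<^esub> w = v))"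


section \<open>Quasitoposes\<close>

text \<open>The arrow \<open>h\<close> below is the uniquely determined \<open>g \<times> A : X \<times> A \<rightarrow> E \<times> A\<close>.\<close>

definition is_exponential ::
  "('o, 'a) cat \<Rightarrow> 'o \<Rightarrow> 'o \<Rightarrow> 'o \<Rightarrow> 'o \<Rightarrow> 'a \<Rightarrow> 'a \<Rightarrow> 'a \<Rightarrow> bool" where
  "is_exponential C A B E P p q ev \<longleftrightarrow> E \<in> Obj C \<and> is_product C E A P p q \<and> ev \<in> hom C P B \<and>
     (\<forall>X Q r s. \<forall>f \<in> hom C Q B. X \<in> Obj C \<and> is_product C X A Q r s \<longrightarrow>
        (\<exists>!g. g \<in> hom C X E \<and>
           (\<exists>h \<in> hom C Q P. p \<cdot>\<^bsub>C\<^esub> h = g \<cdot>\<^bsub>C\<^esub> r \<and> q \<cdot>\<^bsub>C\<^esub> h = s \<and> ev \<cdot>\<^bsub>C\<^esub> h = f)))"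

definition cartesian_closed :: "('o, 'a) cat \<Rightarrow> bool" where
  "cartesian_closed C \<longleftrightarrow> (\<exists>T. is_terminal C T) \<and>
     (\<forall>A \<in> Obj C. \<forall>B \<in> Obj C. \<exists>P p q. is_product C A B P p q) \<and>
     (\<forall>A \<in> Obj C. \<forall>B \<in> Obj C. \<exists>E P p q ev. is_exponential C A B E P p q ev)"

definition strong_subobject_classifier :: "('o, 'a) cat \<Rightarrow> 'a \<Rightarrow> bool" where
  "strong_subobject_classifier C t \<longleftrightarrow> t \<in> Arr C \<and> is_terminal C (Dom C t) \<and>
     (\<forall>m. strong_mono C m \<longrightarrow>
        (\<exists>!\<chi>. \<chi> \<in> hom C (Cod C m) (Cod C t) \<and>
           (\<exists>u \<in> hom C (Dom C m) (Dom C t). is_pullback C m u \<chi> t)))"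

definition quasitopos :: "('o, 'a) cat \<Rightarrow> bool" where
  "quasitopos C \<longleftrightarrow> category C \<and> has_finite_limits C \<and> has_finite_colimits C \<and>
     cartesian_closed C \<and> (\<forall>B \<in> Obj C. cartesian_closed (slice C B)) \<and>
     (\<exists>t. strong_subobject_classifier C t)"


section \<open>Subquasitoposes\<close>

definition full_subcategory :: "('o, 'a) cat \<Rightarrow> ('o, 'a) cat \<Rightarrow> bool" where
  "full_subcategory E C \<longleftrightarrow> Obj E \<subseteq> Obj C \<and> E = full_sub C (Obj E)"

definition replete :: "('o, 'a) cat \<Rightarrow> ('o, 'a) cat \<Rightarrow> bool" where
  "replete E C \<longleftrightarrow> (\<forall>f. iso_arr C f \<and> Dom C f \<in> Obj E \<longrightarrow> Cod C f \<in> Obj E)"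

text \<open>\<open>L : C \<rightarrow> E\<close> is left adjoint to the inclusion of \<open>E\<close>, with unit \<open>\<eta>\<close>.\<close>

definition is_reflection ::
  "('o, 'a) cat \<Rightarrow> ('o, 'a) cat \<Rightarrow> ('o, 'a, 'o, 'a) functor_data \<Rightarrow> ('o \<Rightarrow> 'a) \<Rightarrow> bool" where
  "is_reflection C E L \<eta> \<longleftrightarrow> is_functor C E L \<and>
     (\<forall>X \<in> Obj C. \<eta> X \<in> hom C X (on_obj L X)) \<and>
     (\<forall>f \<in> Arr C. on_arr L f \<cdot>\<^bsub>C\<^esub> \<eta> (Dom C f) = \<eta> (Cod C f) \<cdot>\<^bsub>C\<^esub> f) \<and>
     (\<forall>X \<in> Obj C. \<forall>Y \<in> Obj E. \<forall>f \<in> hom C X Y.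
        \<exists>!g. g \<in> hom E (on_obj L X) Y \<and> g \<cdot>\<^bsub>C\<^esub> \<eta> X = f)"

definition preserves_monos ::
  "('o, 'a) cat \<Rightarrow> ('p, 'b) cat \<Rightarrow> ('o, 'a, 'p, 'b) functor_data \<Rightarrow> bool" where
  "preserves_monos C D F \<longleftrightarrow> (\<forall>m. mono_arr C m \<longrightarrow> mono_arr D (on_arr F m))"

definition has_stable_units ::
  "('o, 'a) cat \<Rightarrow> ('o, 'a) cat \<Rightarrow> ('o, 'a, 'o, 'a) functor_data \<Rightarrow> bool" where
  "has_stable_units C E L \<longleftrightarrow>
     (\<forall>p q f g. is_pullback C p q f g \<and> Cod C f \<in> Obj E \<longrightarrow>
        is_pullback E (on_arr L p) (on_arr L q) (on_arr L f) (on_arr L g))"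

definition subquasitopos :: "('o, 'a) cat \<Rightarrow> ('o, 'a) cat \<Rightarrow> bool" where
  "subquasitopos E S \<longleftrightarrow> full_subcategory E S \<and> replete E S \<and>
     (\<exists>L \<eta>. is_reflection S E L \<eta> \<and> preserves_monos S E L \<and> has_stable_units S E L)"


section \<open>Subobjects and closure operators\<close>

text \<open>A subobject of \<open>A\<close> is the isomorphism class of a monomorphism into \<open>A\<close>; since the class is
  nonempty, it determines \<open>A\<close>.\<close>

definition subobj_of :: "('o, 'a) cat \<Rightarrow> 'a \<Rightarrow> 'a set" where
  "subobj_of C m = {n. mono_arr C n \<and> Cod C n = Cod C m \<and>
     (\<exists>i \<in> hom C (Dom C n) (Dom C m). iso_arr C i \<and> n = m \<cdot>\<^bsub>C\<^esub> i)}"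

definition Sub :: "('o, 'a) cat \<Rightarrow> 'o \<Rightarrow> 'a set set" where
  "Sub C A = {subobj_of C m |m. mono_arr C m \<and> Cod C m = A}"

definition subobj_le :: "('o, 'a) cat \<Rightarrow> 'a set \<Rightarrow> 'a set \<Rightarrow> bool" where
  "subobj_le C x y \<longleftrightarrow> (\<exists>m \<in> x. \<exists>n \<in> y. \<exists>u \<in> hom C (Dom C m) (Dom C n). m = n \<cdot>\<^bsub>C\<^esub> u)"

definition strong_subobj :: "('o, 'a) cat \<Rightarrow> 'a set \<Rightarrow> bool" where
  "strong_subobj C x \<longleftrightarrow> (\<exists>m \<in> x. strong_mono C m)"

text \<open>The subobject \<open>f\<^sup>*(x)\<close>, as the set of all pullbacks along \<open>f\<close> of representatives of \<open>x\<close>.\<close>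

definition sub_pullback :: "('o, 'a) cat \<Rightarrow> 'a \<Rightarrow> 'a set \<Rightarrow> 'a set" where
  "sub_pullback C f x = {n. \<exists>m \<in> x. \<exists>q. is_pullback C n q f m}"

text \<open>Closure operators are functions on the subobjects of all objects together. Requiring the
  conventional value \<open>undefined\<close> elsewhere makes equality of closure operators coincide with
  equality on subobjects, as is needed in order to count them.\<close>

definition closure_operator :: "('o, 'a) cat \<Rightarrow> ('a set \<Rightarrow> 'a set) \<Rightarrow> bool" where
  "closure_operator C j \<longleftrightarrow> j \<in> extensional (\<Union>A \<in> Obj C. Sub C A) \<and>
     (\<forall>A \<in> Obj C. \<forall>x \<in> Sub C A. j x \<in> Sub C A \<and> subobj_le C x (j x) \<and> j (j x) = j x) \<and>
     (\<forall>A \<in> Obj C. \<forall>x \<in> Sub C A. \<forall>y \<in> Sub C A. subobj_le C x y \<longrightarrow> subobj_le C (j x) (j y))"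

definition universal_closure :: "('o, 'a) cat \<Rightarrow> ('a set \<Rightarrow> 'a set) \<Rightarrow> bool" where
  "universal_closure C j \<longleftrightarrow> closure_operator C j \<and>
     (\<forall>f \<in> Arr C. \<forall>x \<in> Sub C (Cod C f). sub_pullback C f (j x) = j (sub_pullback C f x))"

definition proper_closure :: "('o, 'a) cat \<Rightarrow> ('a set \<Rightarrow> 'a set) \<Rightarrow> bool" where
  "proper_closure C j \<longleftrightarrow>
     (\<forall>A \<in> Obj C. \<forall>x \<in> Sub C A. strong_subobj C x \<longrightarrow> strong_subobj C (j x))"

definition strict_closure :: "('o, 'a) cat \<Rightarrow> ('a set \<Rightarrow> 'a set) \<Rightarrow> bool" where
  "strict_closure C j \<longleftrightarrow> (\<forall>A \<in> Obj C. \<forall>x \<in> Sub C A. strong_subobj C (j x))"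

definition dense_mono :: "('o, 'a) cat \<Rightarrow> ('a set \<Rightarrow> 'a set) \<Rightarrow> 'a \<Rightarrow> bool" where
  "dense_mono C j m \<longleftrightarrow> mono_arr C m \<and>
     j (subobj_of C m) = subobj_of C (Ident C (Cod C m))"

definition separated :: "('o, 'a) cat \<Rightarrow> ('a set \<Rightarrow> 'a set) \<Rightarrow> 'o \<Rightarrow> bool" where
  "separated C j X \<longleftrightarrow> (\<forall>m. dense_mono C j m \<longrightarrow>
     (\<forall>u \<in> hom C (Dom C m) X. \<exists>\<^sub>\<le>\<^sub>1v. v \<in> hom C (Cod C m) X \<and> v \<cdot>\<^bsub>C\<^esub> m = u))"

definition sheaf :: "('o, 'a) cat \<Rightarrow> ('a set \<Rightarrow> 'a set) \<Rightarrow> 'o \<Rightarrow> bool" where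
  "sheaf C j X \<longleftrightarrow> (\<forall>m. dense_mono C j m \<longrightarrow>
     (\<forall>u \<in> hom C (Dom C m) X. \<exists>!v. v \<in> hom C (Cod C m) X \<and> v \<cdot>\<^bsub>C\<^esub> m = u))"

definition Sep :: "('o, 'a) cat \<Rightarrow> ('a set \<Rightarrow> 'a set) \<Rightarrow> ('o, 'a) cat" where
  "Sep C j = full_sub C {X \<in> Obj C. separated C j X}"

definition Sh :: "('o, 'a) cat \<Rightarrow> ('a set \<Rightarrow> 'a set) \<Rightarrow> ('o, 'a) cat" where
  "Sh C j = full_sub C {X \<in> Obj C. sheaf C j X}"

definition closure_pair ::
  "('o, 'a) cat \<Rightarrow> ('a set \<Rightarrow> 'a set) \<times> ('a set \<Rightarrow> 'a set) \<Rightarrow> bool" where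
  "closure_pair S = (\<lambda>(h, k).
     universal_closure S k \<and> strict_closure S k \<and>
     universal_closure (Sep S k) h \<and> proper_closure (Sep S k) h \<and>
     (\<forall>m. dense_mono (Sep S k) h m \<longrightarrow> dense_mono S k m))"

end

theory Submission
  imports Defs
begin

text \<open>Given a pair \<open>(h, k)\<close>, the power \<open>M\<close> of the classifier of \<open>k\<close>-closed subobjects by \<open>X\<close> is a
  sheaf, and the transpose \<open>X \<rightarrow> M\<close> of the classifying map of the \<open>k\<close>-closure of the diagonal has that
  closure as its kernel pair. So the quotient of \<open>X\<close> by it is the separated reflection of \<open>X\<close>, and the
  \<open>h\<close>-closure of this quotient in \<open>M\<close> is the sheaf reflection. For stable units, a product fibred over a
  sheaf is reflected one factor at a time; the quotient maps remain orthogonal to separated objects after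
  pulling back because local exponentials of separated objects are separated.

  The sheaves determine the pair: a monomorphism is \<open>k\<close>-dense iff maps into sheaves agree as soon as they
  agree on it, and a monomorphism of separated objects is \<open>h\<close>-dense iff it is orthogonal to all sheaves.

  Conversely, let \<open>L\<close> be the reflection onto a subquasitopos, with unit \<open>\<eta>\<close>. The \<open>k\<close>-closure of
  \<open>m : A' \<rightarrow> A\<close> is the equalizer of \<open>\<eta> i\<close> and \<open>\<eta> j\<close>, where \<open>(i, j)\<close> is the cokernel pair of \<open>m\<close>. It is
  stable under pullback along \<open>f : B \<rightarrow> A\<close> since the cokernel pair \<open>P \<rightarrow> A\<close> is, and \<open>P \<times>\<^sub>A B \<rightarrow> P \<times> B\<close> is a
  monomorphism, hence preserved by \<open>L\<close>. The \<open>k\<close>-separated objects are those with a monic unit, and the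
  \<open>h\<close>-closure of \<open>m\<close> is the pullback of \<open>L m\<close> along \<open>\<eta>\<close>.\<close>

section \<open>Calculus of arrows\<close>

text \<open>In a quasitopos an epimorphism need not be regular and an equivalence relation need not
  be effective, so the image factorizations of topos theory are not at hand. This explains the
  detour through a power object: the transpose exhibits the closed diagonal as a kernel pair
  outright. A quotient is then handled through its kernel relation, agreement on a dense subobject,
  and by lifting along epimorphic covers. Stability of epimorphisms and of cokernel pairs under base
  change comes from one source, the slice exponentials, in the form that arrows
  \<open>T \<times>\<^sub>B D \<rightarrow> Y\<close> are represented over \<open>B\<close>. As
  pullbacks are not chosen, transposition is a relation valid for every choice of them. Strictness
  of \<open>k\<close> makes its closed subobjects classifiable: strong subobjects have a classifier,
  and the closed ones correspond to the fixed points of an endomorphism of it. The operator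
  \<open>h\<close> acts on separated objects only, so each appeal to \<open>h\<close>-density first
  brings the pullbacks involved into that subcategory. Subobjects are compared throughout by which
  generalized elements factor through them.\<close>

lemma hom_iff [simp]: "f \<in> hom C A B \<longleftrightarrow> f \<in> Arr C \<and> Dom C f = A \<and> Cod C f = B"
  by (simp add: hom_def)

context category
begin

declare arr_simps [simp] obj_simps [simp]

lemma ident_simps [simp]:
  "f \<in> Arr C \<Longrightarrow> Cod C f = A \<Longrightarrow> Ident C A \<cdot> f = f"
  "f \<in> Arr C \<Longrightarrow> Dom C f = A \<Longrightarrow> f \<cdot> Ident C A = f"
  by auto

lemma comp_reassoc:
  "f \<cdot> p = r \<Longrightarrow> f \<in> Arr C \<Longrightarrow> p \<in> Arr C \<Longrightarrow> Cod C p = Dom C f \<Longrightarrow>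
   x \<in> Arr C \<Longrightarrow> Cod C x = Dom C p \<Longrightarrow> f \<cdot> (p \<cdot> x) = r \<cdot> x"
  using arr_simps(9) by metis

end

text \<open>For monic \<open>c\<close> this is generalized membership of \<open>x\<close> in the
  subobject \<open>c\<close>. Order, pullback and closure of subobjects are all reduced to it, which
  avoids working with isomorphism classes.\<close>

definition fac :: "('o, 'a) cat \<Rightarrow> 'a \<Rightarrow> 'a \<Rightarrow> bool" where
  "fac C x c \<longleftrightarrow> (\<exists>u \<in> Arr C. Dom C u = Dom C x \<and> Cod C u = Dom C c \<and> x = c \<cdot>\<^bsub>C\<^esub> u)"

text \<open>The sheaf condition for one arrow and one object. It is also needed for arrows that are
  not monic, such as quotient maps and units of reflections.\<close>

definition orth :: "('o, 'a) cat \<Rightarrow> 'a \<Rightarrow> 'o \<Rightarrow> bool" where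
  "orth C m Y \<longleftrightarrow> (\<forall>u \<in> hom C (Dom C m) Y. \<exists>!v. v \<in> hom C (Cod C m) Y \<and> v \<cdot>\<^bsub>C\<^esub> m = u)"

text \<open>The uniqueness half of \<open>orth\<close>: \<open>m\<close> behaves like an epimorphism
  as far as \<open>Y\<close> can see.\<close>

definition cancels :: "('o, 'a) cat \<Rightarrow> 'a \<Rightarrow> 'o \<Rightarrow> bool" where
  "cancels C m Y \<longleftrightarrow> (\<forall>u \<in> hom C (Cod C m) Y. \<forall>v \<in> hom C (Cod C m) Y.
     u \<cdot>\<^bsub>C\<^esub> m = v \<cdot>\<^bsub>C\<^esub> m \<longrightarrow> u = v)"

definition is_pushout :: "('o, 'a) cat \<Rightarrow> 'a \<Rightarrow> 'a \<Rightarrow> 'a \<Rightarrow> 'a \<Rightarrow> bool" where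
  "is_pushout C i j f g \<longleftrightarrow> is_pullback (op_cat C) i j f g"

lemma facE:
  assumes "fac C x c"
  obtains u where "u \<in> Arr C" "Dom C u = Dom C x" "Cod C u = Dom C c" "c \<cdot>\<^bsub>C\<^esub> u = x"
  using assms by (auto simp: fac_def)

lemma facI:
  "u \<in> Arr C \<Longrightarrow> Dom C u = Dom C x \<Longrightarrow> Cod C u = Dom C c \<Longrightarrow> c \<cdot>\<^bsub>C\<^esub> u = x \<Longrightarrow> fac C x c"
  by (auto simp: fac_def)

lemma mono_cancel:
  assumes "mono_arr C m" "f \<in> Arr C" "g \<in> Arr C" "Dom C f = Dom C g"
    "Cod C f = Dom C m" "Cod C g = Dom C m" "m \<cdot>\<^bsub>C\<^esub> f = m \<cdot>\<^bsub>C\<^esub> g"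
  shows "f = g"
proof -
  have "\<forall>A. \<forall>f \<in> hom C A (Dom C m). \<forall>g \<in> hom C A (Dom C m). m \<cdot>\<^bsub>C\<^esub> f = m \<cdot>\<^bsub>C\<^esub> g \<longrightarrow> f = g"
    using assms(1) unfolding mono_arr_def by blast
  from this[rule_format, of f "Dom C g" g] show ?thesis using assms(2-) by simp
qed

lemma monoI:
  assumes "m \<in> Arr C"
    "\<And>f g. \<lbrakk>f \<in> Arr C; g \<in> Arr C; Dom C f = Dom C g; Cod C f = Dom C m; Cod C g = Dom C m;
       m \<cdot>\<^bsub>C\<^esub> f = m \<cdot>\<^bsub>C\<^esub> g\<rbrakk> \<Longrightarrow> f = g"
  shows "mono_arr C m"
  unfolding mono_arr_def by (intro conjI allI ballI impI, rule assms(1)) (rule assms(2), auto)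

lemma mono_Arr: "mono_arr C m \<Longrightarrow> m \<in> Arr C"
  by (simp add: mono_arr_def)

lemma epi_cancel:
  assumes "epi_arr C e" "f \<in> Arr C" "g \<in> Arr C" "Cod C f = Cod C g"
    "Dom C f = Cod C e" "Dom C g = Cod C e" "f \<cdot>\<^bsub>C\<^esub> e = g \<cdot>\<^bsub>C\<^esub> e"
  shows "f = g"
proof -
  have "\<forall>B. \<forall>f \<in> hom C (Cod C e) B. \<forall>g \<in> hom C (Cod C e) B. f \<cdot>\<^bsub>C\<^esub> e = g \<cdot>\<^bsub>C\<^esub> e \<longrightarrow> f = g"
    using assms(1) unfolding epi_arr_def by blast
  from this[rule_format, of f "Cod C g" g] show ?thesis using assms(2-) by simp
qed

lemma epiI:
  assumes "e \<in> Arr C"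
    "\<And>f g. \<lbrakk>f \<in> Arr C; g \<in> Arr C; Cod C f = Cod C g; Dom C f = Cod C e; Dom C g = Cod C e;
       f \<cdot>\<^bsub>C\<^esub> e = g \<cdot>\<^bsub>C\<^esub> e\<rbrakk> \<Longrightarrow> f = g"
  shows "epi_arr C e"
  unfolding epi_arr_def by (intro conjI allI ballI impI, rule assms(1)) (rule assms(2), auto)

lemma epi_Arr: "epi_arr C m \<Longrightarrow> m \<in> Arr C"
  by (simp add: epi_arr_def)

lemma pbD:
  assumes "is_pullback C p q f g"
  shows "f \<in> Arr C" "g \<in> Arr C" "p \<in> Arr C" "q \<in> Arr C" "Cod C f = Cod C g"
    "Dom C p = Dom C q" "Cod C p = Dom C f" "Cod C q = Dom C g" "f \<cdot>\<^bsub>C\<^esub> p = g \<cdot>\<^bsub>C\<^esub> q"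
  using assms by (auto simp: is_pullback_def)

lemma pb_lift:
  assumes "is_pullback C p q f g" "u \<in> Arr C" "v \<in> Arr C" "Dom C u = Dom C v"
    "Cod C u = Dom C f" "Cod C v = Dom C g" "f \<cdot>\<^bsub>C\<^esub> u = g \<cdot>\<^bsub>C\<^esub> v"
  obtains w where "w \<in> Arr C" "Dom C w = Dom C v" "Cod C w = Dom C q" "p \<cdot>\<^bsub>C\<^esub> w = u" "q \<cdot>\<^bsub>C\<^esub> w = v"
proof -
  have "\<forall>X. \<forall>u \<in> hom C X (Dom C f). \<forall>v \<in> hom C X (Dom C g). f \<cdot>\<^bsub>C\<^esub> u = g \<cdot>\<^bsub>C\<^esub> v \<longrightarrow>
        (\<exists>!w. w \<in> hom C X (Dom C p) \<and> p \<cdot>\<^bsub>C\<^esub> w = u \<and> q \<cdot>\<^bsub>C\<^esub> w = v)"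
    using assms(1) unfolding is_pullback_def by blast
  from this[rule_format, of u "Dom C v" v]
  have "\<exists>!w. w \<in> hom C (Dom C v) (Dom C p) \<and> p \<cdot>\<^bsub>C\<^esub> w = u \<and> q \<cdot>\<^bsub>C\<^esub> w = v"
    using assms by simp
  then show ?thesis using that assms(1) by (auto simp: is_pullback_def)
qed

lemma (in category) pb_uniq:
  assumes "is_pullback C p q f g" "x \<in> Arr C" "y \<in> Arr C" "Dom C x = Dom C y"
    "Cod C x = Dom C q" "Cod C y = Dom C q" "p \<cdot> x = p \<cdot> y" "q \<cdot> x = q \<cdot> y"
  shows "x = y"
proof -
  note p = pbD[OF assms(1)]
  have "f \<cdot> (p \<cdot> x) = (g \<cdot> (q \<cdot> x))"
    using assms(2-) p(1-8) by (simp add: comp_reassoc[OF p(9)])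
  moreover have "\<forall>X. \<forall>u \<in> hom C X (Dom C f). \<forall>v \<in> hom C X (Dom C g). f \<cdot> u = g \<cdot> v \<longrightarrow>
        (\<exists>!w. w \<in> hom C X (Dom C p) \<and> p \<cdot> w = u \<and> q \<cdot> w = v)"
    using assms(1) unfolding is_pullback_def by blast
  note * = this[rule_format, of "p \<cdot> x" "Dom C x" "q \<cdot> x"]
  ultimately have "\<exists>!w. w \<in> hom C (Dom C x) (Dom C p) \<and> p \<cdot> w = p \<cdot> x \<and> q \<cdot> w = q \<cdot> x"
    using * assms(2-6) p(1-8) by simp
  moreover have "x \<in> hom C (Dom C x) (Dom C p) \<and> p \<cdot> x = p \<cdot> x \<and> q \<cdot> x = q \<cdot> x"
    "y \<in> hom C (Dom C x) (Dom C p) \<and> p \<cdot> y = p \<cdot> x \<and> q \<cdot> y = q \<cdot> x"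
    using assms(2-8) p(6) by simp_all
  ultimately show ?thesis by blast
qed

lemma pbI:
  assumes "f \<in> Arr C" "g \<in> Arr C" "p \<in> Arr C" "q \<in> Arr C" "Cod C f = Cod C g"
    "Dom C p = Dom C q" "Cod C p = Dom C f" "Cod C q = Dom C g" "f \<cdot>\<^bsub>C\<^esub> p = g \<cdot>\<^bsub>C\<^esub> q"
  and lift: "\<And>u v. \<lbrakk>u \<in> Arr C; v \<in> Arr C; Dom C u = Dom C v; Cod C u = Dom C f; Cod C v = Dom C g;
      f \<cdot>\<^bsub>C\<^esub> u = g \<cdot>\<^bsub>C\<^esub> v\<rbrakk> \<Longrightarrow>
      \<exists>w. w \<in> Arr C \<and> Dom C w = Dom C v \<and> Cod C w = Dom C q \<and> p \<cdot>\<^bsub>C\<^esub> w = u \<and> q \<cdot>\<^bsub>C\<^esub> w = v"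
  and uniq: "\<And>x y. \<lbrakk>x \<in> Arr C; y \<in> Arr C; Dom C x = Dom C y; Cod C x = Dom C q; Cod C y = Dom C q;
      p \<cdot>\<^bsub>C\<^esub> x = p \<cdot>\<^bsub>C\<^esub> y; q \<cdot>\<^bsub>C\<^esub> x = q \<cdot>\<^bsub>C\<^esub> y\<rbrakk> \<Longrightarrow> x = y"
  shows "is_pullback C p q f g"
  unfolding is_pullback_def
proof (intro conjI allI ballI impI)
  fix X u v assume uv: "u \<in> hom C X (Dom C f)" "v \<in> hom C X (Dom C g)" "f \<cdot>\<^bsub>C\<^esub> u = g \<cdot>\<^bsub>C\<^esub> v"
  obtain w where w: "w \<in> Arr C" "Dom C w = Dom C v" "Cod C w = Dom C q" "p \<cdot>\<^bsub>C\<^esub> w = u" "q \<cdot>\<^bsub>C\<^esub> w = v"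
    using lift[of u v] uv by simp blast
  show "\<exists>!w. w \<in> hom C X (Dom C p) \<and> p \<cdot>\<^bsub>C\<^esub> w = u \<and> q \<cdot>\<^bsub>C\<^esub> w = v"
  proof (rule ex1I)
    show "w \<in> hom C X (Dom C p) \<and> p \<cdot>\<^bsub>C\<^esub> w = u \<and> q \<cdot>\<^bsub>C\<^esub> w = v"
      using w(1-3) uv(2) assms(6) by (simp add: w(4,5))
  next
    fix y assume "y \<in> hom C X (Dom C p) \<and> p \<cdot>\<^bsub>C\<^esub> y = u \<and> q \<cdot>\<^bsub>C\<^esub> y = v"
    then show "y = w" using w uv(2) assms(6) by - (rule uniq, auto)
  qed
qed (use assms(1-9) in auto)

lemma orthE:
  assumes "orth C m Y" "u \<in> Arr C" "Dom C u = Dom C m" "Cod C u = Y"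
  obtains v where "v \<in> Arr C" "Dom C v = Cod C m" "Cod C v = Y" "v \<cdot>\<^bsub>C\<^esub> m = u"
proof -
  have "\<exists>!v. v \<in> hom C (Cod C m) Y \<and> v \<cdot>\<^bsub>C\<^esub> m = u"
    using assms(1)[unfolded orth_def, rule_format, of u] assms(2-4) by simp
  then show ?thesis using that by auto
qed

lemma (in category) orth_cancel:
  assumes "orth C m Y" "m \<in> Arr C" "u \<in> Arr C" "Dom C u = Cod C m" "Cod C u = Y"
    "v \<in> Arr C" "Dom C v = Cod C m" "Cod C v = Y" "u \<cdot> m = v \<cdot> m"
  shows "u = v"
proof -
  have "\<exists>!w. w \<in> hom C (Cod C m) Y \<and> w \<cdot> m = u \<cdot> m"
    using assms(1)[unfolded orth_def, rule_format, of "u \<cdot> m"] assms(2-5) by simp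
  moreover have "u \<in> hom C (Cod C m) Y \<and> u \<cdot> m = u \<cdot> m" "v \<in> hom C (Cod C m) Y \<and> v \<cdot> m = u \<cdot> m"
    using assms(3-9) by simp_all
  ultimately show ?thesis by blast
qed

lemma orthI:
  assumes "\<And>u. \<lbrakk>u \<in> Arr C; Dom C u = Dom C m; Cod C u = Y\<rbrakk> \<Longrightarrow>
      \<exists>v. v \<in> Arr C \<and> Dom C v = Cod C m \<and> Cod C v = Y \<and> v \<cdot>\<^bsub>C\<^esub> m = u"
    "\<And>u v. \<lbrakk>u \<in> Arr C; Dom C u = Cod C m; Cod C u = Y;
       v \<in> Arr C; Dom C v = Cod C m; Cod C v = Y; u \<cdot>\<^bsub>C\<^esub> m = v \<cdot>\<^bsub>C\<^esub> m\<rbrakk> \<Longrightarrow> u = v"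
  shows "orth C m Y"
  unfolding orth_def
proof
  fix u assume "u \<in> hom C (Dom C m) Y"
  then have u: "u \<in> Arr C" "Dom C u = Dom C m" "Cod C u = Y" by auto
  obtain v where "v \<in> Arr C" "Dom C v = Cod C m" "Cod C v = Y" "v \<cdot>\<^bsub>C\<^esub> m = u"
    using assms(1)[OF u] by blast
  then show "\<exists>!v. v \<in> hom C (Cod C m) Y \<and> v \<cdot>\<^bsub>C\<^esub> m = u"
    by (intro ex1I[of _ v]) (simp, rule assms(2), auto)
qed

lemma cancelsD:
  assumes "cancels C m Y" "u \<in> Arr C" "Dom C u = Cod C m" "Cod C u = Y"
    "v \<in> Arr C" "Dom C v = Cod C m" "Cod C v = Y" "u \<cdot>\<^bsub>C\<^esub> m = v \<cdot>\<^bsub>C\<^esub> m"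
  shows "u = v"
  using assms(1)[unfolded cancels_def, rule_format, of u v] assms(2-8) by simp

lemma cancelsI:
  assumes "\<And>u v. \<lbrakk>u \<in> Arr C; Dom C u = Cod C m; Cod C u = Y;
       v \<in> Arr C; Dom C v = Cod C m; Cod C v = Y; u \<cdot>\<^bsub>C\<^esub> m = v \<cdot>\<^bsub>C\<^esub> m\<rbrakk> \<Longrightarrow> u = v"
  shows "cancels C m Y"
  unfolding cancels_def by (intro ballI impI) (rule assms, auto)

section \<open>Closure properties of monomorphisms, epimorphisms, orthogonal arrows and
  pullbacks\<close>

context category
begin

lemma orth_imp_cancels: "orth C m Y \<Longrightarrow> m \<in> Arr C \<Longrightarrow> cancels C m Y"
  by (rule cancelsI) (rule orth_cancel)

lemma separated_iff: "separated C j X \<longleftrightarrow> (\<forall>m. dense_mono C j m \<longrightarrow> cancels C m X)"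
proof (intro iffI allI impI)
  fix m assume "separated C j X" and d: "dense_mono C j m"
  then have *: "\<forall>u \<in> hom C (Dom C m) X. \<exists>\<^sub>\<le>\<^sub>1v. v \<in> hom C (Cod C m) X \<and> v \<cdot> m = u"
    by (simp add: separated_def)
  have "m \<in> Arr C" using d by (simp add: dense_mono_def mono_arr_def)
  then show "cancels C m X"
    using * by - (rule cancelsI, rule Uniq_D[of "\<lambda>v. v \<in> hom C (Cod C m) X \<and> v \<cdot> m = _ \<cdot> m"], auto)
next
  assume *: "\<forall>m. dense_mono C j m \<longrightarrow> cancels C m X"
  show "separated C j X"
    unfolding separated_def
  proof (intro allI impI ballI Uniq_I)
    fix m u v w assume "dense_mono C j m" "u \<in> hom C (Dom C m) X"
      "v \<in> hom C (Cod C m) X \<and> v \<cdot> m = u" "w \<in> hom C (Cod C m) X \<and> w \<cdot> m = u"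
    then show "w = v" using * by - (rule cancelsD[of C m X], auto)
  qed
qed

lemma sheaf_iff: "sheaf C j X \<longleftrightarrow> (\<forall>m. dense_mono C j m \<longrightarrow> orth C m X)"
  by (simp add: sheaf_def orth_def)

lemma dense_Arr: "dense_mono C j m \<Longrightarrow> m \<in> Arr C"
  by (simp add: dense_mono_def mono_arr_def)

lemma sheaf_imp_separated: "sheaf C j X \<Longrightarrow> separated C j X"
  by (auto simp: sheaf_iff separated_iff intro: orth_imp_cancels dense_Arr)

lemma is_pullback_sym: "is_pullback C p q f g \<Longrightarrow> is_pullback C q p g f"
proof -
  assume P: "is_pullback C p q f g"
  note p = pbD[OF P]
  show ?thesis
  proof (rule pbI)
    fix u v assume "u \<in> Arr C" "v \<in> Arr C" "Dom C u = Dom C v" "Cod C u = Dom C g"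
      "Cod C v = Dom C f" "g \<cdot> u = f \<cdot> v"
    then obtain w where "w \<in> Arr C" "Dom C w = Dom C u" "Cod C w = Dom C q" "p \<cdot> w = v" "q \<cdot> w = u"
      using pb_lift[OF P, of v u] by auto
    then show "\<exists>w. w \<in> Arr C \<and> Dom C w = Dom C v \<and> Cod C w = Dom C p \<and> q \<cdot> w = u \<and> p \<cdot> w = v"
      using \<open>Dom C u = Dom C v\<close> p by auto
  next
    fix x y assume "x \<in> Arr C" "y \<in> Arr C" "Dom C x = Dom C y" "Cod C x = Dom C p"
      "Cod C y = Dom C p" "q \<cdot> x = q \<cdot> y" "p \<cdot> x = p \<cdot> y"
    then show "x = y" using p by - (rule pb_uniq[OF P], auto)
  qed (use p in auto)
qed

lemma fac_trans:
  assumes "fac C x c" "fac C c d" "c \<in> Arr C" "d \<in> Arr C"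
  shows "fac C x d"
proof -
  obtain u where u: "u \<in> Arr C" "Dom C u = Dom C x" "Cod C u = Dom C c" "c \<cdot> u = x"
    using assms by (elim facE)
  obtain v where v: "v \<in> Arr C" "Dom C v = Dom C c" "Cod C v = Dom C d" "d \<cdot> v = c"
    using assms by (elim facE)
  show ?thesis using u v assms by (intro facI[of "v \<cdot> u"]) (auto simp: v(4)[THEN comp_reassoc])
qed

lemma fac_refl: "x \<in> Arr C \<Longrightarrow> fac C x x"
  by (rule facI[of "Ident C (Dom C x)"]) auto

lemma fac_comp: "x \<in> Arr C \<Longrightarrow> c \<in> Arr C \<Longrightarrow> Cod C x = Dom C c \<Longrightarrow> fac C (c \<cdot> x) c"
  by (rule facI[of x]) auto

lemma fac_comp_right:
  assumes "fac C x c" "x \<in> Arr C" "c \<in> Arr C" "y \<in> Arr C" "Cod C y = Dom C x"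
  shows "fac C (x \<cdot> y) c"
proof -
  obtain u where "u \<in> Arr C" "Dom C u = Dom C x" "Cod C u = Dom C c" "c \<cdot> u = x"
    using assms(1) by (elim facE)
  then show ?thesis
    using assms(2-) by (intro facI[of "u \<cdot> y"]) (auto simp: \<open>c \<cdot> u = x\<close>[THEN comp_reassoc])
qed

lemma mono_comp:
  assumes "mono_arr C m" "mono_arr C n" "Cod C m = Dom C n"
  shows "mono_arr C (n \<cdot> m)"
proof (rule monoI)
  show "n \<cdot> m \<in> Arr C" using assms by (auto simp: mono_Arr)
  fix f g assume a: "f \<in> Arr C" "g \<in> Arr C" "Dom C f = Dom C g" "Cod C f = Dom C (n \<cdot> m)"
    "Cod C g = Dom C (n \<cdot> m)" "n \<cdot> m \<cdot> f = n \<cdot> m \<cdot> g"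
  have "n \<cdot> (m \<cdot> f) = n \<cdot> (m \<cdot> g)"
    using a assms(3) mono_Arr[OF assms(1)] mono_Arr[OF assms(2)] by simp
  then have "m \<cdot> f = m \<cdot> g"
    using a assms by - (rule mono_cancel[OF assms(2)], (auto simp: mono_Arr))
  then show "f = g"
    using a assms by - (rule mono_cancel[OF assms(1)], (auto simp: mono_Arr))
qed

lemma mono_right:
  assumes "mono_arr C (n \<cdot> m)" "Cod C m = Dom C n" "m \<in> Arr C" "n \<in> Arr C"
  shows "mono_arr C m"
proof (rule monoI)
  fix f g assume a: "f \<in> Arr C" "g \<in> Arr C" "Dom C f = Dom C g" "Cod C f = Dom C m"
    "Cod C g = Dom C m" "m \<cdot> f = m \<cdot> g"
  then show "f = g"
    using assms by - (rule mono_cancel[OF assms(1)], auto)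
qed (use assms in auto)

lemma mono_Ident: "A \<in> Obj C \<Longrightarrow> mono_arr C (Ident C A)"
  by (rule monoI) auto

lemma mono_split:
  "m \<in> Arr C \<Longrightarrow> r \<in> Arr C \<Longrightarrow> Dom C r = Cod C m \<Longrightarrow> r \<cdot> m = Ident C (Dom C m) \<Longrightarrow> mono_arr C m"
  by (rule mono_right[of r m]) (auto simp: mono_Ident)

lemma mono_pullback:
  assumes "is_pullback C n q f m" "mono_arr C m"
  shows "mono_arr C n"
proof (rule monoI)
  note p = pbD[OF assms(1)]
  fix x y assume a: "x \<in> Arr C" "y \<in> Arr C" "Dom C x = Dom C y" "Cod C x = Dom C n"
    "Cod C y = Dom C n" "n \<cdot> x = n \<cdot> y"
  have "m \<cdot> (q \<cdot> x) = m \<cdot> (q \<cdot> y)"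
    using a p(1-8) by (simp add: p(9)[symmetric, THEN comp_reassoc])
  then have "q \<cdot> x = q \<cdot> y"
    using a p by - (rule mono_cancel[OF assms(2)], auto)
  then show "x = y" using a p by - (rule pb_uniq[OF assms(1)], auto)
qed (use pbD[OF assms(1)] in auto)

lemma epi_comp:
  assumes "epi_arr C m" "epi_arr C n" "Cod C m = Dom C n"
  shows "epi_arr C (n \<cdot> m)"
proof (rule epiI)
  show "n \<cdot> m \<in> Arr C" using assms by (auto simp: epi_Arr)
  fix f g assume a: "f \<in> Arr C" "g \<in> Arr C" "Cod C f = Cod C g" "Dom C f = Cod C (n \<cdot> m)"
    "Dom C g = Cod C (n \<cdot> m)" "f \<cdot> (n \<cdot> m) = g \<cdot> (n \<cdot> m)"
  have "f \<cdot> n \<cdot> m = g \<cdot> n \<cdot> m"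
    using a assms(3) epi_Arr[OF assms(1)] epi_Arr[OF assms(2)] by simp
  then have "f \<cdot> n = g \<cdot> n"
    using a assms by - (rule epi_cancel[OF assms(1)], (auto simp: epi_Arr))
  then show "f = g"
    using a assms by - (rule epi_cancel[OF assms(2)], (auto simp: epi_Arr))
qed

text \<open>Orthogonality to \<open>Y\<close> means that precomposition is a bijection on arrows
  into \<open>Y\<close>. Hence two-out-of-three holds; this lemma, \<open>orth_right_factor\<close>
  and \<open>orth_left_factor\<close> are its three cases.\<close>

lemma orth_comp:
  assumes "orth C m Y" "orth C n Y" "m \<in> Arr C" "n \<in> Arr C" "Cod C m = Dom C n"
  shows "orth C (n \<cdot> m) Y"
proof (rule orthI)
  fix u assume u: "u \<in> Arr C" "Dom C u = Dom C (n \<cdot> m)" "Cod C u = Y"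
  obtain v where v: "v \<in> Arr C" "Dom C v = Cod C m" "Cod C v = Y" "v \<cdot> m = u"
    using orthE[OF assms(1), of u] u assms by auto
  obtain w where w: "w \<in> Arr C" "Dom C w = Cod C n" "Cod C w = Y" "w \<cdot> n = v"
    using orthE[OF assms(2), of v] v assms by auto
  show "\<exists>w. w \<in> Arr C \<and> Dom C w = Cod C (n \<cdot> m) \<and> Cod C w = Y \<and> w \<cdot> (n \<cdot> m) = u"
    using v w assms by (intro exI[of _ w]) (auto simp: w(4)[THEN comp_reassoc] v(4))
next
  fix f g assume a: "f \<in> Arr C" "g \<in> Arr C" "Cod C f = Y" "Cod C g = Y" "Dom C f = Cod C (n \<cdot> m)"
    "Dom C g = Cod C (n \<cdot> m)" "f \<cdot> (n \<cdot> m) = g \<cdot> (n \<cdot> m)"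
  have "f \<cdot> n \<cdot> m = g \<cdot> n \<cdot> m"
    using a assms by simp
  then have "f \<cdot> n = g \<cdot> n"
    using a assms by - (rule orth_cancel[OF assms(1)], auto)
  then show "f = g"
    using a assms by - (rule orth_cancel[OF assms(2)], auto)
qed

lemma orth_right_factor:
  assumes "orth C (n \<cdot> m) Y" "orth C m Y" "m \<in> Arr C" "n \<in> Arr C" "Cod C m = Dom C n"
  shows "orth C n Y"
proof (rule orthI)
  fix u assume u: "u \<in> Arr C" "Dom C u = Dom C n" "Cod C u = Y"
  obtain w where w: "w \<in> Arr C" "Dom C w = Cod C n" "Cod C w = Y" "w \<cdot> (n \<cdot> m) = u \<cdot> m"
    using orthE[OF assms(1), of "u \<cdot> m"] u assms by auto
  have "w \<cdot> n = u"
    using u w assms by - (rule orth_cancel[OF assms(2)], auto)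
  then show "\<exists>w. w \<in> Arr C \<and> Dom C w = Cod C n \<and> Cod C w = Y \<and> w \<cdot> n = u"
    using w by auto
next
  fix f g assume a: "f \<in> Arr C" "Dom C f = Cod C n" "Cod C f = Y"
    "g \<in> Arr C" "Dom C g = Cod C n" "Cod C g = Y" "f \<cdot> n = g \<cdot> n"
  then show "f = g"
    using assms by - (rule orth_cancel[OF assms(1)], (auto simp: a(7)[THEN comp_reassoc]))
qed

lemma orth_left_factor:
  assumes "orth C (n \<cdot> m) Y" "orth C n Y" "m \<in> Arr C" "n \<in> Arr C" "Cod C m = Dom C n"
  shows "orth C m Y"
proof (rule orthI)
  fix u assume u: "u \<in> Arr C" "Dom C u = Dom C m" "Cod C u = Y"
  obtain w where w: "w \<in> Arr C" "Dom C w = Cod C n" "Cod C w = Y" "w \<cdot> (n \<cdot> m) = u"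
    using orthE[OF assms(1), of "u"] u assms by auto
  then show "\<exists>w. w \<in> Arr C \<and> Dom C w = Cod C m \<and> Cod C w = Y \<and> w \<cdot> m = u"
    using assms by (intro exI[of _ "w \<cdot> n"]) auto
next
  fix f g assume a: "f \<in> Arr C" "Dom C f = Cod C m" "Cod C f = Y"
    "g \<in> Arr C" "Dom C g = Cod C m" "Cod C g = Y" "f \<cdot> m = g \<cdot> m"
  obtain f' where f': "f' \<in> Arr C" "Dom C f' = Cod C n" "Cod C f' = Y" "f' \<cdot> n = f"
    using orthE[OF assms(2), of f] a assms by auto
  obtain g' where g': "g' \<in> Arr C" "Dom C g' = Cod C n" "Cod C g' = Y" "g' \<cdot> n = g"
    using orthE[OF assms(2), of g] a assms by auto
  have "f' \<cdot> n \<cdot> m = g' \<cdot> n \<cdot> m" using f' g' a by simp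
  then have "f' = g'"
    using f' g' a assms by - (rule orth_cancel[OF assms(1)], auto)
  then show "f = g" using f' g' by simp
qed

lemma isoE:
  assumes "iso_arr C f"
  obtains g where "f \<in> Arr C" "g \<in> Arr C" "Dom C g = Cod C f" "Cod C g = Dom C f"
    "g \<cdot> f = Ident C (Dom C f)" "f \<cdot> g = Ident C (Cod C f)"
  using assms by (auto simp: iso_arr_def)

lemma isoI:
  "f \<in> Arr C \<Longrightarrow> g \<in> Arr C \<Longrightarrow> Dom C g = Cod C f \<Longrightarrow> Cod C g = Dom C f \<Longrightarrow>
    g \<cdot> f = Ident C (Dom C f) \<Longrightarrow> f \<cdot> g = Ident C (Cod C f) \<Longrightarrow> iso_arr C f"
  by (auto simp: iso_arr_def)

lemma orth_iso:
  assumes "iso_arr C m" shows "orth C m Y"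
proof -
  obtain g where g: "m \<in> Arr C" "g \<in> Arr C" "Dom C g = Cod C m" "Cod C g = Dom C m"
    "g \<cdot> m = Ident C (Dom C m)" "m \<cdot> g = Ident C (Cod C m)"
    using assms by (elim isoE)
  show ?thesis
  proof (rule orthI)
    fix u assume u: "u \<in> Arr C" "Dom C u = Dom C m" "Cod C u = Y"
    then show "\<exists>v. v \<in> Arr C \<and> Dom C v = Cod C m \<and> Cod C v = Y \<and> v \<cdot> m = u"
      using g by (intro exI[of _ "u \<cdot> g"]) (auto simp flip: u(2))
  next
    fix u v assume u: "u \<in> Arr C" "Dom C u = Cod C m" "Cod C u = Y"
      "v \<in> Arr C" "Dom C v = Cod C m" "Cod C v = Y" "u \<cdot> m = v \<cdot> m"
    have "u = u \<cdot> m \<cdot> g" using u(1-6) g by simp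
    also have "\<dots> = v \<cdot> m \<cdot> g" by (simp only: u(7))
    also have "\<dots> = v" using u(1-6) g by simp
    finally show "u = v" .
  qed
qed

lemma orth_codomain_iso:
  assumes "orth C m X" "iso_arr C f" "Dom C f = X" "m \<in> Arr C"
  shows "orth C m (Cod C f)"
proof -
  obtain g where g: "f \<in> Arr C" "g \<in> Arr C" "Dom C g = Cod C f" "Cod C g = Dom C f"
    "g \<cdot> f = Ident C (Dom C f)" "f \<cdot> g = Ident C (Cod C f)"
    using assms by (elim isoE)
  show ?thesis
  proof (rule orthI)
    fix u assume u: "u \<in> Arr C" "Dom C u = Dom C m" "Cod C u = Cod C f"
    obtain v where v: "v \<in> Arr C" "Dom C v = Cod C m" "Cod C v = X" "v \<cdot> m = g \<cdot> u"
      using orthE[OF assms(1), of "g \<cdot> u"] u g assms by auto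
    have "f \<cdot> v \<cdot> m = (f \<cdot> g) \<cdot> u"
      using u v g(1-4) assms by simp
    also have "\<dots> = u" unfolding g(6) u(3)[symmetric] using u(1) by simp
    finally show "\<exists>v. v \<in> Arr C \<and> Dom C v = Cod C m \<and> Cod C v = Cod C f \<and> v \<cdot> m = u"
      using v g assms by (intro exI[of _ "f \<cdot> v"]) auto
  next
    fix u v assume u: "u \<in> Arr C" "Dom C u = Cod C m" "Cod C u = Cod C f"
      "v \<in> Arr C" "Dom C v = Cod C m" "Cod C v = Cod C f" "u \<cdot> m = v \<cdot> m"
    have "g \<cdot> u = g \<cdot> v"
      using u g assms by - (rule orth_cancel[OF assms(1,4)], auto)
    then have "(f \<cdot> g) \<cdot> u = (f \<cdot> g) \<cdot> v" using u g(1-4) by simp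
    then show "u = v" unfolding g(6) using u(1,4) u(3)[symmetric] u(6) by simp
  qed
qed

lemma iso_mono_retract:
  assumes "mono_arr C m" "s \<in> Arr C" "Dom C s = Cod C m" "Cod C s = Dom C m" "m \<cdot> s = Ident C (Cod C m)"
  shows "iso_arr C m"
proof (rule isoI)
  have m: "m \<in> Arr C" using assms by (simp add: mono_Arr)
  show "s \<cdot> m = Ident C (Dom C m)"
    using assms m by - (rule mono_cancel[OF assms(1)], (auto simp: assms(5)[THEN comp_reassoc]))
qed (use assms in \<open>auto simp: mono_Arr\<close>)

lemma pb_paste:
  assumes "is_pullback C p q f (g \<cdot> h)" "is_pullback C r s f g" "h \<in> Arr C" "Cod C h = Dom C g"
  obtains b where "b \<in> Arr C" "Dom C b = Dom C q" "Cod C b = Dom C s" "r \<cdot> b = p" "s \<cdot> b = h \<cdot> q"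
    "is_pullback C b q s h"
proof -
  note P = pbD[OF assms(1)] and R = pbD[OF assms(2)]
  have "f \<cdot> p = g \<cdot> (h \<cdot> q)" using P R assms by simp
  then obtain b where b: "b \<in> Arr C" "Dom C b = Dom C q" "Cod C b = Dom C s" "r \<cdot> b = p" "s \<cdot> b = h \<cdot> q"
    using pb_lift[OF assms(2), of p "h \<cdot> q"] P R assms by auto
  have "is_pullback C b q s h"
  proof (rule pbI)
    fix u v assume u: "u \<in> Arr C" "v \<in> Arr C" "Dom C u = Dom C v" "Cod C u = Dom C s"
      "Cod C v = Dom C h" "s \<cdot> u = h \<cdot> v"
    have "f \<cdot> (r \<cdot> u) = (g \<cdot> h) \<cdot> v"
      using u P R assms by (simp add: R(9)[THEN comp_reassoc])
    then obtain w where w: "w \<in> Arr C" "Dom C w = Dom C v" "Cod C w = Dom C q" "p \<cdot> w = r \<cdot> u" "q \<cdot> w = v"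
      using pb_lift[OF assms(1), of "r \<cdot> u" v] u P R assms by auto
    have "b \<cdot> w = u"
      using w b u R P assms by - (rule pb_uniq[OF assms(2)], (auto simp: comp_reassoc[OF b(4)] comp_reassoc[OF b(5)]))
    then show "\<exists>w. w \<in> Arr C \<and> Dom C w = Dom C v \<and> Cod C w = Dom C q \<and> b \<cdot> w = u \<and> q \<cdot> w = v"
      using w by auto
  next
    fix x y assume a: "x \<in> Arr C" "y \<in> Arr C" "Dom C x = Dom C y" "Cod C x = Dom C q" "Cod C y = Dom C q"
      "b \<cdot> x = b \<cdot> y" "q \<cdot> x = q \<cdot> y"
    have "r \<cdot> b \<cdot> x = r \<cdot> b \<cdot> y" using a b(1-3) P R by simp
    then show "x = y" using a b P R by - (rule pb_uniq[OF assms(1)], (auto))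
  qed (use b P R assms in auto)
  with b show ?thesis using that by blast
qed

lemma pb_compose:
  assumes "is_pullback C b q s h" "is_pullback C r s f g"
  shows "is_pullback C (r \<cdot> b) q f (g \<cdot> h)"
proof -
  note B = pbD[OF assms(1)] and R = pbD[OF assms(2)]
  show ?thesis
  proof (rule pbI)
    show "f \<cdot> (r \<cdot> b) = g \<cdot> h \<cdot> q" using B R by (simp add: R(9)[THEN comp_reassoc])
  next
    fix u v assume u: "u \<in> Arr C" "v \<in> Arr C" "Dom C u = Dom C v" "Cod C u = Dom C f"
      "Cod C v = Dom C (g \<cdot> h)" "f \<cdot> u = g \<cdot> h \<cdot> v"
    obtain w where w: "w \<in> Arr C" "Dom C w = Dom C v" "Cod C w = Dom C s" "r \<cdot> w = u" "s \<cdot> w = h \<cdot> v"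
      using pb_lift[OF assms(2), of u "h \<cdot> v"] u B R by auto
    obtain z where z: "z \<in> Arr C" "Dom C z = Dom C v" "Cod C z = Dom C q" "b \<cdot> z = w" "q \<cdot> z = v"
      using pb_lift[OF assms(1), of w v] u w B R by auto
    show "\<exists>w. w \<in> Arr C \<and> Dom C w = Dom C v \<and> Cod C w = Dom C q \<and> r \<cdot> b \<cdot> w = u \<and> q \<cdot> w = v"
      using w z B R by (intro exI[of _ z]) auto
  next
    fix x y assume a: "x \<in> Arr C" "y \<in> Arr C" "Dom C x = Dom C y" "Cod C x = Dom C q" "Cod C y = Dom C q"
      "r \<cdot> b \<cdot> x = r \<cdot> b \<cdot> y" "q \<cdot> x = q \<cdot> y"
    have "b \<cdot> x = b \<cdot> y"
      using a B R by - (rule pb_uniq[OF assms(2)], (auto simp: B(9)[THEN comp_reassoc]))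
    then show "x = y" using a B R by - (rule pb_uniq[OF assms(1)], auto)
  qed (use B R in auto)
qed

lemma pb_Ident:
  assumes "f \<in> Arr C"
  shows "is_pullback C (Ident C (Dom C f)) f f (Ident C (Cod C f))"
proof (rule pbI)
  fix u v assume u: "u \<in> Arr C" "v \<in> Arr C" "Dom C u = Dom C v" "Cod C u = Dom C f"
    "Cod C v = Dom C (Ident C (Cod C f))" "f \<cdot> u = Ident C (Cod C f) \<cdot> v"
  have v: "Cod C v = Cod C f" using u assms by simp
  have "Ident C (Cod C f) \<cdot> v = v" unfolding v[symmetric] using u by simp
  moreover have "Ident C (Dom C f) \<cdot> u = u" unfolding u(4)[symmetric] using u by simp
  ultimately show "\<exists>w. w \<in> Arr C \<and> Dom C w = Dom C v \<and> Cod C w = Dom C f \<and>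
      Ident C (Dom C f) \<cdot> w = u \<and> f \<cdot> w = v"
    using u by auto
next
  fix x y assume a: "x \<in> Arr C" "y \<in> Arr C" "Cod C x = Dom C f" "Cod C y = Dom C f"
    "Ident C (Dom C f) \<cdot> x = Ident C (Dom C f) \<cdot> y"
  have "Ident C (Cod C x) \<cdot> x = Ident C (Cod C y) \<cdot> y" using a by simp
  then show "x = y" using a(1,2) by simp
qed (use assms in auto)

end

section \<open>Pullbacks, pushouts and exponentials in a quasitopos\<close>

text \<open>The arrows 0, 1, 2 are the identities, while 3 and 4 run from 0 and 1 to 2. Only an
  identity starts at 2, so in a composable pair at least one arrow is an identity, which justifies
  the two cases of \<open>Comp\<close>.\<close>

definition cospan_shape :: "(nat, nat) cat" where
  "cospan_shape = \<lparr>Obj = {0, 1, 2}, Arr = {0, 1, 2, 3, 4},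
     Dom = (\<lambda>u. if u = 3 then 0 else if u = 4 then 1 else u), Cod = (\<lambda>u. if 3 \<le> u then 2 else u),
     Ident = (\<lambda>i. i), Comp = (\<lambda>g f. if g \<le> 2 then f else g)\<rparr>"

definition cospan_diagram ::
  "('o, 'a) cat \<Rightarrow> 'a \<Rightarrow> 'a \<Rightarrow> (nat, nat, 'o, 'a) functor_data" where
  "cospan_diagram C f g =
     \<lparr>on_obj = (\<lambda>i. if i = 0 then Dom C f else if i = 1 then Dom C g else Cod C f),
      on_arr = (\<lambda>u. if u = 0 then Ident C (Dom C f) else if u = 1 then Ident C (Dom C g)
        else if u = 2 then Ident C (Cod C f) else if u = 3 then f else g)\<rparr>"

lemma category_cospan_shape: "category cospan_shape"
  by unfold_locales (auto simp: cospan_shape_def split: if_splits)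

lemma (in category) is_functor_cospan_diagram:
  assumes "f \<in> Arr C" "g \<in> Arr C" "Cod C f = Cod C g"
  shows "is_functor cospan_shape C (cospan_diagram C f g)"
  using assms unfolding is_functor_def
  by (intro conjI ballI impI) (auto simp: cospan_shape_def cospan_diagram_def split: if_splits)

lemma (in category) has_finite_limits_imp_pullback:
  assumes "has_finite_limits C" "f \<in> Arr C" "g \<in> Arr C" "Cod C f = Cod C g"
  obtains p q where "is_pullback C p q f g"
proof -
  let ?J = cospan_shape and ?F = "cospan_diagram C f g"
  have "finite (Obj ?J)" "finite (Arr ?J)" by (auto simp: cospan_shape_def)
  then obtain N p where lim: "is_limit ?J C ?F N p"
    using assms is_functor_cospan_diagram[of f g] category_cospan_shape
    unfolding has_finite_limits_def by blast
  have cone: "is_cone ?J C ?F N p" using lim by (simp add: is_limit_def)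
  have p: "p 0 \<in> hom C N (Dom C f)" "p 1 \<in> hom C N (Dom C g)" "f \<cdot> p 0 = p 2" "g \<cdot> p 1 = p 2"
    using cone by (auto simp: is_cone_def cospan_shape_def cospan_diagram_def)
  have "is_pullback C (p 0) (p 1) f g"
  proof (rule pbI)
    fix u v assume u: "u \<in> Arr C" "v \<in> Arr C" "Dom C u = Dom C v" "Cod C u = Dom C f"
      "Cod C v = Dom C g" "f \<cdot> u = g \<cdot> v"
    let ?q = "\<lambda>i::nat. if i = 0 then u else if i = 1 then v else f \<cdot> u"
    have "is_cone ?J C ?F (Dom C v) ?q"
      using u assms by (auto simp: is_cone_def cospan_shape_def cospan_diagram_def)
    then have "\<exists>!w. w \<in> hom C (Dom C v) N \<and> (\<forall>i \<in> Obj ?J. p i \<cdot> w = ?q i)"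
      using lim by (simp add: is_limit_def del: hom_iff)
    then obtain w where w: "w \<in> hom C (Dom C v) N" "\<forall>i \<in> Obj ?J. p i \<cdot> w = ?q i" by blast
    have "p 0 \<cdot> w = u" "p 1 \<cdot> w = v"
      using w(2)[rule_format, of 0] w(2)[rule_format, of 1] by (auto simp: cospan_shape_def)
    then show "\<exists>w. w \<in> Arr C \<and> Dom C w = Dom C v \<and> Cod C w = Dom C (p 1) \<and> p 0 \<cdot> w = u \<and> p 1 \<cdot> w = v"
      using w p by auto
  next
    fix x y assume a: "x \<in> Arr C" "y \<in> Arr C" "Dom C x = Dom C y" "Cod C x = Dom C (p 1)"
      "Cod C y = Dom C (p 1)" "p 0 \<cdot> x = p 0 \<cdot> y" "p 1 \<cdot> x = p 1 \<cdot> y"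
    let ?q = "\<lambda>i::nat. p i \<cdot> x"
    have p2: "p 2 \<in> hom C N (Cod C f)" using p assms by (auto simp flip: p(3))
    have "is_cone ?J C ?F (Dom C y) ?q"
      using a(1-5) p assms p2
      by (auto simp: is_cone_def cospan_shape_def cospan_diagram_def p(3)[THEN comp_reassoc] p(4)[unfolded One_nat_def, THEN comp_reassoc])
    then have ex: "\<exists>!w. w \<in> hom C (Dom C y) N \<and> (\<forall>i \<in> Obj ?J. p i \<cdot> w = ?q i)"
      using lim by (simp add: is_limit_def del: hom_iff)
    have "p 2 \<cdot> x = p 2 \<cdot> y"
    proof -
      have "f \<cdot> p 0 \<cdot> x = f \<cdot> p 0 \<cdot> y" using a p(1,2) assms by simp
      then show ?thesis by (simp only: p(3))
    qed
    then have "y \<in> hom C (Dom C y) N \<and> (\<forall>i \<in> Obj ?J. p i \<cdot> y = ?q i)"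
      using a p by (auto simp: cospan_shape_def)
    moreover have "x \<in> hom C (Dom C y) N \<and> (\<forall>i \<in> Obj ?J. p i \<cdot> x = ?q i)"
      using a p by auto
    ultimately show "x = y" using ex by blast
  qed (use p assms in auto)
  then show ?thesis using that by blast
qed

lemma poD:
  assumes "is_pushout C i j f g"
  shows "f \<in> Arr C" "g \<in> Arr C" "i \<in> Arr C" "j \<in> Arr C" "Dom C f = Dom C g"
    "Cod C i = Cod C j" "Dom C i = Cod C f" "Dom C j = Cod C g" "i \<cdot>\<^bsub>C\<^esub> f = j \<cdot>\<^bsub>C\<^esub> g"
  using pbD[OF assms[unfolded is_pushout_def]] by (auto simp: op_cat_def)

lemma po_lift:
  assumes "is_pushout C i j f g" "u \<in> Arr C" "v \<in> Arr C" "Cod C u = Cod C v"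
    "Dom C u = Cod C f" "Dom C v = Cod C g" "u \<cdot>\<^bsub>C\<^esub> f = v \<cdot>\<^bsub>C\<^esub> g"
  obtains w where "w \<in> Arr C" "Cod C w = Cod C v" "Dom C w = Cod C j" "w \<cdot>\<^bsub>C\<^esub> i = u" "w \<cdot>\<^bsub>C\<^esub> j = v"
proof -
  obtain w where "w \<in> Arr (op_cat C)" "Dom (op_cat C) w = Dom (op_cat C) v"
    "Cod (op_cat C) w = Dom (op_cat C) j" "i \<cdot>\<^bsub>op_cat C\<^esub> w = u" "j \<cdot>\<^bsub>op_cat C\<^esub> w = v"
    using pb_lift[OF assms(1)[unfolded is_pushout_def], of u v] assms(2-) by (auto simp: op_cat_def)
  then show ?thesis by (intro that[of w]) (auto simp: op_cat_def)
qed

lemma (in category) po_uniq: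
  assumes "is_pushout C i j f g" "x \<in> Arr C" "y \<in> Arr C" "Cod C x = Cod C y"
    "Dom C x = Cod C j" "Dom C y = Cod C j" "x \<cdot> i = y \<cdot> i" "x \<cdot> j = y \<cdot> j"
  shows "x = y"
proof -
  interpret op: category "op_cat C" by (rule category_op_cat) unfold_locales
  show ?thesis
    using assms(2-) by - (rule op.pb_uniq[OF assms(1)[unfolded is_pushout_def]], auto simp: op_cat_def)
qed

text \<open>Slice arrows are triples that repeat their end points, so the conclusion also identifies
  these redundant components. Together with \<open>pullback_imp_slice_product\<close> it lets
  exponentials of a slice be read as statements about pullbacks.\<close>

lemma (in category) slice_product_imp_pullback:
  assumes "is_product (slice C A) e f P (P', p, e') (Q', q, f')"
  shows "is_pullback C p q e f" "Cod C f = A" "P' = P" "e' = e" "Q' = P" "f' = f" "P = e \<cdot>\<^bsub>C\<^esub> p"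
proof -
  note d = assms[unfolded is_product_def]
  have P: "(P', p, e') \<in> hom (slice C A) P e" "(Q', q, f') \<in> hom (slice C A) P f"
    using d by blast+
  then have eqs: "P' = P" "e' = e" "Q' = P" "f' = f" by (auto simp: slice_def)
  then show "P' = P" "e' = e" "Q' = P" "f' = f" by blast+
  have p: "p \<in> hom C (Dom C P) (Dom C e)" "e \<cdot> p = P" "e \<in> Arr C" "Cod C e = A"
    and q: "q \<in> hom C (Dom C P) (Dom C f)" "f \<cdot> q = P" "f \<in> Arr C" "Cod C f = A"
    using P by (auto simp: slice_def eqs)
  show "Cod C f = A" "P = e \<cdot> p" using p q by auto
  have univ: "\<exists>!h. h \<in> hom (slice C A) X P \<and> (P', p, e') \<cdot>\<^bsub>slice C A\<^esub> h = u \<and> (Q', q, f') \<cdot>\<^bsub>slice C A\<^esub> h = v"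
    if "u \<in> hom (slice C A) X e" "v \<in> hom (slice C A) X f" for X u v
    using d that by blast
  show "is_pullback C p q e f"
  proof (rule pbI)
    fix u v assume a: "u \<in> Arr C" "v \<in> Arr C" "Dom C u = Dom C v" "Cod C u = Dom C e"
      "Cod C v = Dom C f" "e \<cdot> u = f \<cdot> v"
    have "\<exists>!h. h \<in> hom (slice C A) (f \<cdot> v) P \<and> (P', p, e') \<cdot>\<^bsub>slice C A\<^esub> h = (f \<cdot> v, u, e)
         \<and> (Q', q, f') \<cdot>\<^bsub>slice C A\<^esub> h = (f \<cdot> v, v, f)"
      by (rule univ) (use a p q in \<open>auto simp: slice_def\<close>)
    then obtain h where h: "h \<in> hom (slice C A) (f \<cdot> v) P" "(P', p, e') \<cdot>\<^bsub>slice C A\<^esub> h = (f \<cdot> v, u, e)"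
      "(Q', q, f') \<cdot>\<^bsub>slice C A\<^esub> h = (f \<cdot> v, v, f)" by blast
    obtain h1 w h2 where w: "h = (h1, w, h2)" by (cases h)
    have "w \<in> Arr C" "Dom C w = Dom C (f \<cdot> v)" "Cod C w = Dom C P" "p \<cdot> w = u" "q \<cdot> w = v"
      using h by (simp_all add: slice_def w)
    moreover have "Dom C (f \<cdot> v) = Dom C v" using a(2,5) q by simp
    ultimately show "\<exists>w. w \<in> Arr C \<and> Dom C w = Dom C v \<and> Cod C w = Dom C q \<and> p \<cdot> w = u \<and> q \<cdot> w = v"
      using q by (intro exI[of _ w]) simp
  next
    fix x y assume a: "x \<in> Arr C" "y \<in> Arr C" "Dom C x = Dom C y" "Cod C x = Dom C q"
      "Cod C y = Dom C q" "p \<cdot> x = p \<cdot> y" "q \<cdot> x = q \<cdot> y"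
    have ext: "e \<cdot> (p \<cdot> z) = P \<cdot> z" "f \<cdot> (q \<cdot> z) = P \<cdot> z" if "z \<in> Arr C" "Cod C z = Dom C q" for z
      using that p q by (auto simp: q(2)[THEN comp_reassoc] p(2)[THEN comp_reassoc])
    have Py: "P \<cdot> y = P \<cdot> x"
      using a(1-5) ext(1)[of x] ext(1)[of y] a(6) by simp
    have PA: "P \<in> Arr C" "Cod C P = A" using P(1) by (auto simp: slice_def)
    have "\<exists>!h. h \<in> hom (slice C A) (P \<cdot> x) P \<and> (P', p, e') \<cdot>\<^bsub>slice C A\<^esub> h = (P \<cdot> x, p \<cdot> x, e)
         \<and> (Q', q, f') \<cdot>\<^bsub>slice C A\<^esub> h = (P \<cdot> x, q \<cdot> x, f)"
      by (rule univ) (use a(1-5) p(1,3,4) q(1,3,4) PA in \<open>auto simp: slice_def ext\<close>)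
    moreover have "(P \<cdot> x, x, P) \<in> hom (slice C A) (P \<cdot> x) P"
      "(P \<cdot> x, y, P) \<in> hom (slice C A) (P \<cdot> x) P"
      using a(1-5) p(1) q(1) PA by (auto simp: slice_def Py)
    moreover have "(P', p, e') \<cdot>\<^bsub>slice C A\<^esub> (P \<cdot> x, x, P) = (P \<cdot> x, p \<cdot> x, e)"
      "(P', p, e') \<cdot>\<^bsub>slice C A\<^esub> (P \<cdot> x, y, P) = (P \<cdot> x, p \<cdot> x, e)"
      "(Q', q, f') \<cdot>\<^bsub>slice C A\<^esub> (P \<cdot> x, x, P) = (P \<cdot> x, q \<cdot> x, f)"
      "(Q', q, f') \<cdot>\<^bsub>slice C A\<^esub> (P \<cdot> x, y, P) = (P \<cdot> x, q \<cdot> x, f)"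
      by (auto simp: slice_def eqs a(6,7))
    ultimately have "(P \<cdot> x, x, P) = (P \<cdot> x, y, P)" by blast
    then show "x = y" by simp
  qed (use p q in auto)
qed

lemma (in category) pullback_imp_slice_product:
  assumes "is_pullback C r s g f" "Cod C f = A"
  shows "is_product (slice C A) g f (g \<cdot> r) (g \<cdot> r, r, g) (g \<cdot> r, s, f)"
proof -
  note p = pbD[OF assms(1)]
  show ?thesis
    unfolding is_product_def
  proof (intro conjI allI ballI)
    fix X u v assume u: "u \<in> hom (slice C A) X g" and v: "v \<in> hom (slice C A) X f"
    obtain u' where u': "u = (X, u', g)" using u by (auto simp: slice_def)
    obtain v' where v': "v = (X, v', f)" using v by (auto simp: slice_def)
    have a: "u' \<in> Arr C" "v' \<in> Arr C" "Dom C u' = Dom C X" "Dom C v' = Dom C X" "Cod C u' = Dom C g"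
      "Cod C v' = Dom C f" "g \<cdot> u' = X" "f \<cdot> v' = X" "X \<in> Arr C" "Cod C X = A"
      using u v by (auto simp: slice_def u' v')
    obtain w where w: "w \<in> Arr C" "Dom C w = Dom C v'" "Cod C w = Dom C s" "r \<cdot> w = u'" "s \<cdot> w = v'"
      using pb_lift[OF assms(1), of u' v'] a by auto
    show "\<exists>!h. h \<in> hom (slice C A) X (g \<cdot> r) \<and> (g \<cdot> r, r, g) \<cdot>\<^bsub>slice C A\<^esub> h = u \<and>
         (g \<cdot> r, s, f) \<cdot>\<^bsub>slice C A\<^esub> h = v"
    proof (rule ex1I)
      show "(X, w, g \<cdot> r) \<in> hom (slice C A) X (g \<cdot> r) \<and> (g \<cdot> r, r, g) \<cdot>\<^bsub>slice C A\<^esub> (X, w, g \<cdot> r) = u \<and>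
         (g \<cdot> r, s, f) \<cdot>\<^bsub>slice C A\<^esub> (X, w, g \<cdot> r) = v"
        using w a p(1-8) assms(2) by (auto simp: slice_def u' v')
    next
      fix h assume h: "h \<in> hom (slice C A) X (g \<cdot> r) \<and> (g \<cdot> r, r, g) \<cdot>\<^bsub>slice C A\<^esub> h = u \<and>
         (g \<cdot> r, s, f) \<cdot>\<^bsub>slice C A\<^esub> h = v"
      then obtain h' where h': "h = (X, h', g \<cdot> r)" by (auto simp: slice_def)
      have b: "h' \<in> Arr C" "Dom C h' = Dom C X" "Cod C h' = Dom C s" "r \<cdot> h' = u'" "s \<cdot> h' = v'"
        using h p by (auto simp: slice_def h' u' v')
      have "h' = w" using w a b p by - (rule pb_uniq[OF assms(1)], auto)
      then show "h = (X, w, g \<cdot> r)" by (simp add: h')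
    qed
  qed (use p assms(2) in \<open>auto simp: slice_def\<close>)
qed

locale quasitopos_category = category C for C :: "('o, 'a) cat" (structure) +
  assumes quasitopos: "quasitopos C"
begin

lemma pullback_ex:
  assumes "f \<in> Arr C" "g \<in> Arr C" "Cod C f = Cod C g"
  obtains p q where "is_pullback C p q f g"
  using has_finite_limits_imp_pullback[OF _ assms] quasitopos by (auto simp: quasitopos_def)

lemma pushout_ex:
  assumes "f \<in> Arr C" "g \<in> Arr C" "Dom C f = Dom C g"
  obtains i j where "is_pushout C i j f g"
proof -
  interpret op: category "op_cat C" by (rule category_op_cat) unfold_locales
  show ?thesis
    using op.has_finite_limits_imp_pullback[of f g] quasitopos assms that
    by (auto simp: quasitopos_def has_finite_colimits_def is_pushout_def op_cat_def)
qed

lemma product_ex: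
  assumes "A \<in> Obj C" "B \<in> Obj C"
  obtains p q where "is_product C A B (Dom C q) p q" "p \<in> Arr C" "q \<in> Arr C" "Dom C p = Dom C q"
    "Cod C p = A" "Cod C q = B"
proof -
  have "cartesian_closed C" using quasitopos unfolding quasitopos_def by blast
  then obtain P p q where *: "is_product C A B P p q"
    using assms unfolding cartesian_closed_def by blast
  then have "p \<in> hom C P A" "q \<in> hom C P B" by (simp_all add: is_product_def del: hom_iff)
  then show ?thesis using * by (intro that[of q p]) auto
qed

lemma terminal_ex:
  obtains T where "is_terminal C T"
  using quasitopos by (auto simp: quasitopos_def cartesian_closed_def)

end

section \<open>Products, and representability of arrows out of a fibred product\<close>

lemma product_lift:
  assumes "is_product C A B P p q" "f \<in> Arr C" "g \<in> Arr C" "Dom C f = Dom C g" "Cod C f = A" "Cod C g = B"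
  obtains h where "h \<in> Arr C" "Dom C h = Dom C g" "Cod C h = P" "p \<cdot>\<^bsub>C\<^esub> h = f" "q \<cdot>\<^bsub>C\<^esub> h = g"
proof -
  have "\<forall>X. \<forall>f \<in> hom C X A. \<forall>g \<in> hom C X B. \<exists>!h. h \<in> hom C X P \<and> p \<cdot>\<^bsub>C\<^esub> h = f \<and> q \<cdot>\<^bsub>C\<^esub> h = g"
    using assms(1) unfolding is_product_def by blast
  from this[rule_format, of f "Dom C g" g]
  have "\<exists>!h. h \<in> hom C (Dom C g) P \<and> p \<cdot>\<^bsub>C\<^esub> h = f \<and> q \<cdot>\<^bsub>C\<^esub> h = g" using assms(2-) by simp
  then show ?thesis using that by auto
qed

lemma productD:
  assumes "is_product C A B P p q"
  shows "p \<in> Arr C" "q \<in> Arr C" "Dom C p = P" "Dom C q = P" "Cod C p = A" "Cod C q = B" "P \<in> Obj C"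
  using assms by (auto simp: is_product_def)

lemma (in category) product_uniq:
  assumes "is_product C A B P p q" "x \<in> Arr C" "y \<in> Arr C" "Dom C x = Dom C y" "Cod C x = P" "Cod C y = P"
    "p \<cdot> x = p \<cdot> y" "q \<cdot> x = q \<cdot> y"
  shows "x = y"
proof -
  note p = productD[OF assms(1)]
  have "\<forall>X. \<forall>f \<in> hom C X A. \<forall>g \<in> hom C X B. \<exists>!h. h \<in> hom C X P \<and> p \<cdot> h = f \<and> q \<cdot> h = g"
    using assms(1) unfolding is_product_def by blast
  from this[rule_format, of "p \<cdot> x" "Dom C x" "q \<cdot> x"]
  have "\<exists>!h. h \<in> hom C (Dom C x) P \<and> p \<cdot> h = p \<cdot> x \<and> q \<cdot> h = q \<cdot> x" using p assms(2-5) by simp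
  moreover have "x \<in> hom C (Dom C x) P \<and> p \<cdot> x = p \<cdot> x \<and> q \<cdot> x = q \<cdot> x"
    "y \<in> hom C (Dom C x) P \<and> p \<cdot> y = p \<cdot> x \<and> q \<cdot> y = q \<cdot> x"
    using assms p by auto
  ultimately show ?thesis by blast
qed

text \<open>For \<open>f : D \<rightarrow> B\<close>, an arrow \<open>e : E \<rightarrow> B\<close> represents \<open>g \<mapsto> {T \<times>\<^sub>B D \<rightarrow> Y}\<close> on arrows \<open>g : T \<rightarrow> B\<close>.
  The relation \<open>K d r s \<phi>\<close> says that \<open>\<phi>\<close> is the transpose of \<open>d : T \<rightarrow> E\<close> with respect to the
  pullback \<open>(r, s)\<close> of \<open>(e \<cdot> d, f)\<close>.\<close>

definition represents_partial ::
  "('o, 'a) cat \<Rightarrow> 'a \<Rightarrow> 'o \<Rightarrow> 'a \<Rightarrow> ('a \<Rightarrow> 'a \<Rightarrow> 'a \<Rightarrow> 'a \<Rightarrow> bool) \<Rightarrow> bool" where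
  "represents_partial C f Y e K \<longleftrightarrow> e \<in> Arr C \<and> f \<in> Arr C \<and> Cod C e = Cod C f \<and>
   (\<forall>g r s \<phi>. is_pullback C r s g f \<and> \<phi> \<in> hom C (Dom C s) Y \<longrightarrow>
      (\<exists>!d. d \<in> hom C (Dom C g) (Dom C e) \<and> e \<cdot>\<^bsub>C\<^esub> d = g \<and> K d r s \<phi>)) \<and>
   (\<forall>d r s. is_pullback C r s (e \<cdot>\<^bsub>C\<^esub> d) f \<and> d \<in> Arr C \<and> Cod C d = Dom C e \<longrightarrow>
      (\<exists>!\<phi>. \<phi> \<in> hom C (Dom C s) Y \<and> K d r s \<phi>)) \<and>
   (\<forall>d r s \<phi> h r' s' k. K d r s \<phi> \<and> is_pullback C r s (e \<cdot>\<^bsub>C\<^esub> d) f \<and> d \<in> Arr C \<and> Cod C d = Dom C e \<and>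
      \<phi> \<in> hom C (Dom C s) Y \<and> h \<in> hom C (Dom C h) (Dom C d) \<and>
      is_pullback C r' s' (e \<cdot>\<^bsub>C\<^esub> (d \<cdot>\<^bsub>C\<^esub> h)) f \<and> k \<in> hom C (Dom C s') (Dom C s) \<and>
      r \<cdot>\<^bsub>C\<^esub> k = h \<cdot>\<^bsub>C\<^esub> r' \<and> s \<cdot>\<^bsub>C\<^esub> k = s' \<longrightarrow> K (d \<cdot>\<^bsub>C\<^esub> h) r' s' (\<phi> \<cdot>\<^bsub>C\<^esub> k))"

context quasitopos_category
begin

text \<open>Let \<open>A\<close> be the codomain of \<open>f\<close>. The representing arrow is the
  exponential, in the slice over \<open>A\<close>, of the projection
  \<open>Y \<times> A \<rightarrow> A\<close> by \<open>f\<close>: an arrow over \<open>A\<close>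
  into \<open>Y \<times> A\<close> is the same as an arrow into \<open>Y\<close>.\<close>

lemma represents_partial_ex:
  assumes f: "f \<in> Arr C" and Y: "Y \<in> Obj C"
  obtains e K where "represents_partial C f Y e K"
proof -
  let ?A = "Cod C f"
  let ?S = "slice C ?A"
  obtain y \<pi> where prod: "is_product C Y ?A (Dom C \<pi>) y \<pi>"
    and y: "y \<in> Arr C" "\<pi> \<in> Arr C" "Dom C y = Dom C \<pi>" "Cod C y = Y" "Cod C \<pi> = ?A"
    using product_ex[OF Y cod_obj[OF f]] by blast
  have "cartesian_closed ?S" using quasitopos f by (auto simp: quasitopos_def)
  moreover have "f \<in> Obj ?S" "\<pi> \<in> Obj ?S" using f y by (auto simp: slice_def)
  ultimately obtain e P p' q' ev' where exp: "is_exponential ?S f \<pi> e P p' q' ev'"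
    unfolding cartesian_closed_def by blast
  obtain P1 p P2 where p': "p' = (P1, p, P2)" by (cases p')
  obtain Q1 q Q2 where q': "q' = (Q1, q, Q2)" by (cases q')
  have prd: "is_product ?S e f P (P1, p, P2) (Q1, q, Q2)"
    using exp by (simp add: is_exponential_def p' q')
  note pq = slice_product_imp_pullback[OF prd]
  note pb = pq(1)
  note b = pbD[OF pb]
  have "ev' \<in> hom ?S P \<pi>" using exp by (simp add: is_exponential_def del: hom_iff)
  then obtain ev where ev': "ev' = (P, ev, \<pi>)" and ev: "ev \<in> Arr C" "Dom C ev = Dom C q" "Cod C ev = Dom C \<pi>"
    "\<pi> \<cdot> ev = P"
    using pq(7) b by (auto simp: slice_def)
  have univ: "\<exists>!g. g \<in> hom ?S X e \<and> (\<exists>h \<in> hom ?S Q P. p' \<cdot>\<^bsub>?S\<^esub> h = g \<cdot>\<^bsub>?S\<^esub> r \<and> q' \<cdot>\<^bsub>?S\<^esub> h = s \<and> ev' \<cdot>\<^bsub>?S\<^esub> h = f')"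
    if "f' \<in> hom ?S Q \<pi>" "X \<in> Obj ?S" "is_product ?S X f Q r s" for X Q r s f'
    using exp that unfolding is_exponential_def by blast
  \<comment> \<open>The witness \<open>w\<close> is the arrow between fibred products induced by
    \<open>d\<close>. Evaluating along \<open>ev\<close> and projecting to \<open>Y\<close> yields
    the transpose.\<close>
  define K where "K d r s \<phi> \<longleftrightarrow> (\<exists>w \<in> Arr C. Dom C w = Dom C s \<and> Cod C w = Dom C q \<and> p \<cdot> w = d \<cdot> r \<and>
      q \<cdot> w = s \<and> y \<cdot> (ev \<cdot> w) = \<phi>)" for d r s \<phi>
  have "represents_partial C f Y e K"
    unfolding represents_partial_def
  proof (intro conjI allI impI; (elim conjE)?)
    fix g r s \<phi> assume pbg: "is_pullback C r s g f" and \<phi>: "\<phi> \<in> hom C (Dom C s) Y"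
    note c = pbD[OF pbg]
    obtain \<phi>' where \<phi>': "\<phi>' \<in> Arr C" "Dom C \<phi>' = Dom C s" "Cod C \<phi>' = Dom C \<pi>" "y \<cdot> \<phi>' = \<phi>" "\<pi> \<cdot> \<phi>' = g \<cdot> r"
      using product_lift[OF prod, of \<phi> "g \<cdot> r"] \<phi> c(1-8) y by auto
    have F: "(g \<cdot> r, \<phi>', \<pi>) \<in> hom ?S (g \<cdot> r) \<pi>" using \<phi>' c(1-8) y by (auto simp: slice_def)
    have ex: "\<exists>!G. G \<in> hom ?S g e \<and> (\<exists>h \<in> hom ?S (g \<cdot> r) P. p' \<cdot>\<^bsub>?S\<^esub> h = G \<cdot>\<^bsub>?S\<^esub> (g \<cdot> r, r, g) \<and>
        q' \<cdot>\<^bsub>?S\<^esub> h = (g \<cdot> r, s, f) \<and> ev' \<cdot>\<^bsub>?S\<^esub> h = (g \<cdot> r, \<phi>', \<pi>))"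
      using F pullback_imp_slice_product[OF pbg] c by (intro univ) (auto simp: slice_def)
    \<comment> \<open>This translates the universal property of the slice exponential into
      \<open>K\<close>. The arrows \<open>ev \<cdot> w\<close> and \<open>\<phi>'\<close> are
      compared through the two projections \<open>y\<close> and \<open>\<pi>\<close> of the
      product.\<close>
    have iff: "(g, d, e) \<in> hom ?S g e \<and> (\<exists>h \<in> hom ?S (g \<cdot> r) P. p' \<cdot>\<^bsub>?S\<^esub> h = (g, d, e) \<cdot>\<^bsub>?S\<^esub> (g \<cdot> r, r, g) \<and>
        q' \<cdot>\<^bsub>?S\<^esub> h = (g \<cdot> r, s, f) \<and> ev' \<cdot>\<^bsub>?S\<^esub> h = (g \<cdot> r, \<phi>', \<pi>)) \<longleftrightarrow>
       d \<in> hom C (Dom C g) (Dom C e) \<and> e \<cdot> d = g \<and> K d r s \<phi>" (is "?L \<longleftrightarrow> ?R") for d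
    proof
      assume L: ?L
      then have d: "d \<in> Arr C" "Dom C d = Dom C g" "Cod C d = Dom C e" "e \<cdot> d = g"
        by (auto simp: slice_def)
      obtain h where h: "h \<in> hom ?S (g \<cdot> r) P" "p' \<cdot>\<^bsub>?S\<^esub> h = (g, d, e) \<cdot>\<^bsub>?S\<^esub> (g \<cdot> r, r, g)"
        "q' \<cdot>\<^bsub>?S\<^esub> h = (g \<cdot> r, s, f)" "ev' \<cdot>\<^bsub>?S\<^esub> h = (g \<cdot> r, \<phi>', \<pi>)" using L by blast
      obtain w where w: "h = (g \<cdot> r, w, P)" using h(1) by (auto simp: slice_def)
      have "w \<in> Arr C" "Dom C w = Dom C s" "Cod C w = Dom C q" "p \<cdot> w = d \<cdot> r" "q \<cdot> w = s" "ev \<cdot> w = \<phi>'"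
        using h c(1-8) b(1-8) ev(1-3) unfolding w p' q' ev' pq(3-7) by (auto simp: slice_def)
      then have "K d r s \<phi>" unfolding K_def using \<phi>' by (intro bexI[of _ w]) auto
      with d show ?R by auto
    next
      assume R: ?R
      then obtain w where w: "w \<in> Arr C" "Dom C w = Dom C s" "Cod C w = Dom C q" "p \<cdot> w = d \<cdot> r" "q \<cdot> w = s"
        "y \<cdot> (ev \<cdot> w) = \<phi>" by (auto simp: K_def)
      have d: "d \<in> Arr C" "Dom C d = Dom C g" "Cod C d = Dom C e" "e \<cdot> d = g" using R by auto
      have Pw: "P \<cdot> w = g \<cdot> r"
        unfolding pq(7) using b(1-8) w c(1-8) d(1-3) by (simp add: d(4)[THEN comp_reassoc])
      have "\<pi> \<cdot> (ev \<cdot> w) = \<pi> \<cdot> \<phi>'"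
        using \<phi>' ev w Pw y b(1-8) by (simp add: ev(4)[THEN comp_reassoc])
      then have "ev \<cdot> w = \<phi>'"
        using \<phi>' ev(1-3) w y by - (rule product_uniq[OF prod], auto)
      moreover have "P \<in> Arr C" "Dom C P = Dom C q" "Cod C P = Cod C f"
        unfolding pq(7) using b(1-8) by auto
      ultimately show ?L
        using d w Pw c(1-8) b(1-8) unfolding p' q' ev' pq(3-6)
        by (intro conjI bexI[of _ "(g \<cdot> r, w, P)"]) (auto simp: slice_def)
    qed
    show "\<exists>!d. d \<in> hom C (Dom C g) (Dom C e) \<and> e \<cdot> d = g \<and> K d r s \<phi>"
    proof -
      obtain G where G: "G \<in> hom ?S g e \<and> (\<exists>h \<in> hom ?S (g \<cdot> r) P. p' \<cdot>\<^bsub>?S\<^esub> h = G \<cdot>\<^bsub>?S\<^esub> (g \<cdot> r, r, g) \<and>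
        q' \<cdot>\<^bsub>?S\<^esub> h = (g \<cdot> r, s, f) \<and> ev' \<cdot>\<^bsub>?S\<^esub> h = (g \<cdot> r, \<phi>', \<pi>))" using ex by blast
      then obtain d where d: "G = (g, d, e)" by (auto simp: slice_def)
      show ?thesis
      proof (rule ex1I)
        show "d \<in> hom C (Dom C g) (Dom C e) \<and> e \<cdot> d = g \<and> K d r s \<phi>"
          using G unfolding d iff .
        fix d' assume "d' \<in> hom C (Dom C g) (Dom C e) \<and> e \<cdot> d' = g \<and> K d' r s \<phi>"
        then have "(g, d', e) = G" using ex G unfolding iff[symmetric] by blast
        then show "d' = d" by (simp add: d)
      qed
    qed
  next
    fix d r s assume pbd: "is_pullback C r s (e \<cdot> d) f" and d: "d \<in> Arr C" "Cod C d = Dom C e"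
    note c = pbD[OF pbd]
    have "e \<cdot> (d \<cdot> r) = f \<cdot> s" using c d b(1-8) by simp
    then obtain w where w: "w \<in> Arr C" "Dom C w = Dom C s" "Cod C w = Dom C q" "p \<cdot> w = d \<cdot> r" "q \<cdot> w = s"
      using pb_lift[OF pb, of "d \<cdot> r" s] c(1-8) d b(1-8) by auto
    show "\<exists>!\<phi>. \<phi> \<in> hom C (Dom C s) Y \<and> K d r s \<phi>"
    proof (rule ex1I)
      show "y \<cdot> (ev \<cdot> w) \<in> hom C (Dom C s) Y \<and> K d r s (y \<cdot> (ev \<cdot> w))"
        unfolding K_def using w y ev by auto
      fix \<phi> assume "\<phi> \<in> hom C (Dom C s) Y \<and> K d r s \<phi>"
      then obtain v where v: "v \<in> Arr C" "Dom C v = Dom C s" "Cod C v = Dom C q" "p \<cdot> v = d \<cdot> r" "q \<cdot> v = s"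
        "y \<cdot> (ev \<cdot> v) = \<phi>" by (auto simp: K_def)
      have "v = w" using v w by - (rule pb_uniq[OF pb], auto)
      then show "\<phi> = y \<cdot> (ev \<cdot> w)" using v by simp
    qed
  next
    fix d r s \<phi> h r' s' k
    assume K: "K d r s \<phi>" and pbd: "is_pullback C r s (e \<cdot> d) f" and d: "d \<in> Arr C" "Cod C d = Dom C e"
      and h: "h \<in> hom C (Dom C h) (Dom C d)" and pbd': "is_pullback C r' s' (e \<cdot> (d \<cdot> h)) f"
      and k: "k \<in> hom C (Dom C s') (Dom C s)" "r \<cdot> k = h \<cdot> r'" "s \<cdot> k = s'"
    note c = pbD[OF pbd] and c' = pbD[OF pbd']
    obtain w where w: "w \<in> Arr C" "Dom C w = Dom C s" "Cod C w = Dom C q" "p \<cdot> w = d \<cdot> r" "q \<cdot> w = s"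
        "y \<cdot> (ev \<cdot> w) = \<phi>" using K by (auto simp: K_def)
    have "p \<cdot> (w \<cdot> k) = (d \<cdot> h) \<cdot> r'"
      using w(1-3) k(1) c(1-8) c'(1-8) d h b(1-8) by (simp add: w(4)[THEN comp_reassoc] k(2))
    moreover have "q \<cdot> (w \<cdot> k) = s'"
      using w(1-3) k(1) c(1-8) c'(1-8) d h b(1-8) by (simp add: w(5)[THEN comp_reassoc] k(3))
    moreover have "y \<cdot> (ev \<cdot> (w \<cdot> k)) = \<phi> \<cdot> k"
      unfolding w(6)[symmetric] using w(1-3) k(1) ev y by simp
    ultimately show "K (d \<cdot> h) r' s' (\<phi> \<cdot> k)"
      unfolding K_def using w(1-3) k(1) by (intro bexI[of _ "w \<cdot> k"]) auto
  qed (use b in auto)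
  then show ?thesis using that by blast
qed

end

lemma rpD:
  assumes "represents_partial C f Y e K"
  shows "e \<in> Arr C" "f \<in> Arr C" "Cod C e = Cod C f"
  using assms unfolding represents_partial_def by blast+

lemma rp_curry:
  assumes "represents_partial C f Y e K" "is_pullback C r s g f" "\<phi> \<in> Arr C" "Dom C \<phi> = Dom C s" "Cod C \<phi> = Y"
  obtains d where "d \<in> Arr C" "Dom C d = Dom C g" "Cod C d = Dom C e" "e \<cdot>\<^bsub>C\<^esub> d = g" "K d r s \<phi>"
proof -
  have "\<exists>!d. d \<in> hom C (Dom C g) (Dom C e) \<and> e \<cdot>\<^bsub>C\<^esub> d = g \<and> K d r s \<phi>"
    using assms unfolding represents_partial_def by simp
  then show ?thesis using that by auto
qed

lemma rp_curry_uniq: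
  assumes "represents_partial C f Y e K" "is_pullback C r s g f" "\<phi> \<in> Arr C" "Dom C \<phi> = Dom C s" "Cod C \<phi> = Y"
    "d \<in> Arr C" "d' \<in> Arr C" "Dom C d = Dom C g" "Dom C d' = Dom C g" "Cod C d = Dom C e" "Cod C d' = Dom C e"
    "e \<cdot>\<^bsub>C\<^esub> d = g" "e \<cdot>\<^bsub>C\<^esub> d' = g" "K d r s \<phi>" "K d' r s \<phi>"
  shows "d = d'"
proof -
  have "\<exists>!d. d \<in> hom C (Dom C g) (Dom C e) \<and> e \<cdot>\<^bsub>C\<^esub> d = g \<and> K d r s \<phi>"
    using assms(1-5) unfolding represents_partial_def by simp
  moreover have "d \<in> hom C (Dom C g) (Dom C e) \<and> e \<cdot>\<^bsub>C\<^esub> d = g \<and> K d r s \<phi>"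
     "d' \<in> hom C (Dom C g) (Dom C e) \<and> e \<cdot>\<^bsub>C\<^esub> d' = g \<and> K d' r s \<phi>"
    using assms(6-) by simp_all
  ultimately show ?thesis by blast
qed

lemma rp_uncurry:
  assumes "represents_partial C f Y e K" "is_pullback C r s g f" "d \<in> Arr C" "Cod C d = Dom C e" "e \<cdot>\<^bsub>C\<^esub> d = g"
  obtains \<phi> where "\<phi> \<in> Arr C" "Dom C \<phi> = Dom C s" "Cod C \<phi> = Y" "K d r s \<phi>"
proof -
  have "\<exists>!\<phi>. \<phi> \<in> hom C (Dom C s) Y \<and> K d r s \<phi>"
    using assms unfolding represents_partial_def by simp
  then show ?thesis using that by auto
qed

lemma rp_uncurry_uniq:
  assumes "represents_partial C f Y e K" "is_pullback C r s g f" "d \<in> Arr C" "Cod C d = Dom C e" "e \<cdot>\<^bsub>C\<^esub> d = g"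
    "\<phi> \<in> Arr C" "Dom C \<phi> = Dom C s" "Cod C \<phi> = Y" "K d r s \<phi>"
    "\<psi> \<in> Arr C" "Dom C \<psi> = Dom C s" "Cod C \<psi> = Y" "K d r s \<psi>"
  shows "\<phi> = \<psi>"
proof -
  have "\<exists>!\<phi>. \<phi> \<in> hom C (Dom C s) Y \<and> K d r s \<phi>"
    using assms(1-5) unfolding represents_partial_def by simp
  moreover have "\<phi> \<in> hom C (Dom C s) Y \<and> K d r s \<phi>" "\<psi> \<in> hom C (Dom C s) Y \<and> K d r s \<psi>"
    using assms(6-) by simp_all
  ultimately show ?thesis by blast
qed

lemma rp_natural:
  assumes "represents_partial C f Y e K" "is_pullback C r s g f" "d \<in> Arr C" "Cod C d = Dom C e" "e \<cdot>\<^bsub>C\<^esub> d = g"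
    "\<phi> \<in> Arr C" "Dom C \<phi> = Dom C s" "Cod C \<phi> = Y" "K d r s \<phi>"
    "h \<in> Arr C" "Cod C h = Dom C d" "is_pullback C r' s' g' f" "e \<cdot>\<^bsub>C\<^esub> (d \<cdot>\<^bsub>C\<^esub> h) = g'"
    "k \<in> Arr C" "Dom C k = Dom C s'" "Cod C k = Dom C s" "r \<cdot>\<^bsub>C\<^esub> k = h \<cdot>\<^bsub>C\<^esub> r'" "s \<cdot>\<^bsub>C\<^esub> k = s'"
  shows "K (d \<cdot>\<^bsub>C\<^esub> h) r' s' (\<phi> \<cdot>\<^bsub>C\<^esub> k)"
proof -
  have "\<forall>d r s \<phi> h r' s' k. K d r s \<phi> \<and> is_pullback C r s (e \<cdot>\<^bsub>C\<^esub> d) f \<and> d \<in> Arr C \<and> Cod C d = Dom C e \<and>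
      \<phi> \<in> hom C (Dom C s) Y \<and> h \<in> hom C (Dom C h) (Dom C d) \<and>
      is_pullback C r' s' (e \<cdot>\<^bsub>C\<^esub> (d \<cdot>\<^bsub>C\<^esub> h)) f \<and> k \<in> hom C (Dom C s') (Dom C s) \<and>
      r \<cdot>\<^bsub>C\<^esub> k = h \<cdot>\<^bsub>C\<^esub> r' \<and> s \<cdot>\<^bsub>C\<^esub> k = s' \<longrightarrow> K (d \<cdot>\<^bsub>C\<^esub> h) r' s' (\<phi> \<cdot>\<^bsub>C\<^esub> k)"
    using assms(1) unfolding represents_partial_def by blast
  then show ?thesis using assms(2-) by (metis hom_iff)
qed

section \<open>Universal closure operators\<close>

context category
begin

lemma facD_Cod: "fac C x c \<Longrightarrow> c \<in> Arr C \<Longrightarrow> Cod C x = Cod C c"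
  by (auto simp: fac_def)

lemma pb_fac:
  assumes "is_pullback C n q f m" "y \<in> Arr C" "Cod C y = Dom C f"
  shows "fac C y n \<longleftrightarrow> fac C (f \<cdot> y) m"
proof
  note p = pbD[OF assms(1)]
  assume "fac C y n"
  then obtain u where u: "u \<in> Arr C" "Dom C u = Dom C y" "Cod C u = Dom C n" "n \<cdot> u = y"
    by (elim facE)
  have "f \<cdot> y = m \<cdot> (q \<cdot> u)"
    unfolding u(4)[symmetric] using u(1-3) p(1-8) by (simp add: p(9)[THEN comp_reassoc])
  then show "fac C (f \<cdot> y) m"
    using u p assms by (intro facI[of "q \<cdot> u"]) auto
next
  note p = pbD[OF assms(1)]
  assume "fac C (f \<cdot> y) m"
  then obtain u where u: "u \<in> Arr C" "Dom C u = Dom C y" "Cod C u = Dom C m" "m \<cdot> u = f \<cdot> y"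
    using assms p by (elim facE) auto
  obtain w where "w \<in> Arr C" "Dom C w = Dom C u" "Cod C w = Dom C q" "n \<cdot> w = y" "q \<cdot> w = u"
    using pb_lift[OF assms(1), of y u] u assms p(1-8) by auto
  then show "fac C y n" using u p by (intro facI[of w]) auto
qed

text \<open>Converse of \<open>pb_fac\<close> for monomorphisms: the membership criterion at
  \<open>y = n\<close> produces the missing side \<open>q\<close>, and monicity supplies all
  uniqueness.\<close>

lemma pbI_fac:
  assumes n: "mono_arr C n" "Cod C n = Dom C f" and f: "f \<in> Arr C" and m: "mono_arr C m" "Cod C f = Cod C m"
    and fac: "\<And>y. y \<in> Arr C \<Longrightarrow> Cod C y = Dom C f \<Longrightarrow> fac C y n \<longleftrightarrow> fac C (f \<cdot> y) m"
  obtains q where "is_pullback C n q f m"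
proof -
  have nm: "n \<in> Arr C" "m \<in> Arr C" using n m by (auto simp: mono_Arr)
  have "fac C (f \<cdot> n) m" using fac[of n] nm n fac_refl by simp
  then obtain q where q: "q \<in> Arr C" "Dom C q = Dom C n" "Cod C q = Dom C m" "m \<cdot> q = f \<cdot> n"
    using nm f n by (elim facE) auto
  have "is_pullback C n q f m"
  proof (rule pbI)
    fix u v assume u: "u \<in> Arr C" "v \<in> Arr C" "Dom C u = Dom C v" "Cod C u = Dom C f"
      "Cod C v = Dom C m" "f \<cdot> u = m \<cdot> v"
    have "fac C (f \<cdot> u) m" using u nm f m by (simp add: fac_comp)
    then have "fac C u n" using fac u by blast
    then obtain w where w: "w \<in> Arr C" "Dom C w = Dom C u" "Cod C w = Dom C n" "n \<cdot> w = u"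
      by (elim facE)
    have "m \<cdot> (q \<cdot> w) = m \<cdot> v"
      using u(6) q(1-3) w nm f n by (simp add: q(4)[THEN comp_reassoc])
    then have "q \<cdot> w = v" using w(1-3) q(1-3) u(1-5) by - (rule mono_cancel[OF m(1)], auto)
    then show "\<exists>w. w \<in> Arr C \<and> Dom C w = Dom C v \<and> Cod C w = Dom C q \<and> n \<cdot> w = u \<and> q \<cdot> w = v"
      using w u q by auto
  next
    fix x y assume "x \<in> Arr C" "y \<in> Arr C" "Dom C x = Dom C y" "Cod C x = Dom C q"
      "Cod C y = Dom C q" "n \<cdot> x = n \<cdot> y" "q \<cdot> x = q \<cdot> y"
    then show "x = y" using q by - (rule mono_cancel[OF n(1)], auto)
  qed (use q n m nm f in auto)
  then show ?thesis using that by blast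
qed

text \<open>As \<open>e\<close> is monic, an arrow \<open>e \<cdot> y\<close> belongs to
  \<open>e \<cdot> d\<close> exactly when \<open>y\<close> belongs to \<open>d\<close>. This lets
  universality of a closure operator pass from subobjects of \<open>Cod e\<close> to subobjects of
  \<open>Dom e\<close>.\<close>

lemma pb_of_comp:
  assumes "mono_arr C e" "mono_arr C d" "Cod C d = Dom C e"
  obtains q where "is_pullback C d q e (e \<cdot> d)"
proof -
  have a: "e \<in> Arr C" "d \<in> Arr C" using assms by (auto simp: mono_Arr)
  have "fac C y d \<longleftrightarrow> fac C (e \<cdot> y) (e \<cdot> d)" if "y \<in> Arr C" "Cod C y = Dom C e" for y
  proof
    assume "fac C y d"
    then obtain u where "u \<in> Arr C" "Dom C u = Dom C y" "Cod C u = Dom C d" "d \<cdot> u = y" by (elim facE)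
    then show "fac C (e \<cdot> y) (e \<cdot> d)" using that assms a by (intro facI[of u]) auto
  next
    assume "fac C (e \<cdot> y) (e \<cdot> d)"
    then obtain u where u: "u \<in> Arr C" "Dom C u = Dom C (e \<cdot> y)" "Cod C u = Dom C (e \<cdot> d)" "e \<cdot> d \<cdot> u = e \<cdot> y"
      by (elim facE)
    then have "d \<cdot> u = y"
      using that assms a by - (rule mono_cancel[OF assms(1)], auto)
    then show "fac C y d" using u that assms a by (intro facI[of u]) auto
  qed
  then show ?thesis
    using pbI_fac[OF assms(2,3) a(1) mono_comp[OF assms(2,1,3)]] assms a that by auto
qed

text \<open>Two factorizations between monomorphisms are mutually inverse, so isomorphism of
  subobjects reduces to membership in both directions.\<close>

lemma subobj_of_iff:
  assumes "mono_arr C m"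
  shows "n \<in> subobj_of C m \<longleftrightarrow> mono_arr C n \<and> fac C n m \<and> fac C m n"
proof
  assume "n \<in> subobj_of C m"
  then obtain i where n: "mono_arr C n" "Cod C n = Cod C m" and i: "i \<in> hom C (Dom C n) (Dom C m)"
    "iso_arr C i" "n = m \<cdot> i" unfolding subobj_of_def by blast
  obtain g where g: "i \<in> Arr C" "g \<in> Arr C" "Dom C g = Cod C i" "Cod C g = Dom C i"
    "g \<cdot> i = Ident C (Dom C i)" "i \<cdot> g = Ident C (Cod C i)"
    using isoE[OF i(2)] by blast
  have "fac C n m" using i by (intro facI[of i]) auto
  moreover have "fac C m n"
  proof (rule facI[of g])
    have "m \<in> Arr C" "Cod C i = Dom C m" using i(1) assms by (auto simp: mono_Arr)
    then show "n \<cdot> g = m" using g(1-4) by (simp add: i(3) g(6))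
  qed (use g i(1) in auto)
  ultimately show "mono_arr C n \<and> fac C n m \<and> fac C m n" using n by blast
next
  assume a: "mono_arr C n \<and> fac C n m \<and> fac C m n"
  then have nm: "n \<in> Arr C" "m \<in> Arr C" using assms by (auto simp: mono_Arr)
  obtain u where u: "u \<in> Arr C" "Dom C u = Dom C n" "Cod C u = Dom C m" "m \<cdot> u = n"
    using a by (auto elim: facE)
  obtain v where v: "v \<in> Arr C" "Dom C v = Dom C m" "Cod C v = Dom C n" "n \<cdot> v = m"
    using a by (auto elim: facE)
  have "m \<cdot> (u \<cdot> v) = m \<cdot> Ident C (Dom C m)"
    using u(1-3) v nm by (simp add: u(4)[THEN comp_reassoc])
  then have uv: "u \<cdot> v = Ident C (Dom C m)"
    using u v nm by - (rule mono_cancel[OF assms], auto)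
  have "n \<cdot> (v \<cdot> u) = n \<cdot> Ident C (Dom C n)"
    using v(1-3) u nm by (simp add: v(4)[THEN comp_reassoc])
  then have vu: "v \<cdot> u = Ident C (Dom C n)"
    using u v nm a by - (rule mono_cancel[of C n], auto)
  have "iso_arr C u" using u(1-3) v(1-3) uv vu by (intro isoI[of u v]) auto
  moreover have "Cod C n = Cod C m" using a nm facD_Cod by blast
  ultimately show "n \<in> subobj_of C m"
    using a u unfolding subobj_of_def by auto
qed

lemma subobj_of_eq_iff:
  assumes "mono_arr C m" "mono_arr C n"
  shows "subobj_of C m = subobj_of C n \<longleftrightarrow> fac C m n \<and> fac C n m"
proof
  assume "subobj_of C m = subobj_of C n"
  moreover have "m \<in> subobj_of C m"
    using assms by (simp add: subobj_of_iff fac_refl mono_Arr)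
  ultimately show "fac C m n \<and> fac C n m" using assms by (simp add: subobj_of_iff)
next
  assume "fac C m n \<and> fac C n m"
  then have "fac C x m \<longleftrightarrow> fac C x n" "fac C m x \<longleftrightarrow> fac C n x" if "mono_arr C x" for x
    using fac_trans assms that mono_Arr by metis+
  then show "subobj_of C m = subobj_of C n"
    using assms by (auto simp: subobj_of_iff)
qed

lemma subobj_of_eqI:
  "mono_arr C m \<Longrightarrow> mono_arr C n \<Longrightarrow> fac C m n \<Longrightarrow> fac C n m \<Longrightarrow> subobj_of C m = subobj_of C n"
  by (simp add: subobj_of_eq_iff)

lemma subobj_of_eq_fac:
  assumes "mono_arr C m" "mono_arr C n" "Cod C n = Cod C m"
  shows "subobj_of C m = subobj_of C n \<longleftrightarrow> (\<forall>x \<in> Arr C. Cod C x = Cod C m \<longrightarrow> (fac C x m \<longleftrightarrow> fac C x n))"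
proof -
  have "m \<in> Arr C" "n \<in> Arr C" using assms by (auto simp: mono_Arr)
  then show ?thesis
    using assms fac_refl fac_trans unfolding subobj_of_eq_iff[OF assms(1,2)] by metis
qed

lemma subobj_le_iff:
  assumes "mono_arr C m" "mono_arr C n"
  shows "subobj_le C (subobj_of C m) (subobj_of C n) \<longleftrightarrow> fac C m n"
proof
  have mn: "m \<in> Arr C" "n \<in> Arr C" using assms by (auto simp: mono_Arr)
  assume "subobj_le C (subobj_of C m) (subobj_of C n)"
  then obtain m' n' u where *: "m' \<in> subobj_of C m" "n' \<in> subobj_of C n" "u \<in> hom C (Dom C m') (Dom C n')"
    "m' = n' \<cdot> u" unfolding subobj_le_def by blast
  then have a: "mono_arr C m'" "mono_arr C n'" "fac C m m'" "fac C n' n" "fac C m' n'"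
    using assms by (auto simp: subobj_of_iff intro: facI)
  then show "fac C m n" using mn fac_trans mono_Arr by metis
next
  assume "fac C m n"
  then obtain u where "u \<in> Arr C" "Dom C u = Dom C m" "Cod C u = Dom C n" "n \<cdot> u = m" by (elim facE)
  then have "u \<in> hom C (Dom C m) (Dom C n)" "m = n \<cdot> u" by auto
  moreover have "m \<in> subobj_of C m" "n \<in> subobj_of C n"
    using assms by (simp_all add: subobj_of_iff fac_refl mono_Arr)
  ultimately show "subobj_le C (subobj_of C m) (subobj_of C n)"
    unfolding subobj_le_def by blast
qed

lemma sub_pullback_eq:
  assumes "is_pullback C n q f m" "mono_arr C m"
  shows "sub_pullback C f (subobj_of C m) = subobj_of C n"
proof -
  note p = pbD[OF assms(1)]
  have n: "mono_arr C n" by (rule mono_pullback[OF assms])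
  show ?thesis
  proof (intro equalityI subsetI)
    fix x assume "x \<in> sub_pullback C f (subobj_of C m)"
    then obtain m' q' where m': "m' \<in> subobj_of C m" and pb: "is_pullback C x q' f m'"
      unfolding sub_pullback_def by blast
    have m'': "mono_arr C m'" "fac C m m'" "fac C m' m" using m' assms(2) by (auto simp: subobj_of_iff)
    note p' = pbD[OF pb]
    have x: "mono_arr C x" using mono_pullback[OF pb m''(1)] .
    have "fac C (f \<cdot> x) m'" using pb_fac[OF pb, of x] p' fac_refl by simp
    then have "fac C (f \<cdot> x) m" using m'' p' p fac_trans by blast
    then have xn: "fac C x n" using pb_fac[OF assms(1), of x] p' by simp
    have "fac C (f \<cdot> n) m" using pb_fac[OF assms(1), of n] p fac_refl by simp
    then have "fac C (f \<cdot> n) m'" using m'' p' p fac_trans by blast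
    then have nx: "fac C n x" using pb_fac[OF pb, of n] p by simp
    show "x \<in> subobj_of C n" using x xn nx n by (simp add: subobj_of_iff)
  next
    fix x assume "x \<in> subobj_of C n"
    then have x: "mono_arr C x" "fac C x n" "fac C n x" using n by (auto simp: subobj_of_iff)
    have xa: "x \<in> Arr C" using x by (simp add: mono_Arr)
    have "fac C y x \<longleftrightarrow> fac C (f \<cdot> y) m" if "y \<in> Arr C" "Cod C y = Dom C f" for y
      using pb_fac[OF assms(1) that] fac_trans[of y x n] fac_trans[of y n x] x xa p by blast
    moreover have "Cod C x = Dom C f" using facD_Cod[OF x(2)] p by simp
    ultimately obtain q' where "is_pullback C x q' f m"
      using pbI_fac[of x f m] x p assms(2) by auto
    moreover have "m \<in> subobj_of C m" using assms(2) by (simp add: subobj_of_iff fac_refl mono_Arr)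
    ultimately show "x \<in> sub_pullback C f (subobj_of C m)" unfolding sub_pullback_def by blast
  qed
qed

end

section \<open>Closed and dense monomorphisms, and the sheaves they determine\<close>

definition closed_mono :: "('o, 'a) cat \<Rightarrow> ('a set \<Rightarrow> 'a set) \<Rightarrow> 'a \<Rightarrow> bool" where
  "closed_mono C j c \<longleftrightarrow> mono_arr C c \<and> j (subobj_of C c) = subobj_of C c"

text \<open>Closure operators are treated over pullbacks alone, because the theory is applied twice:
  to the quasitopos itself and to its category of separated objects.\<close>

locale pullback_category = category C for C :: "('o, 'a) cat" (structure) +
  assumes pb_exists: "f \<in> Arr C \<Longrightarrow> g \<in> Arr C \<Longrightarrow> Cod C f = Cod C g \<Longrightarrow> \<exists>p q. is_pullback C p q f g"

locale closure_category = pullback_category +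
  fixes j :: "'a set \<Rightarrow> 'a set"
  assumes universal: "universal_closure C j"
begin

lemma closed_mono_Arr: "closed_mono C j c \<Longrightarrow> c \<in> Arr C"
  by (simp add: closed_mono_def mono_Arr)

lemma closed_monoD: "closed_mono C j c \<Longrightarrow> mono_arr C c"
  by (simp add: closed_mono_def)

lemma dense_monoD: "dense_mono C j c \<Longrightarrow> mono_arr C c"
  by (simp add: dense_mono_def)

lemma Sub_mem: "mono_arr C m \<Longrightarrow> subobj_of C m \<in> Sub C (Cod C m)"
  unfolding Sub_def by blast

lemma closure_rep:
  assumes "mono_arr C m"
  obtains c where "closed_mono C j c" "Cod C c = Cod C m" "j (subobj_of C m) = subobj_of C c" "fac C m c"
proof -
  have A: "Cod C m \<in> Obj C" using assms by (simp add: mono_Arr)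
  have co: "\<forall>A \<in> Obj C. \<forall>x \<in> Sub C A. j x \<in> Sub C A \<and> subobj_le C x (j x) \<and> j (j x) = j x"
    using universal unfolding universal_closure_def closure_operator_def by blast
  have *: "j (subobj_of C m) \<in> Sub C (Cod C m)" "subobj_le C (subobj_of C m) (j (subobj_of C m))"
    "j (j (subobj_of C m)) = j (subobj_of C m)"
    using co A Sub_mem[OF assms] by blast+
  obtain c where c: "mono_arr C c" "Cod C c = Cod C m" "j (subobj_of C m) = subobj_of C c"
    using *(1) unfolding Sub_def by blast
  show ?thesis
  proof (rule that[of c])
    show "fac C m c" using *(2) c assms by (simp add: subobj_le_iff)
  qed (use c * in \<open>auto simp: closed_mono_def\<close>)
qed

lemma closure_mono:
  assumes "fac C m n" "mono_arr C m" "mono_arr C n"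
    "j (subobj_of C m) = subobj_of C c" "j (subobj_of C n) = subobj_of C d" "mono_arr C c" "mono_arr C d"
  shows "fac C c d"
proof -
  have co: "\<forall>A \<in> Obj C. \<forall>x \<in> Sub C A. \<forall>y \<in> Sub C A. subobj_le C x y \<longrightarrow> subobj_le C (j x) (j y)"
    using universal unfolding universal_closure_def closure_operator_def by blast
  have eq: "Cod C m = Cod C n" using facD_Cod[OF assms(1)] assms by (simp add: mono_Arr)
  have "Cod C m \<in> Obj C" using assms by (simp add: mono_Arr)
  moreover have "subobj_of C m \<in> Sub C (Cod C m)" "subobj_of C n \<in> Sub C (Cod C m)"
    using Sub_mem[OF assms(2)] Sub_mem[OF assms(3)] eq by auto
  ultimately have "subobj_le C (j (subobj_of C m)) (j (subobj_of C n))"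
    using co assms(1-3) by (simp add: subobj_le_iff)
  then show ?thesis using assms by (simp add: subobj_le_iff)
qed

lemma closure_pullback:
  assumes "mono_arr C m" "j (subobj_of C m) = subobj_of C c" "mono_arr C c"
    "is_pullback C m' q f m" "is_pullback C c' q' f c"
  shows "j (subobj_of C m') = subobj_of C c'"
proof -
  note p = pbD[OF assms(4)]
  have u: "\<forall>f \<in> Arr C. \<forall>x \<in> Sub C (Cod C f). sub_pullback C f (j x) = j (sub_pullback C f x)"
    using universal unfolding universal_closure_def by blast
  have "subobj_of C m \<in> Sub C (Cod C f)" using Sub_mem[OF assms(1)] p by simp
  then have "sub_pullback C f (j (subobj_of C m)) = j (sub_pullback C f (subobj_of C m))"
    using u p by blast
  then show ?thesis
    using sub_pullback_eq[OF assms(4,1)] sub_pullback_eq[OF assms(5,3)] assms(2) by simp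
qed

lemma closed_pullback:
  assumes "closed_mono C j c" "is_pullback C n q f c"
  shows "closed_mono C j n"
  using closure_pullback[of c c, OF _ _ _ assms(2,2)] mono_pullback[OF assms(2)] assms(1)
  by (simp add: closed_mono_def)

lemma dense_pullback:
  assumes "dense_mono C j d" "is_pullback C n q f d"
  shows "dense_mono C j n"
proof -
  note p = pbD[OF assms(2)]
  have d: "mono_arr C d" "j (subobj_of C d) = subobj_of C (Ident C (Cod C d))"
    using assms(1) by (auto simp: dense_mono_def)
  have "is_pullback C (Ident C (Dom C f)) f f (Ident C (Cod C d))"
    using pb_Ident[OF p(1)] p by simp
  then have "j (subobj_of C n) = subobj_of C (Ident C (Dom C f))"
    using closure_pullback[OF d(1,2) _ assms(2)] p by (simp add: mono_Ident)
  then show ?thesis using mono_pullback[OF assms(2) d(1)] p by (simp add: dense_mono_def)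
qed

text \<open>The pullback of \<open>c\<close> along \<open>v\<close> is closed and contains the dense
  \<open>d\<close>, so it is the whole object. This is the diagonal fill-in between dense and closed
  monomorphisms.\<close>

lemma dense_fac_closed:
  assumes "dense_mono C j d" "closed_mono C j c" "v \<in> Arr C" "Dom C v = Cod C d" "Cod C v = Cod C c"
    "fac C (v \<cdot> d) c"
  shows "fac C v c"
proof -
  have a: "c \<in> Arr C" "d \<in> Arr C" "mono_arr C d" "j (subobj_of C d) = subobj_of C (Ident C (Cod C d))"
    using assms by (auto simp: closed_mono_Arr dense_mono_def mono_Arr)
  obtain c' q where pb: "is_pullback C c' q v c" using pb_exists[of v c] assms a by auto
  note p = pbD[OF pb]
  have c': "mono_arr C c'" "j (subobj_of C c') = subobj_of C c'"
    using closed_pullback[OF assms(2) pb] by (auto simp: closed_mono_def)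
  have "fac C d c'" using pb_fac[OF pb, of d] a assms by simp
  then have "fac C (Ident C (Cod C d)) c'"
    using closure_mono[OF _ a(3) c'(1) a(4) c'(2) _ c'(1)] a by (simp add: mono_Ident)
  then have "fac C (v \<cdot> Ident C (Cod C d)) c"
    using pb_fac[OF pb, of "Ident C (Cod C d)"] assms a by simp
  then show ?thesis using assms by simp
qed

lemma dense_iff:
  assumes "mono_arr C m"
  shows "dense_mono C j m \<longleftrightarrow>
    (\<forall>c. closed_mono C j c \<longrightarrow> fac C m c \<longrightarrow> fac C (Ident C (Cod C m)) c)"
proof (intro iffI allI impI)
  fix c assume a: "dense_mono C j m" "closed_mono C j c" "fac C m c"
  have m: "m \<in> Arr C" using assms by (simp add: mono_Arr)
  have "Cod C m = Cod C c" using facD_Cod[OF a(3)] closed_mono_Arr[OF a(2)] by simp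
  then show "fac C (Ident C (Cod C m)) c"
    using dense_fac_closed[OF a(1,2), of "Ident C (Cod C m)"] a(3) m closed_mono_Arr[OF a(2)] by simp
next
  assume a: "\<forall>c. closed_mono C j c \<longrightarrow> fac C m c \<longrightarrow> fac C (Ident C (Cod C m)) c"
  obtain c where c: "closed_mono C j c" "Cod C c = Cod C m" "j (subobj_of C m) = subobj_of C c" "fac C m c"
    using closure_rep[OF assms] .
  have m: "m \<in> Arr C" using assms by (simp add: mono_Arr)
  have ca: "c \<in> Arr C" "mono_arr C c" using c closed_mono_Arr closed_monoD by auto
  have "fac C c (Ident C (Cod C m))" using m ca c by (intro facI[of c]) auto
  then have "subobj_of C c = subobj_of C (Ident C (Cod C m))"
    using a c ca m by (intro subobj_of_eqI) (auto simp: mono_Ident)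
  then show "dense_mono C j m" using c assms by (simp add: dense_mono_def)
qed

lemma dense_comp:
  assumes "dense_mono C j d" "dense_mono C j e" "Cod C d = Dom C e"
  shows "dense_mono C j (e \<cdot> d)"
proof -
  have a: "d \<in> Arr C" "e \<in> Arr C" "mono_arr C d" "mono_arr C e"
    using assms by (auto simp: dense_mono_def mono_Arr)
  show ?thesis
    unfolding dense_iff[OF mono_comp[OF a(3,4) assms(3)]]
  proof (intro allI impI)
    fix c assume c: "closed_mono C j c" "fac C (e \<cdot> d) c"
    have "Cod C e = Cod C c" using facD_Cod[OF c(2)] closed_mono_Arr[OF c(1)] a assms by simp
    then have "fac C e c" using dense_fac_closed[OF assms(1) c(1) a(2)] c assms by simp
    then show "fac C (Ident C (Cod C (e \<cdot> d))) c"
      using assms(2) c a assms(3) unfolding dense_iff[OF a(4)] by simp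
  qed
qed

lemma dense_left:
  assumes "dense_mono C j (e \<cdot> d)" "mono_arr C e" "d \<in> Arr C" "Cod C d = Dom C e"
  shows "dense_mono C j d"
proof -
  have m: "mono_arr C (e \<cdot> d)" using assms(1) by (simp add: dense_mono_def)
  have e: "e \<in> Arr C" using assms by (simp add: mono_Arr)
  have d: "mono_arr C d" using mono_right[OF m] assms e by simp
  obtain q where "is_pullback C d q e (e \<cdot> d)" using pb_of_comp[OF assms(2) d assms(4)] .
  then show ?thesis using dense_pullback[OF assms(1)] by blast
qed

lemma factorization:
  assumes "mono_arr C m"
  obtains c d where "closed_mono C j c" "dense_mono C j d" "Cod C d = Dom C c" "Dom C d = Dom C m"
    "Cod C c = Cod C m" "c \<cdot> d = m" "j (subobj_of C m) = subobj_of C c"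
proof -
  obtain c where c: "closed_mono C j c" "Cod C c = Cod C m" "j (subobj_of C m) = subobj_of C c" "fac C m c"
    using closure_rep[OF assms] .
  obtain d where d: "d \<in> Arr C" "Dom C d = Dom C m" "Cod C d = Dom C c" "c \<cdot> d = m"
    using c(4) by (elim facE)
  have ca: "c \<in> Arr C" "mono_arr C c" using c closed_mono_Arr closed_monoD by auto
  have dm: "mono_arr C d" using mono_right[of c d] d ca assms by simp
  \<comment> \<open>Universality is used along \<open>c\<close>: there \<open>m\<close> pulls back
    to \<open>d\<close> and \<open>c\<close> to an identity, so the closure of \<open>d\<close> is
    everything.\<close>
  obtain q where pb: "is_pullback C d q c m" using pb_of_comp[OF ca(2) dm d(3)] d(4) by auto
  obtain q' where "is_pullback C (Ident C (Dom C c)) q' c (c \<cdot> Ident C (Dom C c))"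
    using pb_of_comp[OF ca(2) mono_Ident, of "Dom C c"] ca by auto
  then have "is_pullback C (Ident C (Dom C c)) q' c c" using ca by simp
  then have "j (subobj_of C d) = subobj_of C (Ident C (Dom C c))"
    using closure_pullback[OF assms c(3) ca(2) pb] by blast
  then have "dense_mono C j d" using dm d by (simp add: dense_mono_def)
  then show ?thesis using that c d by blast
qed

lemma separated_jointly_mono:
  assumes "p \<in> Arr C" "q \<in> Arr C" "Dom C p = Dom C q"
    "\<And>x y. x \<in> Arr C \<Longrightarrow> y \<in> Arr C \<Longrightarrow> Dom C x = Dom C y \<Longrightarrow> Cod C x = Dom C q \<Longrightarrow> Cod C y = Dom C q \<Longrightarrow>
      p \<cdot> x = p \<cdot> y \<Longrightarrow> q \<cdot> x = q \<cdot> y \<Longrightarrow> x = y"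
    "separated C j (Cod C p)" "separated C j (Cod C q)"
  shows "separated C j (Dom C q)"
  unfolding separated_iff
proof (intro allI impI)
  fix m assume m: "dense_mono C j m"
  have ma: "m \<in> Arr C" using m by (rule dense_Arr)
  have c: "cancels C m (Cod C p)" "cancels C m (Cod C q)" using assms m by (auto simp: separated_iff)
  show "cancels C m (Dom C q)"
  proof (rule cancelsI)
    fix u v assume a: "u \<in> Arr C" "Dom C u = Cod C m" "Cod C u = Dom C q"
      "v \<in> Arr C" "Dom C v = Cod C m" "Cod C v = Dom C q" "u \<cdot> m = v \<cdot> m"
    have "p \<cdot> u = p \<cdot> v" using a ma assms(1-3) by - (rule cancelsD[OF c(1)], auto)
    moreover have "q \<cdot> u = q \<cdot> v" using a ma assms(1-3) by - (rule cancelsD[OF c(2)], auto)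
    ultimately show "u = v" using assms(4) a by simp
  qed
qed

lemma separated_pullback:
  assumes "is_pullback C p q f g" "separated C j (Dom C f)" "separated C j (Dom C g)"
  shows "separated C j (Dom C q)"
  using pbD[OF assms(1)] assms(2,3)
  by - (rule separated_jointly_mono[of p q], auto intro: pb_uniq[OF assms(1)])

lemma separated_mono:
  assumes "mono_arr C n" "separated C j (Cod C n)"
  shows "separated C j (Dom C n)"
  using mono_Arr[OF assms(1)] assms(2)
  by - (rule separated_jointly_mono[of n n], auto intro: mono_cancel[OF assms(1)])

text \<open>An extension exists in the ambient sheaf, and it lands in the closed subobject because
  its restriction to the dense part does.\<close>

lemma sheaf_closed_mono:
  assumes "closed_mono C j c" "sheaf C j (Cod C c)"
  shows "sheaf C j (Dom C c)"
  unfolding sheaf_iff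
proof (intro allI impI)
  fix m assume m: "dense_mono C j m"
  have ma: "m \<in> Arr C" using m by (rule dense_Arr)
  have ca: "c \<in> Arr C" "mono_arr C c" using assms closed_mono_Arr closed_monoD by auto
  have o: "orth C m (Cod C c)" using assms(2) m by (simp add: sheaf_iff)
  show "orth C m (Dom C c)"
  proof (rule orthI)
    fix u assume u: "u \<in> Arr C" "Dom C u = Dom C m" "Cod C u = Dom C c"
    obtain v where v: "v \<in> Arr C" "Dom C v = Cod C m" "Cod C v = Cod C c" "v \<cdot> m = c \<cdot> u"
      using orthE[OF o, of "c \<cdot> u"] u ca by auto
    have "fac C (v \<cdot> m) c" using v u ca by (simp add: fac_comp)
    then have "fac C v c" using dense_fac_closed[OF m assms(1) v(1-3)] by simp
    then obtain w where w: "w \<in> Arr C" "Dom C w = Dom C v" "Cod C w = Dom C c" "c \<cdot> w = v" by (elim facE)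
    have "c \<cdot> (w \<cdot> m) = c \<cdot> u" using w v u ma ca by (simp add: w(4)[THEN comp_reassoc])
    then have "w \<cdot> m = u" using w v u ma ca by - (rule mono_cancel[OF ca(2)], auto)
    then show "\<exists>v. v \<in> Arr C \<and> Dom C v = Cod C m \<and> Cod C v = Dom C c \<and> v \<cdot> m = u"
      using w v by auto
  next
    fix u v assume a: "u \<in> Arr C" "Dom C u = Cod C m" "Cod C u = Dom C c"
      "v \<in> Arr C" "Dom C v = Cod C m" "Cod C v = Dom C c" "u \<cdot> m = v \<cdot> m"
    have "c \<cdot> u = c \<cdot> v" using a ma ca by - (rule orth_cancel[OF o ma], auto)
    then show "u = v" using a by - (rule mono_cancel[OF ca(2)], auto)
  qed
qed

end

text \<open>The closure of \<open>m\<close> is the closed part of its dense-closed factorization,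
  and the fill-in property makes that part unique. If the dense classes coincide, each of the two
  closures therefore contains the other.\<close>

lemma (in pullback_category) universal_closure_unique:
  assumes "universal_closure C j" "universal_closure C k"
    "\<And>m. dense_mono C j m \<longleftrightarrow> dense_mono C k m"
  shows "j = k"
proof -
  interpret J: closure_category C j by unfold_locales fact
  interpret K: closure_category C k by unfold_locales fact
  have "j (subobj_of C m) = k (subobj_of C m)" if m: "mono_arr C m" for m
  proof -
    obtain c d where c: "closed_mono C j c" "dense_mono C j d" "Cod C d = Dom C c" "Dom C d = Dom C m"
      "Cod C c = Cod C m" "c \<cdot> d = m" "j (subobj_of C m) = subobj_of C c"
      using J.factorization[OF m] .
    obtain c' d' where c': "closed_mono C k c'" "dense_mono C k d'" "Cod C d' = Dom C c'" "Dom C d' = Dom C m"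
      "Cod C c' = Cod C m" "c' \<cdot> d' = m" "k (subobj_of C m) = subobj_of C c'"
      using K.factorization[OF m] .
    have a: "c \<in> Arr C" "c' \<in> Arr C" "d \<in> Arr C" "d' \<in> Arr C" "mono_arr C c" "mono_arr C c'"
      using c c' by (auto simp: closed_mono_def dense_mono_def mono_Arr)
    have "dense_mono C k d" "dense_mono C j d'" using c c' assms(3) by auto
    moreover have "fac C (c \<cdot> d) c'" "fac C (c' \<cdot> d') c"
      using fac_comp[of d c] fac_comp[of d' c'] a c c' by simp_all
    ultimately have "fac C c c'" "fac C c' c"
      using K.dense_fac_closed[OF _ c'(1), of d c] J.dense_fac_closed[OF _ c(1), of d' c'] a c c' by auto
    then show ?thesis using c c' a by (simp add: subobj_of_eq_iff)
  qed
  then have eq: "j x = k x" if "x \<in> (\<Union>A \<in> Obj C. Sub C A)" for x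
    using that unfolding Sub_def by auto
  have "j \<in> extensional (\<Union>A \<in> Obj C. Sub C A)" "k \<in> extensional (\<Union>A \<in> Obj C. Sub C A)"
    using assms(1,2) unfolding universal_closure_def closure_operator_def by blast+
  then show "j = k" using eq by (rule extensionalityI)
qed

text \<open>The predicate \<open>F m x\<close> reads: \<open>x\<close> factors through the closure of \<open>m\<close>.\<close>

lemma (in pullback_category) universal_closure_ex:
  assumes rep: "\<And>m. mono_arr C m \<Longrightarrow>
      \<exists>c. mono_arr C c \<and> Cod C c = Cod C m \<and> (\<forall>x \<in> Arr C. Cod C x = Cod C m \<longrightarrow> (fac C x c \<longleftrightarrow> F m x))"
    and infl: "\<And>m. mono_arr C m \<Longrightarrow> F m m"
    and mono: "\<And>m n x. \<lbrakk>mono_arr C m; mono_arr C n; fac C m n; x \<in> Arr C; Cod C x = Cod C m; F m x\<rbrakk> \<Longrightarrow> F n x"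
    and idem: "\<And>m c x. \<lbrakk>mono_arr C m; mono_arr C c; Cod C c = Cod C m;
        \<forall>x \<in> Arr C. Cod C x = Cod C m \<longrightarrow> (fac C x c \<longleftrightarrow> F m x); x \<in> Arr C; Cod C x = Cod C m; F c x\<rbrakk> \<Longrightarrow> F m x"
    and univ: "\<And>m n q f y. \<lbrakk>mono_arr C m; mono_arr C n; is_pullback C n q f m; y \<in> Arr C; Cod C y = Dom C f\<rbrakk> \<Longrightarrow>
        F n y \<longleftrightarrow> F m (f \<cdot> y)"
  obtains j where "universal_closure C j"
    "\<And>m c. \<lbrakk>mono_arr C m; mono_arr C c; Cod C c = Cod C m\<rbrakk> \<Longrightarrow>
      j (subobj_of C m) = subobj_of C c \<longleftrightarrow> (\<forall>x \<in> Arr C. Cod C x = Cod C m \<longrightarrow> (fac C x c \<longleftrightarrow> F m x))"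
proof -
  define cl where "cl m = (SOME c. mono_arr C c \<and> Cod C c = Cod C m \<and>
    (\<forall>x \<in> Arr C. Cod C x = Cod C m \<longrightarrow> (fac C x c \<longleftrightarrow> F m x)))" for m
  have cl: "mono_arr C (cl m)" "Cod C (cl m) = Cod C m"
    "\<And>x. x \<in> Arr C \<Longrightarrow> Cod C x = Cod C m \<Longrightarrow> fac C x (cl m) \<longleftrightarrow> F m x" if "mono_arr C m" for m
    using someI_ex[OF rep[OF that]] unfolding cl_def by blast+
  \<comment> \<open>A representative of the class is picked arbitrarily; \<open>F_cong\<close> shows
    that the choice does not matter. The value \<open>undefined\<close> elsewhere is what
    extensionality prescribes.\<close>
  define j where "j x = (if x \<in> (\<Union>A \<in> Obj C. Sub C A)
      then subobj_of C (cl (SOME m. mono_arr C m \<and> x = subobj_of C m)) else undefined)" for x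
  have Sub: "subobj_of C m \<in> (\<Union>A \<in> Obj C. Sub C A)" if "mono_arr C m" for m
    using that unfolding Sub_def by (auto simp: mono_Arr)
  have F_cong: "F m x \<longleftrightarrow> F n x"
    if "mono_arr C m" "mono_arr C n" "subobj_of C m = subobj_of C n" "x \<in> Arr C" "Cod C x = Cod C m" for m n x
  proof -
    have f: "fac C m n" "fac C n m" using that by (auto simp: subobj_of_eq_iff)
    have "Cod C m = Cod C n" using facD_Cod[OF f(1)] that(2) by (simp add: mono_Arr)
    then show ?thesis using mono[of m n x] mono[of n m x] that f by auto
  qed
  have j: "j (subobj_of C m) = subobj_of C (cl m)" if m: "mono_arr C m" for m
  proof -
    let ?n = "SOME n. mono_arr C n \<and> subobj_of C m = subobj_of C n"
    have n: "mono_arr C ?n \<and> subobj_of C m = subobj_of C ?n"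
      by (rule someI[of _ m]) (use m in blast)
    then have c: "Cod C ?n = Cod C m"
      using facD_Cod[of ?n m] m subobj_of_eq_iff[of m ?n] by (simp add: mono_Arr)
    have "subobj_of C (cl ?n) = subobj_of C (cl m)"
      using cl[OF m] cl[of ?n] n c F_cong[OF m, of ?n] m by (subst subobj_of_eq_fac) auto
    then show ?thesis using Sub[OF m] by (simp add: j_def)
  qed
  have iff: "j (subobj_of C m) = subobj_of C c \<longleftrightarrow>
     (\<forall>x \<in> Arr C. Cod C x = Cod C m \<longrightarrow> (fac C x c \<longleftrightarrow> F m x))"
    if "mono_arr C m" "mono_arr C c" "Cod C c = Cod C m" for m c
    unfolding j[OF that(1)] using that cl[OF that(1)] by (subst subobj_of_eq_fac) auto
  have "universal_closure C j"
    unfolding universal_closure_def closure_operator_def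
  proof (intro conjI ballI impI)
    show "j \<in> extensional (\<Union>A \<in> Obj C. Sub C A)" by (simp add: j_def extensional_def)
  next
    fix A x assume "x \<in> Sub C A"
    then obtain m where m: "mono_arr C m" "Cod C m = A" "x = subobj_of C m" by (auto simp: Sub_def)
    note c = cl[OF m(1)]
    have ma: "m \<in> Arr C" using m by (simp add: mono_Arr)
    show "j x \<in> Sub C A" using m j[OF m(1)] c by (auto simp: Sub_def)
    show "subobj_le C x (j x)"
      using m j[OF m(1)] c infl[OF m(1)] ma by (simp add: subobj_le_iff)
    have f: "fac C m (cl m)" using c(3)[of m] ma infl[OF m(1)] by simp
    have "subobj_of C (cl (cl m)) = subobj_of C (cl m)"
    proof (subst subobj_of_eq_fac[OF cl(1)[OF c(1)] c(1)], goal_cases)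
      case 2
      have "fac C x (cl (cl m)) \<longleftrightarrow> fac C x (cl m)" if x: "x \<in> Arr C" "Cod C x = Cod C m" for x
      proof -
        have "fac C x (cl (cl m)) \<longleftrightarrow> F (cl m) x" using cl(3)[OF c(1)] x c(2) by simp
        also have "\<dots> \<longleftrightarrow> F m x"
          using idem[OF m(1) c(1,2) _ x] mono[OF m(1) c(1) f x] c(3) by blast
        also have "\<dots> \<longleftrightarrow> fac C x (cl m)" using c(3) x by simp
        finally show ?thesis .
      qed
      then show ?case using cl(2)[OF c(1)] c(2) by simp
    qed (use cl(2)[OF c(1)] c(2) in simp)
    then show "j (j x) = j x" using m j[OF m(1)] j[OF c(1)] by simp
  next
    fix A x y assume xy: "x \<in> Sub C A" "y \<in> Sub C A" "subobj_le C x y"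
    then obtain m n where m: "mono_arr C m" "Cod C m = A" "x = subobj_of C m"
      and n: "mono_arr C n" "Cod C n = A" "y = subobj_of C n" by (auto simp: Sub_def)
    have f: "fac C m n" using xy m n by (simp add: subobj_le_iff)
    have "cl m \<in> Arr C" using cl[OF m(1)] by (simp add: mono_Arr)
    then have "F m (cl m)" using cl(2)[OF m(1)] cl(3)[OF m(1), of "cl m"] fac_refl by simp
    then have "fac C (cl m) (cl n)"
      using cl[OF m(1)] cl[OF n(1)] mono[OF m(1) n(1) f, of "cl m"] m n \<open>cl m \<in> Arr C\<close> by simp
    then show "subobj_le C (j x) (j y)"
      using cl[OF m(1)] cl[OF n(1)] m n j by (simp add: subobj_le_iff)
  next
    fix f x assume f: "f \<in> Arr C" and "x \<in> Sub C (Cod C f)"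
    then obtain m where m: "mono_arr C m" "Cod C m = Cod C f" "x = subobj_of C m" by (auto simp: Sub_def)
    note c = cl[OF m(1)]
    obtain n q where pn: "is_pullback C n q f m" using pb_exists[of f m] f m by (auto simp: mono_Arr)
    obtain p r where pp: "is_pullback C p r f (cl m)"
      using pb_exists[of f "cl m"] f m c by (auto simp: mono_Arr)
    have n: "mono_arr C n" using mono_pullback[OF pn m(1)] .
    have p: "mono_arr C p" using mono_pullback[OF pp c(1)] .
    have cods: "Cod C n = Dom C f" "Cod C p = Dom C f" using pbD[OF pn] pbD[OF pp] by auto
    have "subobj_of C p = subobj_of C (cl n)"
      using p cl[OF n] cods pb_fac[OF pp] univ[OF m(1) n pn] c f m
      by (subst subobj_of_eq_fac) auto
    then show "sub_pullback C f (j x) = j (sub_pullback C f x)"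
      using sub_pullback_eq[OF pn m(1)] sub_pullback_eq[OF pp c(1)] m j[OF m(1)] j[OF n] by simp
  qed
  then show ?thesis using that iff by blast
qed

section \<open>Full subcategories closed under pullbacks\<close>

lemma full_sub_simps [simp]:
  "Obj (full_sub C X) = X"
  "f \<in> Arr (full_sub C X) \<longleftrightarrow> f \<in> Arr C \<and> Dom C f \<in> X \<and> Cod C f \<in> X"
  "Dom (full_sub C X) = Dom C" "Cod (full_sub C X) = Cod C"
  "Ident (full_sub C X) = Ident C" "Comp (full_sub C X) = Comp C"
  by (auto simp: full_sub_def)

lemma fac_full_sub:
  "x \<in> Arr (full_sub C X) \<Longrightarrow> c \<in> Arr (full_sub C X) \<Longrightarrow> fac (full_sub C X) x c \<longleftrightarrow> fac C x c"
  by (auto simp: fac_def)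

lemma hom_full_sub: "A \<in> X \<Longrightarrow> B \<in> X \<Longrightarrow> hom (full_sub C X) A B = hom C A B"
  by (auto simp: hom_def)

lemma orth_full_sub:
  "m \<in> Arr (full_sub C X) \<Longrightarrow> Y \<in> X \<Longrightarrow> orth (full_sub C X) m Y \<longleftrightarrow> orth C m Y"
  unfolding orth_def by (simp add: hom_full_sub del: hom_iff)

locale pullback_closed = pullback_category C for C :: "('o, 'a) cat" (structure) +
  fixes X :: "'o set"
  assumes sub_Obj: "X \<subseteq> Obj C"
    and pullback_closed: "is_pullback C p q f g \<Longrightarrow> Dom C f \<in> X \<Longrightarrow> Dom C g \<in> X \<Longrightarrow> Cod C g \<in> X \<Longrightarrow> Dom C q \<in> X"
begin

abbreviation "D \<equiv> full_sub C X"

text \<open>The kernel pair of \<open>m\<close> has its vertex in the subcategory, so cancelling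
  inside \<open>D\<close> already identifies its two projections; this makes \<open>m\<close> monic
  in the whole category.\<close>

lemma mono_D_iff: "mono_arr D m \<longleftrightarrow> mono_arr C m \<and> m \<in> Arr D"
proof
  assume m: "mono_arr D m"
  then have a: "m \<in> Arr C" "Dom C m \<in> X" "Cod C m \<in> X" by (auto dest: mono_Arr)
  obtain p q where pq: "is_pullback C p q m m" using pb_exists[of m m] a by blast
  note P = pbD[OF pq]
  have "Dom C q \<in> X" using pullback_closed[OF pq] a by simp
  then have "p = q" using P a by - (rule mono_cancel[OF m], auto)
  have "mono_arr C m"
  proof (rule monoI)
    fix f g assume f: "f \<in> Arr C" "g \<in> Arr C" "Dom C f = Dom C g" "Cod C f = Dom C m" "Cod C g = Dom C m"
      "m \<cdot> f = m \<cdot> g"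
    obtain w where "p \<cdot> w = f" "q \<cdot> w = g" using pb_lift[OF pq f] by blast
    then show "f = g" using \<open>p = q\<close> by simp
  qed (use a in simp)
  then show "mono_arr C m \<and> m \<in> Arr D" using a by simp
next
  assume "mono_arr C m \<and> m \<in> Arr D"
  then show "mono_arr D m"
    by (intro monoI) (auto elim: mono_cancel)
qed

text \<open>A pullback formed in \<open>C\<close> of a cospan of \<open>D\<close> stays in
  \<open>D\<close>, hence is isomorphic, through \<open>w\<close> and \<open>z\<close>, to any
  pullback formed in \<open>D\<close>.\<close>

lemma pullback_D_iff:
  "is_pullback D p q f g \<longleftrightarrow> is_pullback C p q f g \<and> f \<in> Arr D \<and> g \<in> Arr D \<and> p \<in> Arr D \<and> q \<in> Arr D"
proof
  interpret D: category D by (rule category_full_sub[OF category_axioms sub_Obj])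
  assume L: "is_pullback D p q f g"
  note d = pbD[OF L, simplified]
  obtain p' q' where pb: "is_pullback C p' q' f g" using pb_exists[of f g] d by auto
  note c = pbD[OF pb]
  have X: "Dom C q' \<in> X" using pullback_closed[OF pb] d by simp
  obtain w where w: "w \<in> Arr C" "Dom C w = Dom C q'" "Cod C w = Dom C q" "p \<cdot> w = p'" "q \<cdot> w = q'"
    using pb_lift[OF L, of p' q'] c d X by auto
  obtain z where z: "z \<in> Arr C" "Dom C z = Dom C q" "Cod C z = Dom C q'" "p' \<cdot> z = p" "q' \<cdot> z = q"
    using pb_lift[OF pb, of p q] d by auto
  have "p \<cdot> (w \<cdot> z) = p" "q \<cdot> (w \<cdot> z) = q"
    using w(1-3) z d by (simp_all add: w(4,5)[THEN comp_reassoc])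
  then have wz: "w \<cdot> z = Ident C (Dom C q)"
    using w(1-3) z(1-3) d X by - (rule D.pb_uniq[OF L], auto)
  have "is_pullback C p q f g"
  proof (rule pbI)
    fix u v assume u: "u \<in> Arr C" "v \<in> Arr C" "Dom C u = Dom C v" "Cod C u = Dom C f"
      "Cod C v = Dom C g" "f \<cdot> u = g \<cdot> v"
    obtain y where y: "y \<in> Arr C" "Dom C y = Dom C v" "Cod C y = Dom C q'" "p' \<cdot> y = u" "q' \<cdot> y = v"
      using pb_lift[OF pb u] by blast
    then show "\<exists>w. w \<in> Arr C \<and> Dom C w = Dom C v \<and> Cod C w = Dom C q \<and> p \<cdot> w = u \<and> q \<cdot> w = v"
      using w d by (intro exI[of _ "w \<cdot> y"]) (auto simp: w(4,5)[THEN comp_reassoc])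
  next
    fix x y assume x: "x \<in> Arr C" "y \<in> Arr C" "Dom C x = Dom C y" "Cod C x = Dom C q"
      "Cod C y = Dom C q" "p \<cdot> x = p \<cdot> y" "q \<cdot> x = q \<cdot> y"
    have "p' \<cdot> (z \<cdot> x) = p' \<cdot> (z \<cdot> y)" "q' \<cdot> (z \<cdot> x) = q' \<cdot> (z \<cdot> y)"
      using x z(1-3) c(1-8) by (simp_all add: z(4,5)[THEN comp_reassoc])
    then have "z \<cdot> x = z \<cdot> y" using x(1-5) z(1-3) by - (rule pb_uniq[OF pb], auto)
    then have "w \<cdot> z \<cdot> x = w \<cdot> z \<cdot> y" using x(1-5) z(1-3) w(1-3) by simp
    then show "x = y" using x by (simp add: wz)
  qed (use d in auto)
  then show "is_pullback C p q f g \<and> f \<in> Arr D \<and> g \<in> Arr D \<and> p \<in> Arr D \<and> q \<in> Arr D"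
    using d by auto
next
  assume R: "is_pullback C p q f g \<and> f \<in> Arr D \<and> g \<in> Arr D \<and> p \<in> Arr D \<and> q \<in> Arr D"
  then have pb: "is_pullback C p q f g" by blast
  note d = pbD[OF pb]
  show "is_pullback D p q f g"
  proof (rule pbI)
    fix u v assume u: "u \<in> Arr D" "v \<in> Arr D" "Dom D u = Dom D v" "Cod D u = Dom D f"
      "Cod D v = Dom D g" "f \<cdot>\<^bsub>D\<^esub> u = g \<cdot>\<^bsub>D\<^esub> v"
    obtain y where "y \<in> Arr C" "Dom C y = Dom C v" "Cod C y = Dom C q" "p \<cdot> y = u" "q \<cdot> y = v"
      using pb_lift[OF pb, of u v] u by auto
    then show "\<exists>w. w \<in> Arr D \<and> Dom D w = Dom D v \<and> Cod D w = Dom D q \<and> p \<cdot>\<^bsub>D\<^esub> w = u \<and> q \<cdot>\<^bsub>D\<^esub> w = v"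
      using u R by auto
  next
    fix x y assume "x \<in> Arr D" "y \<in> Arr D" "Dom D x = Dom D y" "Cod D x = Dom D q"
      "Cod D y = Dom D q" "p \<cdot>\<^bsub>D\<^esub> x = p \<cdot>\<^bsub>D\<^esub> y" "q \<cdot>\<^bsub>D\<^esub> x = q \<cdot>\<^bsub>D\<^esub> y"
    then show "x = y" by - (rule pb_uniq[OF pb], auto)
  qed (use R d in auto)
qed

lemma pullback_category_D: "pullback_category D"
proof -
  interpret D: category D by (rule category_full_sub[OF category_axioms sub_Obj])
  show ?thesis
  proof
    fix f g assume a: "f \<in> Arr D" "g \<in> Arr D" "Cod D f = Cod D g"
    then obtain p q where pq: "is_pullback C p q f g" using pb_exists[of f g] by auto
    have "Dom C q \<in> X" using pullback_closed[OF pq] a by simp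
    then show "\<exists>p q. is_pullback D p q f g"
      using pq a pbD[OF pq] by (intro exI[of _ p] exI[of _ q]) (simp add: pullback_D_iff)
  qed
qed

end

section \<open>Consequences of local cartesian closedness\<close>

context quasitopos_category
begin

sublocale pullback_category C
  by unfold_locales (metis pullback_ex)

text \<open>The equalizer is the pullback of the graphs \<open>h\<close> and \<open>h'\<close> of
  \<open>f\<close> and \<open>g\<close> inside \<open>Dom f \<times> Cod f\<close>. The first
  projection forces both sides of the pullback to coincide.\<close>

lemma equalizer_ex:
  assumes "f \<in> Arr C" "g \<in> Arr C" "Dom C f = Dom C g" "Cod C f = Cod C g"
  obtains m where "mono_arr C m" "Cod C m = Dom C f" "f \<cdot> m = g \<cdot> m"
    "\<And>x. x \<in> Arr C \<Longrightarrow> Cod C x = Dom C f \<Longrightarrow> f \<cdot> x = g \<cdot> x \<Longrightarrow> fac C x m"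
proof -
  obtain p q where prod: "is_product C (Dom C f) (Cod C f) (Dom C q) p q"
    and pq: "p \<in> Arr C" "q \<in> Arr C" "Dom C p = Dom C q" "Cod C p = Dom C f" "Cod C q = Cod C f"
    using product_ex[OF dom_obj[OF assms(1)] cod_obj[OF assms(1)]] .
  obtain h where h: "h \<in> Arr C" "Dom C h = Dom C f" "Cod C h = Dom C q" "p \<cdot> h = Ident C (Dom C f)" "q \<cdot> h = f"
    using product_lift[OF prod, of "Ident C (Dom C f)" f] assms by auto
  obtain h' where h': "h' \<in> Arr C" "Dom C h' = Dom C g" "Cod C h' = Dom C q" "p \<cdot> h' = Ident C (Dom C f)" "q \<cdot> h' = g"
    using product_lift[OF prod, of "Ident C (Dom C f)" g] assms by auto
  obtain m n where pb: "is_pullback C m n h h'" using pb_exists[of h h'] h h' by auto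
  note b = pbD[OF pb]
  have "p \<cdot> (h \<cdot> m) = p \<cdot> (h' \<cdot> n)" "q \<cdot> (h \<cdot> m) = q \<cdot> (h' \<cdot> n)" using b by auto
  then have mn: "m = n" "f \<cdot> m = g \<cdot> n"
    using b(1-8) h h' pq assms by (auto simp: h(4,5)[THEN comp_reassoc] h'(4,5)[THEN comp_reassoc])
  have "mono_arr C m"
    by (rule monoI) (use b mn in \<open>auto intro: pb_uniq[OF pb]\<close>)
  moreover have "fac C x m" if x: "x \<in> Arr C" "Cod C x = Dom C f" "f \<cdot> x = g \<cdot> x" for x
  proof -
    have "h \<cdot> x = h' \<cdot> x"
      using x h h' pq assms
      by - (rule product_uniq[OF prod], auto simp: h(4,5)[THEN comp_reassoc] h'(4,5)[THEN comp_reassoc])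
    then obtain w where "w \<in> Arr C" "Dom C w = Dom C x" "Cod C w = Dom C n" "m \<cdot> w = x"
      using pb_lift[OF pb, of x x] x h h' assms by auto
    then show ?thesis using b by (intro facI[of w]) auto
  qed
  ultimately show ?thesis using that[of m] b h mn by auto
qed

text \<open>Arrows from \<open>Dom f\<close> to a fixed object transpose to sections, over
  \<open>Cod f\<close>, of the object representing them. Restriction along \<open>e'\<close> becomes
  composition with \<open>e\<close>, which can be cancelled.\<close>

lemma epi_pullback:
  assumes epi: "epi_arr C e" and pb: "is_pullback C e' q f e"
  shows "epi_arr C e'"
proof (rule epiI)
  note b = pbD[OF pb]
  show "e' \<in> Arr C" using b by simp
  fix u v assume a: "u \<in> Arr C" "v \<in> Arr C" "Cod C u = Cod C v" "Dom C u = Cod C e'" "Dom C v = Cod C e'"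
    "u \<cdot> e' = v \<cdot> e'"
  obtain e0 K where rp: "represents_partial C f (Cod C v) e0 K"
    using represents_partial_ex[of f "Cod C v"] a b by auto
  note r = rpD[OF rp]
  have pb1: "is_pullback C f (Ident C (Dom C f)) (Ident C (Cod C f)) f"
    by (rule is_pullback_sym[OF pb_Ident[OF b(1)]])
  have pb2: "is_pullback C q e' e f" by (rule is_pullback_sym[OF pb])
  obtain d where d: "d \<in> Arr C" "Dom C d = Cod C f" "Cod C d = Dom C e0" "e0 \<cdot> d = Ident C (Cod C f)"
    "K d f (Ident C (Dom C f)) u"
    using rp_curry[OF rp pb1, of u] a b by auto
  obtain d' where d': "d' \<in> Arr C" "Dom C d' = Cod C f" "Cod C d' = Dom C e0" "e0 \<cdot> d' = Ident C (Cod C f)"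
    "K d' f (Ident C (Dom C f)) v"
    using rp_curry[OF rp pb1, of v] a b by auto
  have 1: "K (d \<cdot> e) q e' (u \<cdot> e')"
    using a b d r by - (rule rp_natural[OF rp pb1 d(1,3,4) _ _ _ d(5) b(2) _ pb2], auto simp: d(4)[THEN comp_reassoc])
  have 2: "K (d' \<cdot> e) q e' (v \<cdot> e')"
    using a b d' r by - (rule rp_natural[OF rp pb1 d'(1,3,4) _ _ _ d'(5) b(2) _ pb2], auto simp: d'(4)[THEN comp_reassoc])
  have "d \<cdot> e = d' \<cdot> e"
    using 1 2 a b d d' r
    by - (rule rp_curry_uniq[OF rp pb2, of "u \<cdot> e'"], auto simp: d(4)[THEN comp_reassoc] d'(4)[THEN comp_reassoc])
  then have "d = d'" using d d' b by - (rule epi_cancel[OF epi], auto)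
  then show "u = v"
    using d d' a b by - (rule rp_uncurry_uniq[OF rp pb1 d(1,3,4)], auto)
qed

text \<open>Local lifting: an arrow into the target of an epimorphism lifts to its source after an
  epimorphic cover, so quotients can be treated with generalized elements.\<close>

lemma epi_cover:
  assumes "epi_arr C e" "u \<in> Arr C" "Cod C u = Cod C e"
  obtains e' a where "epi_arr C e'" "e' \<in> Arr C" "Cod C e' = Dom C u" "a \<in> Arr C" "Dom C a = Dom C e'"
    "Cod C a = Dom C e" "e \<cdot> a = u \<cdot> e'"
proof -
  obtain e' a where pb: "is_pullback C e' a u e" using pb_exists[of u e] assms by (auto simp: epi_Arr)
  show ?thesis using that[of e' a] epi_pullback[OF assms(1) pb] pbD[OF pb] by auto
qed

text \<open>Pulling back along \<open>f\<close> preserves the pushout of \<open>m\<close> with itself, as a slice category is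
  cartesian closed. Only the existence half of the universal property is recorded.\<close>

lemma pushout_stable:
  assumes po: "is_pushout C i j m m" and c: "c \<in> Arr C" "Dom C c = Cod C i"
    "c \<cdot> i = Ident C (Cod C m)" "c \<cdot> j = Ident C (Cod C m)"
  and pbm: "is_pullback C n q f m" and pbc: "is_pullback C r s c f"
  and x: "x \<in> Arr C" "Dom C x = Dom C f" "Cod C x = Dom C s" "r \<cdot> x = i \<cdot> f" "s \<cdot> x = Ident C (Dom C f)"
  and y: "y \<in> Arr C" "Dom C y = Dom C f" "Cod C y = Dom C s" "r \<cdot> y = j \<cdot> f" "s \<cdot> y = Ident C (Dom C f)"
  and u: "u \<in> Arr C" "Dom C u = Dom C f" "v \<in> Arr C" "Dom C v = Dom C f" "Cod C u = Cod C v"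
    "u \<cdot> n = v \<cdot> n"
  obtains \<phi> where "\<phi> \<in> Arr C" "Dom C \<phi> = Dom C s" "Cod C \<phi> = Cod C v" "\<phi> \<cdot> x = u" "\<phi> \<cdot> y = v"
proof -
  note p = poD[OF po] and b = pbD[OF pbm] and bc = pbD[OF pbc]
  have Cc: "Cod C c = Cod C m"
    using arr_simps(6)[of i c] c p by simp
  obtain e0 K where rp: "represents_partial C f (Cod C v) e0 K"
    using represents_partial_ex[of f "Cod C v"] u b by auto
  note r = rpD[OF rp]
  have pb1: "is_pullback C f (Ident C (Dom C f)) (Ident C (Cod C f)) f"
    by (rule is_pullback_sym[OF pb_Ident[OF b(1)]])
  have pb2: "is_pullback C q n m f" by (rule is_pullback_sym[OF pbm])
  obtain d where d: "d \<in> Arr C" "Dom C d = Cod C f" "Cod C d = Dom C e0" "e0 \<cdot> d = Ident C (Cod C f)"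
    "K d f (Ident C (Dom C f)) u"
    using rp_curry[OF rp pb1, of u] u b by auto
  obtain d' where d': "d' \<in> Arr C" "Dom C d' = Cod C f" "Cod C d' = Dom C e0" "e0 \<cdot> d' = Ident C (Cod C f)"
    "K d' f (Ident C (Dom C f)) v"
    using rp_curry[OF rp pb1, of v] u b by auto
  have 1: "K (d \<cdot> m) q n (u \<cdot> n)"
    using u b d r by - (rule rp_natural[OF rp pb1 d(1,3,4) _ _ _ d(5) b(2) _ pb2], auto simp: d(4)[THEN comp_reassoc])
  have 2: "K (d' \<cdot> m) q n (v \<cdot> n)"
    using u b d' r by - (rule rp_natural[OF rp pb1 d'(1,3,4) _ _ _ d'(5) b(2) _ pb2], auto simp: d'(4)[THEN comp_reassoc])
  have "d \<cdot> m = d' \<cdot> m"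
    using 1 2 u b d d' r
    by - (rule rp_curry_uniq[OF rp pb2, of "u \<cdot> n"], auto simp: d(4)[THEN comp_reassoc] d'(4)[THEN comp_reassoc])
  \<comment> \<open>The transposes of \<open>u\<close> and \<open>v\<close> agree on
    \<open>m\<close>, hence glue on the pushout. The glued arrow lies over \<open>c\<close>, and its
    transpose back is the required \<open>\<phi>\<close>.\<close>
  then obtain D where D: "D \<in> Arr C" "Cod C D = Dom C e0" "Dom C D = Cod C j" "D \<cdot> i = d" "D \<cdot> j = d'"
    using po_lift[OF po, of d d'] d d' b by auto
  have e0D: "e0 \<cdot> D = c"
    using D d(4) d'(4) c r p b Cc by - (rule po_uniq[OF po], auto)
  obtain \<phi> where \<phi>: "\<phi> \<in> Arr C" "Dom C \<phi> = Dom C s" "Cod C \<phi> = Cod C v" "K D r s \<phi>"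
    using rp_uncurry[OF rp pbc D(1,2) e0D] by blast
  have 3: "K (D \<cdot> i) f (Ident C (Dom C f)) (\<phi> \<cdot> x)"
    using D \<phi> x p b bc d by - (rule rp_natural[OF rp pbc D(1,2) e0D \<phi> p(3) _ pb1], auto)
  have 4: "K (D \<cdot> j) f (Ident C (Dom C f)) (\<phi> \<cdot> y)"
    using D \<phi> y p b bc d' by - (rule rp_natural[OF rp pbc D(1,2) e0D \<phi> p(4) _ pb1], auto)
  have "\<phi> \<cdot> x = u"
    using 3 d \<phi> x u b unfolding D(4) by - (rule rp_uncurry_uniq[OF rp pb1 d(1,3,4)], auto)
  moreover have "\<phi> \<cdot> y = v"
    using 4 d' \<phi> y u b unfolding D(5) by - (rule rp_uncurry_uniq[OF rp pb1 d'(1,3,4)], auto)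
  ultimately show ?thesis using that \<phi> by blast
qed

text \<open>An arrow into \<open>Dom e\<close> consists of an arrow into the base and a transpose.
  The base parts agree by \<open>base\<close>; the transposes agree on the pullback \<open>b\<close>
  of \<open>m\<close>, where cancelling into \<open>Y\<close> is available.\<close>

lemma rp_cancels:
  assumes rp: "represents_partial C f Y e K" and m: "m \<in> Arr C" and base: "cancels C m (Cod C f)"
  and fib: "\<And>r s b r'. s \<in> Arr C \<Longrightarrow> is_pullback C b r' r m \<Longrightarrow> Dom C r = Dom C s \<Longrightarrow> cancels C b Y"
  shows "cancels C m (Dom C e)"
proof (rule cancelsI)
  note R = rpD[OF rp]
  fix u v assume a: "u \<in> Arr C" "Dom C u = Cod C m" "Cod C u = Dom C e"
    "v \<in> Arr C" "Dom C v = Cod C m" "Cod C v = Dom C e" "u \<cdot> m = v \<cdot> m"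
  have g: "e \<cdot> v = e \<cdot> u" using a R m by - (rule cancelsD[OF base], auto)
  obtain r s where pb: "is_pullback C r s (e \<cdot> u) f" using pb_exists[of "e \<cdot> u" f] a R by auto
  obtain r' s' where pb': "is_pullback C r' s' (e \<cdot> u \<cdot> m) f" using pb_exists[of "e \<cdot> u \<cdot> m" f] a R m by auto
  obtain b where b: "b \<in> Arr C" "Dom C b = Dom C r'" "Cod C b = Dom C r" "s \<cdot> b = s'" "r \<cdot> b = m \<cdot> r'"
    "is_pullback C b r' r m"
    using pb_paste[OF is_pullback_sym[OF pb'] is_pullback_sym[OF pb] m] a R by auto
  note P = pbD[OF pb] and P' = pbD[OF pb']
  have cb: "cancels C b Y" using fib[OF P(4) b(6) P(6)] .
  obtain \<phi> where \<phi>: "\<phi> \<in> Arr C" "Dom C \<phi> = Dom C s" "Cod C \<phi> = Y" "K u r s \<phi>"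
    using rp_uncurry[OF rp pb, of u] a by auto
  obtain \<psi> where \<psi>: "\<psi> \<in> Arr C" "Dom C \<psi> = Dom C s" "Cod C \<psi> = Y" "K v r s \<psi>"
    using rp_uncurry[OF rp pb, of v] a g by auto
  have 1: "K (u \<cdot> m) r' s' (\<phi> \<cdot> b)"
    using a b P P' R m by - (rule rp_natural[OF rp pb a(1,3) _ \<phi> m _ pb'], auto)
  have "e \<cdot> (v \<cdot> m) = e \<cdot> v \<cdot> m" using a(4-6) R m by simp
  also have "\<dots> = e \<cdot> u \<cdot> m" by (simp only: g)
  finally have evm: "e \<cdot> (v \<cdot> m) = e \<cdot> u \<cdot> m" .
  have 2: "K (v \<cdot> m) r' s' (\<psi> \<cdot> b)"
    using a(1-6) b P P' R m by - (rule rp_natural[OF rp pb a(4,6) g \<psi> m _ pb' evm], auto)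
  have "\<phi> \<cdot> b = \<psi> \<cdot> b"
    using 1 2 a \<phi> \<psi> b P P' R m by - (rule rp_uncurry_uniq[OF rp pb', of "u \<cdot> m"], auto)
  then have "\<phi> = \<psi>" using \<phi> \<psi> b P by - (rule cancelsD[OF cb], auto)
  then show "u = v"
    using a \<phi> \<psi> g P R by - (rule rp_curry_uniq[OF rp pb \<phi>(1-3)], auto)
qed

text \<open>First \<open>e \<cdot> u\<close> is extended along \<open>m\<close> in the base. Over
  that extension the transpose of \<open>u\<close> lives on the domain of \<open>b\<close>, a
  pullback of \<open>m\<close>, and extends along \<open>b\<close>.\<close>

lemma rp_orth:
  assumes rp: "represents_partial C f Y e K" and m: "m \<in> Arr C" and base: "orth C m (Cod C f)"
  and fib: "\<And>r s b r'. s \<in> Arr C \<Longrightarrow> is_pullback C b r' r m \<Longrightarrow> Dom C r = Dom C s \<Longrightarrow> orth C b Y"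
  shows "orth C m (Dom C e)"
proof (rule orthI)
  note R = rpD[OF rp]
  fix u assume u: "u \<in> Arr C" "Dom C u = Dom C m" "Cod C u = Dom C e"
  obtain g where g: "g \<in> Arr C" "Dom C g = Cod C m" "Cod C g = Cod C f" "g \<cdot> m = e \<cdot> u"
    using orthE[OF base, of "e \<cdot> u"] u R by auto
  obtain r s where pb: "is_pullback C r s g f" using pb_exists[of g f] g R by auto
  obtain r' s' where pb': "is_pullback C r' s' (g \<cdot> m) f" using pb_exists[of "g \<cdot> m" f] g(1-3) R m by auto
  obtain b where b: "b \<in> Arr C" "Dom C b = Dom C r'" "Cod C b = Dom C r" "s \<cdot> b = s'" "r \<cdot> b = m \<cdot> r'"
    "is_pullback C b r' r m"
    using pb_paste[OF is_pullback_sym[OF pb'] is_pullback_sym[OF pb] m] g(1-3) R by auto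
  note P = pbD[OF pb] and P' = pbD[OF pb']
  have ob: "orth C b Y" using fib[OF P(4) b(6) P(6)] .
  obtain \<psi> where \<psi>: "\<psi> \<in> Arr C" "Dom C \<psi> = Dom C s'" "Cod C \<psi> = Y" "K u r' s' \<psi>"
    using rp_uncurry[OF rp pb', of u] u g by auto
  obtain \<phi> where \<phi>: "\<phi> \<in> Arr C" "Dom C \<phi> = Cod C b" "Cod C \<phi> = Y" "\<phi> \<cdot> b = \<psi>"
    using orthE[OF ob, of \<psi>] \<psi> b P' by auto
  obtain d where d: "d \<in> Arr C" "Dom C d = Dom C g" "Cod C d = Dom C e" "e \<cdot> d = g" "K d r s \<phi>"
    using rp_curry[OF rp pb, of \<phi>] \<phi> b P by auto
  have "K (d \<cdot> m) r' s' (\<phi> \<cdot> b)"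
    using d b P P' R m g \<phi>
    by - (rule rp_natural[OF rp pb d(1,3,4) \<phi>(1) _ \<phi>(3) d(5) m _ pb'], auto simp: d(4)[THEN comp_reassoc])
  then have "d \<cdot> m = u"
    using u d \<phi> \<psi> b P P' R m g
    by - (rule rp_curry_uniq[OF rp pb', of \<psi>], auto simp: d(4)[THEN comp_reassoc])
  then show "\<exists>v. v \<in> Arr C \<and> Dom C v = Cod C m \<and> Cod C v = Dom C e \<and> v \<cdot> m = u" using d g by auto
next
  have "cancels C b Y" if "s \<in> Arr C" "is_pullback C b r' r m" "Dom C r = Dom C s" for r s b r'
    using fib[OF that] pbD[OF that(2)] by (simp add: orth_imp_cancels)
  then have "cancels C m (Dom C e)"
    using rp_cancels[OF rp m orth_imp_cancels[OF base m]] by blast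
  then show "u = v" if "u \<in> Arr C" "Dom C u = Cod C m" "Cod C u = Dom C e"
    "v \<in> Arr C" "Dom C v = Cod C m" "Cod C v = Dom C e" "u \<cdot> m = v \<cdot> m" for u v
    using that by - (rule cancelsD, auto)
qed

text \<open>The transposition of \<open>rp_orth\<close> read backwards: extending arrows into
  \<open>Y\<close> along \<open>b\<close> is the same as extending arrows into \<open>Dom e\<close>
  along \<open>m\<close> while keeping the base part \<open>g\<close>. In this way orthogonality
  survives a base change.\<close>

lemma rp_orth_fibre:
  assumes rp: "represents_partial C f Y e K" and m: "m \<in> Arr C"
  and base: "orth C m (Cod C f)" and total: "orth C m (Dom C e)"
  and g: "g \<in> Arr C" "Dom C g = Cod C m" and pb: "is_pullback C r s g f" and pbb: "is_pullback C b r' r m"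
  shows "orth C b Y"
proof -
  note R = rpD[OF rp] and P = pbD[OF pb] and B = pbD[OF pbb]
  have pb': "is_pullback C r' (s \<cdot> b) (g \<cdot> m) f"
    by (rule is_pullback_sym[OF pb_compose[OF pbb is_pullback_sym[OF pb]]])
  note P' = pbD[OF pb']
  show ?thesis
  proof (rule orthI)
    fix \<psi> assume \<psi>: "\<psi> \<in> Arr C" "Dom C \<psi> = Dom C b" "Cod C \<psi> = Y"
    obtain d' where d': "d' \<in> Arr C" "Dom C d' = Dom C (g \<cdot> m)" "Cod C d' = Dom C e" "e \<cdot> d' = g \<cdot> m"
      "K d' r' (s \<cdot> b) \<psi>"
      using rp_curry[OF rp pb', of \<psi>] \<psi> B P by auto
    obtain d where d: "d \<in> Arr C" "Dom C d = Cod C m" "Cod C d = Dom C e" "d \<cdot> m = d'"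
      using orthE[OF total, of d'] d' g m by auto
    have ed: "e \<cdot> d = g"
      using d d' g m R P by - (rule orth_cancel[OF base m], auto)
    obtain \<phi> where \<phi>: "\<phi> \<in> Arr C" "Dom C \<phi> = Dom C s" "Cod C \<phi> = Y" "K d r s \<phi>"
      using rp_uncurry[OF rp pb d(1,3) ed] by blast
    have "K (d \<cdot> m) r' (s \<cdot> b) (\<phi> \<cdot> b)"
      using d(1-3) B P(1-8) P'(1-8) R m g \<phi>(1-3)
      by - (rule rp_natural[OF rp pb d(1,3) ed \<phi> m _ pb'], auto simp: ed ed[THEN comp_reassoc])
    then have "\<phi> \<cdot> b = \<psi>"
      using d'(5) \<phi>(1-3) \<psi> B(1-8) P(1-8) unfolding d(4)
      by - (rule rp_uncurry_uniq[OF rp pb' d'(1,3,4)], auto)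
    then show "\<exists>v. v \<in> Arr C \<and> Dom C v = Cod C b \<and> Cod C v = Y \<and> v \<cdot> b = \<psi>"
      using \<phi> B P by auto
  next
    fix \<phi> \<psi> assume a: "\<phi> \<in> Arr C" "Dom C \<phi> = Cod C b" "Cod C \<phi> = Y"
      "\<psi> \<in> Arr C" "Dom C \<psi> = Cod C b" "Cod C \<psi> = Y" "\<phi> \<cdot> b = \<psi> \<cdot> b"
    obtain d where d: "d \<in> Arr C" "Dom C d = Dom C g" "Cod C d = Dom C e" "e \<cdot> d = g" "K d r s \<phi>"
      using rp_curry[OF rp pb, of \<phi>] a B P by auto
    obtain d' where d': "d' \<in> Arr C" "Dom C d' = Dom C g" "Cod C d' = Dom C e" "e \<cdot> d' = g" "K d' r s \<psi>"
      using rp_curry[OF rp pb, of \<psi>] a B P by auto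
    have 1: "K (d \<cdot> m) r' (s \<cdot> b) (\<phi> \<cdot> b)"
      using d B P P' R m g a
      by - (rule rp_natural[OF rp pb d(1,3,4) a(1) _ a(3) d(5) m _ pb'], auto simp: d(4)[THEN comp_reassoc])
    have 2: "K (d' \<cdot> m) r' (s \<cdot> b) (\<psi> \<cdot> b)"
      using d' B P P' R m g a
      by - (rule rp_natural[OF rp pb d'(1,3,4) a(4) _ a(6) d'(5) m _ pb'], auto simp: d'(4)[THEN comp_reassoc])
    have "d \<cdot> m = d' \<cdot> m"
      using 1 2 a d d' B P P' R m g
      by - (rule rp_curry_uniq[OF rp pb', of "\<phi> \<cdot> b"], auto simp: d(4)[THEN comp_reassoc] d'(4)[THEN comp_reassoc])
    then have "d = d'" using d d' g by - (rule orth_cancel[OF total m], auto)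
    then show "\<phi> = \<psi>"
      using a d d' B P by - (rule rp_uncurry_uniq[OF rp pb d(1,3,4)], auto)
  qed
qed

end

section \<open>Strict universal closure operators\<close>

text \<open>In the presence of a universal closure operator these are the generalized elements
  \<open>(u, v)\<close> of the closure of the diagonal, expressed without forming a product.\<close>

definition agree :: "('o, 'a) cat \<Rightarrow> ('a set \<Rightarrow> 'a set) \<Rightarrow> 'a \<Rightarrow> 'a \<Rightarrow> bool" where
  "agree C k u v \<longleftrightarrow> (\<exists>m. dense_mono C k m \<and> Cod C m = Dom C u \<and> u \<cdot>\<^bsub>C\<^esub> m = v \<cdot>\<^bsub>C\<^esub> m)"

text \<open>Membership replaces the pullback square, so the arrow into the terminal object need not
  be carried along. For monic \<open>t\<close> and \<open>c\<close> the two forms agree by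
  \<open>classifiesI_pullback\<close> and \<open>classifies_pullback\<close>.\<close>

definition classifies :: "('o, 'a) cat \<Rightarrow> 'a \<Rightarrow> 'a \<Rightarrow> 'a \<Rightarrow> bool" where
  "classifies C t c \<chi> \<longleftrightarrow> \<chi> \<in> Arr C \<and> Dom C \<chi> = Cod C c \<and> Cod C \<chi> = Cod C t \<and>
     (\<forall>y \<in> Arr C. Cod C y = Cod C c \<longrightarrow> (fac C y c \<longleftrightarrow> fac C (\<chi> \<cdot>\<^bsub>C\<^esub> y) t))"

definition closed_classifier :: "('o, 'a) cat \<Rightarrow> ('a set \<Rightarrow> 'a set) \<Rightarrow> 'a \<Rightarrow> bool" where
  "closed_classifier C k t \<longleftrightarrow> t \<in> Arr C \<and> is_terminal C (Dom C t) \<and>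
     (\<forall>c. closed_mono C k c \<longrightarrow> (\<exists>!\<chi>. classifies C t c \<chi>)) \<and>
     (\<forall>\<chi> \<in> Arr C. Cod C \<chi> = Cod C t \<longrightarrow> (\<exists>c. closed_mono C k c \<and> classifies C t c \<chi>))"

lemma closed_classifierD:
  assumes "closed_classifier C k t"
  shows "t \<in> Arr C" "is_terminal C (Dom C t)"
    "\<And>c. closed_mono C k c \<Longrightarrow> \<exists>\<chi>. classifies C t c \<chi>"
    "\<And>c \<chi> \<chi>'. closed_mono C k c \<Longrightarrow> classifies C t c \<chi> \<Longrightarrow> classifies C t c \<chi>' \<Longrightarrow> \<chi> = \<chi>'"
    "\<And>\<chi>. \<chi> \<in> Arr C \<Longrightarrow> Cod C \<chi> = Cod C t \<Longrightarrow> \<exists>c. closed_mono C k c \<and> classifies C t c \<chi>"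
  using assms unfolding closed_classifier_def by blast+

context category
begin

lemma separated_agree:
  assumes "separated C k Y" "agree C k u v" "u \<in> Arr C" "v \<in> Arr C" "Dom C u = Dom C v"
    "Cod C u = Y" "Cod C v = Y"
  shows "u = v"
proof -
  obtain m where m: "dense_mono C k m" "Cod C m = Dom C u" "u \<cdot> m = v \<cdot> m"
    using assms(2) by (auto simp: agree_def)
  then have "cancels C m Y" using assms by (simp add: separated_iff)
  then show ?thesis using m assms by - (rule cancelsD, auto)
qed

lemma mono_from_terminal:
  assumes "is_terminal C (Dom C t)" "t \<in> Arr C"
  shows "mono_arr C t"
proof (rule monoI)
  fix f g assume "f \<in> Arr C" "g \<in> Arr C" "Dom C f = Dom C g" "Cod C f = Dom C t" "Cod C g = Dom C t"
  moreover have "\<forall>A \<in> Obj C. \<exists>!h. h \<in> hom C A (Dom C t)" using assms by (simp add: is_terminal_def)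
  then have "\<exists>!h. h \<in> hom C (Dom C g) (Dom C t)" using \<open>g \<in> Arr C\<close> by (simp del: hom_iff)
  ultimately show "f = g" by auto
qed (use assms in simp)

lemma terminal_uniq:
  assumes "is_terminal C T" "f \<in> Arr C" "g \<in> Arr C" "Dom C f = Dom C g" "Cod C f = T" "Cod C g = T"
  shows "f = g"
proof -
  have "\<exists>!h. h \<in> hom C (Dom C g) T" using assms by (simp add: is_terminal_def)
  then show ?thesis using assms by auto
qed

lemma terminal_arrow:
  assumes "is_terminal C T" "A \<in> Obj C"
  obtains f where "f \<in> Arr C" "Dom C f = A" "Cod C f = T"
  using assms unfolding is_terminal_def by auto

lemma orth_terminal:
  assumes "is_terminal C T" "m \<in> Arr C"
  shows "orth C m T"
proof (rule orthI)
  fix u assume u: "u \<in> Arr C" "Dom C u = Dom C m" "Cod C u = T"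
  obtain f where f: "f \<in> Arr C" "Dom C f = Cod C m" "Cod C f = T"
    using terminal_arrow[OF assms(1), of "Cod C m"] assms by auto
  have "f \<cdot> m = u" using u f assms by - (rule terminal_uniq[OF assms(1)], auto)
  then show "\<exists>v. v \<in> Arr C \<and> Dom C v = Cod C m \<and> Cod C v = T \<and> v \<cdot> m = u" using f by blast
next
  fix u v assume "u \<in> Arr C" "Dom C u = Cod C m" "Cod C u = T" "v \<in> Arr C" "Dom C v = Cod C m" "Cod C v = T"
  then show "u = v" by - (rule terminal_uniq[OF assms(1)], auto)
qed

lemma classifiesI_pullback:
  assumes "is_pullback C c u \<chi> t"
  shows "classifies C t c \<chi>"
  using pbD[OF assms] pb_fac[OF assms] by (auto simp: classifies_def)

lemma classifies_pullback:
  assumes "classifies C t c \<chi>" "mono_arr C t" "mono_arr C c"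
  obtains u where "is_pullback C c u \<chi> t"
  using pbI_fac[of c \<chi> t] assms by (auto simp: classifies_def)

lemma classifies_cong:
  assumes "classifies C t c \<chi>" "mono_arr C c" "mono_arr C c'" "subobj_of C c = subobj_of C c'"
  shows "classifies C t c' \<chi>"
proof -
  have f: "fac C c c'" "fac C c' c" using assms by (auto simp: subobj_of_eq_iff)
  have a: "c \<in> Arr C" "c' \<in> Arr C" using assms by (auto simp: mono_Arr)
  have "Cod C c = Cod C c'" using facD_Cod[OF f(1) a(2)] .
  moreover have "fac C y c \<longleftrightarrow> fac C y c'" for y using fac_trans f a by metis
  ultimately show ?thesis using assms(1) by (simp add: classifies_def)
qed

lemma classifies_comp:
  assumes "classifies C t c \<chi>" "is_pullback C n q f c"
  shows "classifies C t n (\<chi> \<cdot> f)"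
proof -
  note p = pbD[OF assms(2)]
  have c: "\<chi> \<in> Arr C" "Dom C \<chi> = Cod C c" "Cod C \<chi> = Cod C t"
    "\<And>y. y \<in> Arr C \<Longrightarrow> Cod C y = Cod C c \<Longrightarrow> fac C y c \<longleftrightarrow> fac C (\<chi> \<cdot> y) t"
    using assms(1) by (auto simp: classifies_def)
  show ?thesis
    unfolding classifies_def using p(1-8) c(1-3) pb_fac[OF assms(2)] c(4) by auto
qed

end

locale strict_closure_quasitopos = quasitopos_category + closure_category C k for k +
  assumes strict: "strict_closure C k"
begin

lemma agreeI: "dense_mono C k m \<Longrightarrow> Cod C m = Dom C u \<Longrightarrow> u \<cdot> m = v \<cdot> m \<Longrightarrow> agree C k u v"
  by (auto simp: agree_def)

lemma agree_comp:
  assumes "agree C k u v" "u \<in> Arr C" "v \<in> Arr C" "Dom C u = Dom C v" "x \<in> Arr C" "Cod C x = Dom C u"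
  shows "agree C k (u \<cdot> x) (v \<cdot> x)"
proof -
  obtain m where m: "dense_mono C k m" "Cod C m = Dom C u" "u \<cdot> m = v \<cdot> m"
    using assms(1) by (auto simp: agree_def)
  have ma: "m \<in> Arr C" using dense_Arr[OF m(1)] .
  obtain n q where pb: "is_pullback C n q x m" using pb_exists[of x m] m ma assms by auto
  note p = pbD[OF pb]
  have "u \<cdot> (x \<cdot> n) = v \<cdot> (x \<cdot> n)"
    using p(1-8) assms m(2) ma by (simp add: p(9) m(3)[THEN comp_reassoc])
  then show ?thesis
    using dense_pullback[OF m(1) pb] p(1-8) assms by (intro agreeI[of n]) auto
qed

lemma closed_Ident: "A \<in> Obj C \<Longrightarrow> closed_mono C k (Ident C A)"
proof -
  assume A: "A \<in> Obj C"
  obtain c where c: "closed_mono C k c" "Cod C c = Cod C (Ident C A)"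
    "k (subobj_of C (Ident C A)) = subobj_of C c" "fac C (Ident C A) c"
    using closure_rep[OF mono_Ident[OF A]] .
  have ca: "c \<in> Arr C" using c closed_mono_Arr by blast
  have "subobj_of C c = subobj_of C (Ident C A)"
    using c A ca by (intro subobj_of_eqI) (auto simp: mono_Ident closed_monoD intro: facI[of c])
  then show ?thesis using c A by (simp add: closed_mono_def mono_Ident)
qed

text \<open>Closed monomorphisms are strong by strictness, so the classifier \<open>t0\<close> of
  strong subobjects classifies them. Those among its arrows that come from closed subobjects are the
  ones fixed by the operation that \<open>k\<close> induces on the classifying object.\<close>

lemma closed_classifier_ex:
  obtains t where "closed_classifier C k t"
proof -
  obtain t0 where "strong_subobject_classifier C t0"
    using quasitopos by (auto simp: quasitopos_def)
  then have t0: "t0 \<in> Arr C" "is_terminal C (Dom C t0)"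
    and cl: "\<And>m. strong_mono C m \<Longrightarrow> \<exists>!\<chi>. \<chi> \<in> hom C (Cod C m) (Cod C t0) \<and>
           (\<exists>u \<in> hom C (Dom C m) (Dom C t0). is_pullback C m u \<chi> t0)"
    unfolding strong_subobject_classifier_def by blast+
  have mt0: "mono_arr C t0" using mono_from_terminal t0 by blast
  \<comment> \<open>Strictness provides only some strong member of the class of \<open>c\<close>;
    the classifier is applied to that member and the result carried back to
    \<open>c\<close>.\<close>
  have str: "\<exists>n. strong_mono C n \<and> mono_arr C n \<and> subobj_of C c = subobj_of C n \<and> Cod C n = Cod C c"
    if c: "closed_mono C k c" for c
  proof -
    have ca: "c \<in> Arr C" "mono_arr C c" using c closed_mono_Arr closed_monoD by auto
    have "strong_subobj C (k (subobj_of C c))"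
      using strict[unfolded strict_closure_def, rule_format, of "Cod C c" "subobj_of C c"]
        Sub_mem[OF ca(2)] ca by simp
    then obtain n where n: "n \<in> subobj_of C c" "strong_mono C n"
      using c by (auto simp: strong_subobj_def closed_mono_def)
    then have "mono_arr C n" "fac C n c" "fac C c n" using ca by (auto simp: subobj_of_iff)
    then show ?thesis
      using n ca facD_Cod[of n c] by (intro exI[of _ n]) (simp add: subobj_of_eq_iff)
  qed
  have ex0: "\<exists>\<chi>. classifies C t0 c \<chi>" if c: "closed_mono C k c" for c
  proof -
    obtain n where n: "strong_mono C n" "mono_arr C n" "subobj_of C c = subobj_of C n" using str[OF c] by blast
    obtain \<chi> u where "is_pullback C n u \<chi> t0" using cl[OF n(1)] by blast
    then show ?thesis using classifies_cong[OF classifiesI_pullback n(2)] n c closed_monoD by metis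
  qed
  have uniq0: "\<chi> = \<chi>'" if c: "closed_mono C k c" "classifies C t0 c \<chi>" "classifies C t0 c \<chi>'" for c \<chi> \<chi>'
  proof -
    obtain n where n: "strong_mono C n" "mono_arr C n" "subobj_of C c = subobj_of C n" "Cod C n = Cod C c"
      using str[OF c(1)] by blast
    have *: "\<zeta> \<in> hom C (Cod C n) (Cod C t0) \<and> (\<exists>u \<in> hom C (Dom C n) (Dom C t0). is_pullback C n u \<zeta> t0)"
      if "classifies C t0 c \<zeta>" for \<zeta>
    proof -
      have "classifies C t0 n \<zeta>" using classifies_cong[OF that _ n(2,3)] c closed_monoD by blast
      then obtain u where "is_pullback C n u \<zeta> t0" using classifies_pullback mt0 n(2) by blast
      then show ?thesis using pbD[of C n u \<zeta> t0] by (auto intro!: bexI[of _ u])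
    qed
    show ?thesis using *[OF c(2)] *[OF c(3)] cl[OF n(1)] by blast
  qed
  \<comment> \<open>The classifying map \<open>jj\<close> of the closure of \<open>t0\<close> plays
    the part of a Lawvere-Tierney topology. Its fixed points are cut out by the equalizer
    \<open>\<omega>\<close> with the identity.\<close>
  obtain J where J: "closed_mono C k J" "Cod C J = Cod C t0" "k (subobj_of C t0) = subobj_of C J" "fac C t0 J"
    using closure_rep[OF mt0] .
  have Ja: "J \<in> Arr C" "mono_arr C J" using J closed_mono_Arr closed_monoD by auto
  obtain jj where jj: "classifies C t0 J jj" using ex0[OF J(1)] by blast
  then have jja: "jj \<in> Arr C" "Dom C jj = Cod C t0" "Cod C jj = Cod C t0"
    and jjf: "\<And>y. y \<in> Arr C \<Longrightarrow> Cod C y = Cod C t0 \<Longrightarrow> fac C y J \<longleftrightarrow> fac C (jj \<cdot> y) t0"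
    using J by (auto simp: classifies_def)
  obtain \<omega> where \<omega>: "mono_arr C \<omega>" "Cod C \<omega> = Cod C t0" "jj \<cdot> \<omega> = Ident C (Cod C t0) \<cdot> \<omega>"
    "\<And>x. x \<in> Arr C \<Longrightarrow> Cod C x = Cod C t0 \<Longrightarrow> jj \<cdot> x = Ident C (Cod C t0) \<cdot> x \<Longrightarrow> fac C x \<omega>"
    using equalizer_ex[of jj "Ident C (Cod C t0)"] jja t0 by auto
  have \<omega>a: "\<omega> \<in> Arr C" using \<omega> by (simp add: mono_Arr)
  have j\<omega>: "jj \<cdot> \<omega> = \<omega>" using \<omega>(2,3) \<omega>a by simp
  \<comment> \<open>By universality the pullback of \<open>J\<close> along \<open>\<chi>\<close> is
    the closure of \<open>c\<close>, which is \<open>c\<close> again; so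
    \<open>jj \<cdot> \<chi>\<close> classifies \<open>c\<close> as well.\<close>
  have closed_fix: "jj \<cdot> \<chi> = \<chi>" if c: "closed_mono C k c" "classifies C t0 c \<chi>" for c \<chi>
  proof (rule uniq0[OF c(1) _ c(2)])
    have \<chi>: "\<chi> \<in> Arr C" "Dom C \<chi> = Cod C c" "Cod C \<chi> = Cod C t0" using c by (auto simp: classifies_def)
    obtain u where pb: "is_pullback C c u \<chi> t0" using classifies_pullback[OF c(2) mt0] c closed_monoD by blast
    obtain c' u' where pb': "is_pullback C c' u' \<chi> J" using pb_exists[of \<chi> J] \<chi> Ja J by auto
    have "subobj_of C c' = subobj_of C c"
      using closure_pullback[OF mt0 J(3) Ja(2) pb pb'] c(1) by (simp add: closed_mono_def)
    then show "classifies C t0 c (jj \<cdot> \<chi>)"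
      using classifies_comp[OF jj pb'] classifies_cong mono_pullback[OF pb' Ja(2)] closed_monoD[OF c(1)] by blast
  qed
  have "jj \<cdot> t0 = t0"
  proof (rule closed_fix)
    show "closed_mono C k (Ident C (Dom C t0))" using closed_Ident t0 by simp
    have "is_pullback C (Ident C (Dom C t0)) (Ident C (Dom C t0)) t0 t0"
      by (rule pbI) (use t0 mono_cancel[OF mt0] in \<open>auto intro: exI\<close>)
    then show "classifies C t0 (Ident C (Dom C t0)) t0" by (rule classifiesI_pullback)
  qed
  then have "fac C t0 \<omega>" using \<omega>(4)[of t0] t0 by simp
  then obtain t where t: "t \<in> Arr C" "Dom C t = Dom C t0" "Cod C t = Dom C \<omega>" "\<omega> \<cdot> t = t0" by (elim facE)
  have fac_t: "fac C y t \<longleftrightarrow> fac C (\<omega> \<cdot> y) t0" if y: "y \<in> Arr C" "Cod C y = Dom C \<omega>" for y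
  proof
    assume "fac C y t"
    then obtain u where u: "u \<in> Arr C" "Dom C u = Dom C y" "Cod C u = Dom C t" "t \<cdot> u = y" by (elim facE)
    have "\<omega> \<cdot> y = t0 \<cdot> u"
      unfolding u(4)[symmetric] using u(1-3) t(1-3) \<omega>a by (simp add: t(4)[THEN comp_reassoc])
    then show "fac C (\<omega> \<cdot> y) t0" using t0 t(1-3) \<omega>a y u(1-3) by (intro facI[of u]) auto
  next
    assume "fac C (\<omega> \<cdot> y) t0"
    then obtain u where u: "u \<in> Arr C" "Dom C u = Dom C (\<omega> \<cdot> y)" "Cod C u = Dom C t0" "t0 \<cdot> u = \<omega> \<cdot> y"
      by (elim facE)
    have "\<omega> \<cdot> (t \<cdot> u) = \<omega> \<cdot> y" using u(1-3) t(1-3) \<omega>a by (simp add: t(4)[THEN comp_reassoc] u(4))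
    then have "t \<cdot> u = y" using u t y \<omega>a by - (rule mono_cancel[OF \<omega>(1)], auto)
    then show "fac C y t" using u t y \<omega>a by (intro facI[of u]) auto
  qed
  have cls_iff: "classifies C t c \<chi> \<longleftrightarrow> classifies C t0 c (\<omega> \<cdot> \<chi>)"
    if "\<chi> \<in> Arr C" "Dom C \<chi> = Cod C c" "Cod C \<chi> = Dom C \<omega>" for c \<chi>
  proof -
    have "fac C (\<chi> \<cdot> y) t \<longleftrightarrow> fac C (\<omega> \<cdot> \<chi> \<cdot> y) t0" if "y \<in> Arr C" "Cod C y = Cod C c" for y
      using fac_t[of "\<chi> \<cdot> y"] that \<open>\<chi> \<in> Arr C\<close> \<open>Dom C \<chi> = Cod C c\<close> \<open>Cod C \<chi> = Dom C \<omega>\<close> \<omega>a by simp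
    then show ?thesis using that \<omega>a \<omega>(2) t(3) unfolding classifies_def by simp
  qed
  have ex: "\<exists>\<chi>. classifies C t c \<chi>" if c: "closed_mono C k c" for c
  proof -
    obtain \<chi> where \<chi>: "classifies C t0 c \<chi>" using ex0[OF c] by blast
    then have \<chi>a: "\<chi> \<in> Arr C" "Dom C \<chi> = Cod C c" "Cod C \<chi> = Cod C t0" by (auto simp: classifies_def)
    have "fac C \<chi> \<omega>" using closed_fix[OF c \<chi>] \<omega>(4)[of \<chi>] \<chi>a by simp
    then obtain \<xi> where \<xi>: "\<xi> \<in> Arr C" "Dom C \<xi> = Dom C \<chi>" "Cod C \<xi> = Dom C \<omega>" "\<omega> \<cdot> \<xi> = \<chi>" by (elim facE)
    then show "\<exists>\<chi>. classifies C t c \<chi>" using cls_iff[of \<xi> c] \<chi> \<chi>a by auto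
  qed
  have uniq: "\<chi> = \<chi>'" if c: "closed_mono C k c" "classifies C t c \<chi>" "classifies C t c \<chi>'" for c \<chi> \<chi>'
  proof -
    have a: "\<chi> \<in> Arr C" "Dom C \<chi> = Cod C c" "Cod C \<chi> = Dom C \<omega>"
      "\<chi>' \<in> Arr C" "Dom C \<chi>' = Cod C c" "Cod C \<chi>' = Dom C \<omega>"
      using c t by (auto simp: classifies_def)
    have "\<omega> \<cdot> \<chi> = \<omega> \<cdot> \<chi>'" using uniq0[OF c(1)] c a cls_iff by blast
    then show "\<chi> = \<chi>'" using a by - (rule mono_cancel[OF \<omega>(1)], auto)
  qed
  \<comment> \<open>Pulling the closed \<open>J\<close> back along
    \<open>\<omega> \<cdot> \<chi>\<close> gives a closed subobject classified by
    \<open>jj \<cdot> (\<omega> \<cdot> \<chi>)\<close>, and \<open>jj\<close> fixes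
    \<open>\<omega>\<close>.\<close>
  have inv: "\<exists>c. closed_mono C k c \<and> classifies C t c \<chi>" if \<chi>: "\<chi> \<in> Arr C" "Cod C \<chi> = Cod C t" for \<chi>
  proof -
    obtain c u where pb: "is_pullback C c u (\<omega> \<cdot> \<chi>) J" using pb_exists[of "\<omega> \<cdot> \<chi>" J] \<chi> t \<omega>a Ja J \<omega> by auto
    have "classifies C t0 c (jj \<cdot> (\<omega> \<cdot> \<chi>))" using classifies_comp[OF jj pb] .
    then have "classifies C t0 c (\<omega> \<cdot> \<chi>)" using j\<omega>[THEN comp_reassoc] jja \<omega>a \<chi> t \<omega> by simp
    then have "classifies C t c \<chi>"
      using cls_iff[of \<chi> c] \<chi> t pbD[OF pb] \<omega>a by simp
    then show "\<exists>c. closed_mono C k c \<and> classifies C t c \<chi>" using closed_pullback[OF J(1) pb] by blast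
  qed
  have "closed_classifier C k t"
    unfolding closed_classifier_def
  proof (intro conjI allI impI ballI)
    fix c assume "closed_mono C k c"
    then show "\<exists>!\<chi>. classifies C t c \<chi>" using ex uniq by blast
  qed (use t t0 inv in auto)
  then show ?thesis by (rule that)
qed

text \<open>Extending an arrow along a dense \<open>m\<close> means extending a closed subobject
  \<open>c'\<close> of \<open>Dom m\<close>. The closure of \<open>m \<cdot> c'\<close> does this:
  by universality it restricts to the closure of \<open>c'\<close>, that is, to
  \<open>c'\<close>.\<close>

lemma closed_classifier_sheaf:
  assumes "closed_classifier C k t"
  shows "sheaf C k (Cod C t)"
  unfolding sheaf_iff
proof (intro allI impI)
  note ex = closed_classifierD(3)[OF assms] and uniq = closed_classifierD(4)[OF assms]
    and inv = closed_classifierD(5)[OF assms]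
  fix m assume m: "dense_mono C k m"
  have ma: "m \<in> Arr C" "mono_arr C m" using m dense_Arr dense_monoD by auto
  show "orth C m (Cod C t)"
  proof (rule orthI)
    fix u assume u: "u \<in> Arr C" "Dom C u = Dom C m" "Cod C u = Cod C t"
    obtain c' where c': "closed_mono C k c'" "classifies C t c' u" using inv u by blast
    have c'a: "c' \<in> Arr C" "mono_arr C c'" "Cod C c' = Dom C m"
      using c' u closed_mono_Arr closed_monoD by (auto simp: classifies_def)
    have mc: "mono_arr C (m \<cdot> c')" using mono_comp[OF c'a(2) ma(2) c'a(3)] .
    obtain c where c: "closed_mono C k c" "Cod C c = Cod C (m \<cdot> c')" "k (subobj_of C (m \<cdot> c')) = subobj_of C c"
      using closure_rep[OF mc] by metis
    have ca: "c \<in> Arr C" "mono_arr C c" "Cod C c = Cod C m"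
      using c closed_mono_Arr closed_monoD ma c'a by auto
    obtain \<chi> where \<chi>: "classifies C t c \<chi>" using ex c by blast
    obtain q where pb: "is_pullback C c' q m (m \<cdot> c')" using pb_of_comp[OF ma(2) c'a(2,3)] .
    obtain c'' q' where pb': "is_pullback C c'' q' m c" using pb_exists[of m c] ma ca by auto
    have "subobj_of C c'' = subobj_of C c'"
      using closure_pullback[OF mc c(3) ca(2) pb pb'] c' by (simp add: closed_mono_def)
    then have "classifies C t c' (\<chi> \<cdot> m)"
      using classifies_comp[OF \<chi> pb'] classifies_cong mono_pullback[OF pb' ca(2)] c'a by blast
    then have "\<chi> \<cdot> m = u" using uniq c' by blast
    then show "\<exists>v. v \<in> Arr C \<and> Dom C v = Cod C m \<and> Cod C v = Cod C t \<and> v \<cdot> m = u"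
      using \<chi> ca by (auto simp: classifies_def)
  next
    fix u v assume u: "u \<in> Arr C" "Dom C u = Cod C m" "Cod C u = Cod C t"
      and v: "v \<in> Arr C" "Dom C v = Cod C m" "Cod C v = Cod C t" and uv: "u \<cdot> m = v \<cdot> m"
    \<comment> \<open>Half of uniqueness: the pullback of \<open>m\<close> along \<open>c\<close> is
      dense in the domain of \<open>c\<close>, so a closed subobject is contained in another as soon
      as its restriction to \<open>m\<close> is.\<close>
    have *: "fac C c c'"
      if u: "u \<in> Arr C" "Dom C u = Cod C m" "Cod C u = Cod C t"
      and v: "v \<in> Arr C" "Dom C v = Cod C m" "Cod C v = Cod C t" and uv: "u \<cdot> m = v \<cdot> m"
      and c: "closed_mono C k c" "classifies C t c u" and c': "closed_mono C k c'" "classifies C t c' v"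
      for u v c c'
    proof -
      have ca: "c \<in> Arr C" "Cod C c = Cod C m" "c' \<in> Arr C" "Cod C c' = Cod C m"
        using c c' u v closed_mono_Arr by (auto simp: classifies_def)
      obtain p q where pb: "is_pullback C p q c m" using pb_exists[of c m] ca ma by auto
      note b = pbD[OF pb]
      have "fac C (c \<cdot> p) c" using ca b by (intro fac_comp) auto
      then have "fac C (u \<cdot> (c \<cdot> p)) t" using c(2) ca b(1-8) by (simp add: classifies_def)
      moreover have "u \<cdot> (c \<cdot> p) = v \<cdot> (c \<cdot> p)"
        unfolding b(9) using uv[THEN comp_reassoc] b(1-8) u v ma by simp
      ultimately have "fac C (c \<cdot> p) c'" using c'(2) ca b(1-8) by (simp add: classifies_def)
      then show ?thesis
        using dense_fac_closed[OF dense_pullback[OF m pb] c'(1), of c] ca b by simp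
    qed
    obtain c where c: "closed_mono C k c" "classifies C t c u" using inv u by blast
    obtain c' where c': "closed_mono C k c'" "classifies C t c' v" using inv v by blast
    have "fac C c c'" "fac C c' c"
      using *[OF u v uv c c'] *[OF v u uv[symmetric] c' c] by auto
    then have "subobj_of C c' = subobj_of C c" using c c' closed_monoD by (simp add: subobj_of_eq_iff)
    then have "classifies C t c v" using classifies_cong[OF c'(2)] c c' closed_monoD by metis
    then show "u = v" using uniq c by blast
  qed
qed

text \<open>The arrow \<open>s\<close> is the transpose of the classifying map of the closed diagonal, so that the
  sheaf below is a power of the classifier of closed subobjects.\<close>

lemma kernel_embedding:
  assumes X: "X \<in> Obj C"
  obtains p q d s where "p \<in> Arr C" "q \<in> Arr C" "Dom C p = Dom C q" "Cod C p = X" "Cod C q = X"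
    "dense_mono C k d" "Dom C d = X" "Cod C d = Dom C q" "p \<cdot> d = Ident C X" "q \<cdot> d = Ident C X"
    "s \<in> Arr C" "Dom C s = X" "sheaf C k (Cod C s)"
    "\<forall>u \<in> Arr C. \<forall>v \<in> Arr C. Dom C u = Dom C v \<longrightarrow> Cod C u = X \<longrightarrow> Cod C v = X \<longrightarrow> s \<cdot> u = s \<cdot> v \<longrightarrow>
      (\<exists>z \<in> Arr C. Dom C z = Dom C u \<and> Cod C z = Dom C q \<and> p \<cdot> z = u \<and> q \<cdot> z = v)"
proof -
  obtain t where cc: "closed_classifier C k t" using closed_classifier_ex .
  note t = closed_classifierD[OF cc]
  have \<Omega>: "sheaf C k (Cod C t)" by (rule closed_classifier_sheaf[OF cc])
  obtain f where f: "f \<in> Arr C" "Dom C f = X" "Cod C f = Dom C t"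
    using terminal_arrow[OF t(2) X] by metis
  obtain e K where rp: "represents_partial C f (Cod C t) e K"
    using represents_partial_ex[OF f(1), of "Cod C t"] t by auto
  note R = rpD[OF rp]
  have M: "sheaf C k (Dom C e)"
    unfolding sheaf_iff
  proof (intro allI impI)
    fix m assume m: "dense_mono C k m"
    show "orth C m (Dom C e)"
    proof (rule rp_orth[OF rp dense_Arr[OF m]])
      show "orth C m (Cod C f)" using orth_terminal[OF t(2) dense_Arr[OF m]] f by simp
      fix r s b r' assume "is_pullback C b r' r m"
      then show "orth C b (Cod C t)" using dense_pullback[OF m] \<Omega> by (simp add: sheaf_iff)
    qed
  qed
  \<comment> \<open>Since \<open>Cod f\<close> is terminal, this pullback is the product
    \<open>X \<times> X\<close>, with diagonal \<open>\<delta>\<close>.\<close>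
  obtain r0 s0 where pb0: "is_pullback C r0 s0 f f" using pb_exists[OF f(1) f(1)] by blast
  note b0 = pbD[OF pb0]
  obtain \<delta> where \<delta>: "\<delta> \<in> Arr C" "Dom C \<delta> = X" "Cod C \<delta> = Dom C s0" "r0 \<cdot> \<delta> = Ident C X" "s0 \<cdot> \<delta> = Ident C X"
    using pb_lift[OF pb0, of "Ident C X" "Ident C X"] X f by auto
  have "mono_arr C \<delta>" by (rule mono_split[of \<delta> r0]) (use \<delta> b0 f in auto)
  then obtain c d where c: "closed_mono C k c" "dense_mono C k d" "Cod C d = Dom C c" "Dom C d = Dom C \<delta>"
    "Cod C c = Cod C \<delta>" "c \<cdot> d = \<delta>" using factorization by metis
  have ca: "c \<in> Arr C" "d \<in> Arr C" using c closed_mono_Arr dense_Arr by auto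
  obtain \<sigma> where \<sigma>: "classifies C t c \<sigma>" using t(3) c by blast
  then have \<sigma>a: "\<sigma> \<in> Arr C" "Dom C \<sigma> = Dom C s0" "Cod C \<sigma> = Cod C t"
    and \<sigma>f: "\<And>y. y \<in> Arr C \<Longrightarrow> Cod C y = Dom C s0 \<Longrightarrow> fac C y c \<longleftrightarrow> fac C (\<sigma> \<cdot> y) t"
    using c \<delta> by (auto simp: classifies_def)
  obtain s where s: "s \<in> Arr C" "Dom C s = Dom C f" "Cod C s = Dom C e" "e \<cdot> s = f" "K s r0 s0 \<sigma>"
    using rp_curry[OF rp pb0 \<sigma>a] by blast
  \<comment> \<open>Leibniz's principle: equality of \<open>s \<cdot> u\<close> and
    \<open>s \<cdot> v\<close> says that \<open>u\<close> and \<open>v\<close> stand in the closed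
    diagonal with the same parameters. The pair \<open>(v, v)\<close> does, hence so does
    \<open>(u, v)\<close>.\<close>
  have key: "\<exists>z \<in> Arr C. Dom C z = Dom C u \<and> Cod C z = Dom C (s0 \<cdot> c) \<and> r0 \<cdot> c \<cdot> z = u \<and> s0 \<cdot> c \<cdot> z = v"
    if u: "u \<in> Arr C" "Cod C u = X" and v: "v \<in> Arr C" "Cod C v = X" and d: "Dom C u = Dom C v"
    and suv: "s \<cdot> u = s \<cdot> v" for u v
  proof -
    have fuv: "f \<cdot> v = f \<cdot> u" using u v d f by - (rule terminal_uniq[OF t(2)], auto)
    obtain r1 s1 where pb1: "is_pullback C r1 s1 (f \<cdot> u) f" using pb_exists[of "f \<cdot> u" f] f u by auto
    note b1 = pbD[OF pb1]
    have b1_eq: "f \<cdot> (u \<cdot> r1) = f \<cdot> s1" using b1 u f by simp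
    have b1_eq': "f \<cdot> (v \<cdot> r1) = f \<cdot> s1"
      using b1(1-8) b1_eq u v d f by (simp add: fuv[THEN comp_reassoc])
    obtain ku where ku: "ku \<in> Arr C" "Dom C ku = Dom C s1" "Cod C ku = Dom C s0" "r0 \<cdot> ku = u \<cdot> r1" "s0 \<cdot> ku = s1"
      using pb_lift[OF pb0, of "u \<cdot> r1" s1] b1(1-8) b1_eq u f by auto
    obtain kv where kv: "kv \<in> Arr C" "Dom C kv = Dom C s1" "Cod C kv = Dom C s0" "r0 \<cdot> kv = v \<cdot> r1" "s0 \<cdot> kv = s1"
      using pb_lift[OF pb0, of "v \<cdot> r1" s1] b1(1-8) b1_eq' v d u f by auto
    have esu: "e \<cdot> (s \<cdot> u) = f \<cdot> u" using s u R f by (simp add: s(4)[THEN comp_reassoc])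
    have esv: "e \<cdot> (s \<cdot> v) = f \<cdot> u" using s v R f by (simp add: s(4)[THEN comp_reassoc] fuv)
    have 1: "K (s \<cdot> u) r1 s1 (\<sigma> \<cdot> ku)"
      using \<sigma>a ku s u f b1(1-8) by - (rule rp_natural[OF rp pb0 s(1,3,4) \<sigma>a s(5) u(1) _ pb1 esu], auto)
    have 2: "K (s \<cdot> v) r1 s1 (\<sigma> \<cdot> kv)"
      using \<sigma>a kv s v d u f b1(1-8) by - (rule rp_natural[OF rp pb0 s(1,3,4) \<sigma>a s(5) v(1) _ pb1 esv], auto)
    have eq: "\<sigma> \<cdot> ku = \<sigma> \<cdot> kv"
      using 1[unfolded suv] 2 \<sigma>a ku(1-3) kv(1-3) s v f
      by - (rule rp_uncurry_uniq[OF rp pb1 _ _ esv], auto)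
    \<comment> \<open>This graph of \<open>v\<close> substitutes \<open>v\<close> for the free
      parameter \<open>s1\<close>.\<close>
    obtain w where w: "w \<in> Arr C" "Dom C w = Dom C v" "Cod C w = Dom C s1" "r1 \<cdot> w = Ident C (Dom C u)" "s1 \<cdot> w = v"
      using pb_lift[OF pb1, of "Ident C (Dom C u)" v] u v d f fuv by auto
    have kuw: "r0 \<cdot> (ku \<cdot> w) = u" "s0 \<cdot> (ku \<cdot> w) = v"
      using ku(1-3) w u b0(1-8) b1(1-8) d f by (simp_all add: ku(4,5)[THEN comp_reassoc])
    have kvw: "r0 \<cdot> (kv \<cdot> w) = v" "s0 \<cdot> (kv \<cdot> w) = v"
      using kv(1-3) w u v b0(1-8) b1(1-8) d f by (simp_all add: kv(4,5)[THEN comp_reassoc])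
    have dv: "r0 \<cdot> (\<delta> \<cdot> v) = v" "s0 \<cdot> (\<delta> \<cdot> v) = v"
      using \<delta>(1-3) v b0(1-8) f by (simp_all add: \<delta>(4,5)[THEN comp_reassoc])
    have "kv \<cdot> w = \<delta> \<cdot> v"
      using kv(1-3) w(1-3) \<delta>(1-3) v by - (rule pb_uniq[OF pb0], auto simp: kvw dv)
    moreover have "\<sigma> \<cdot> (ku \<cdot> w) = \<sigma> \<cdot> (kv \<cdot> w)"
      using ku(1-3) kv(1-3) w(1-3) \<sigma>a by (simp add: eq[THEN comp_reassoc])
    moreover have "fac C (\<delta> \<cdot> v) c"
      using c(6)[symmetric] ca c v \<delta>(1-3) by (intro facI[of "d \<cdot> v"]) auto
    ultimately have "fac C (ku \<cdot> w) c"
      using \<sigma>f[of "\<delta> \<cdot> v"] \<sigma>f[of "ku \<cdot> w"] ku(1-3) w(1-3) \<delta>(1-3) v by simp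
    then obtain z where "z \<in> Arr C" "Dom C z = Dom C (ku \<cdot> w)" "Cod C z = Dom C c" "c \<cdot> z = ku \<cdot> w" by (elim facE)
    then show ?thesis
      using kuw b0(1-8) ca c \<delta>(1-3) w(1-3) ku(1-3) d by (intro bexI[of _ z]) auto
  qed
  show ?thesis
  proof (rule that[of "r0 \<cdot> c" "s0 \<cdot> c" d s])
    show "r0 \<cdot> c \<cdot> d = Ident C X" "s0 \<cdot> c \<cdot> d = Ident C X"
      using b0(1-8) ca c \<delta> by simp_all
    show "\<forall>u \<in> Arr C. \<forall>v \<in> Arr C. Dom C u = Dom C v \<longrightarrow> Cod C u = X \<longrightarrow> Cod C v = X \<longrightarrow> s \<cdot> u = s \<cdot> v \<longrightarrow>
      (\<exists>z \<in> Arr C. Dom C z = Dom C u \<and> Cod C z = Dom C (s0 \<cdot> c) \<and> r0 \<cdot> c \<cdot> z = u \<and> s0 \<cdot> c \<cdot> z = v)"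
      using key by blast
  qed (use b0(1-8) ca c \<delta> s f M in auto)
qed

text \<open>Separated objects cannot distinguish the projections of the closed diagonal, since these
  agree on a dense subobject. Every arrow into such an object, in particular \<open>s\<close>,
  therefore passes to the quotient, and the kernel property of \<open>s\<close> makes the induced
  \<open>n\<close> monic.\<close>

lemma separated_reflection_ex:
  assumes X: "X \<in> Obj C"
  obtains \<pi> n where "epi_arr C \<pi>" "Dom C \<pi> = X" "mono_arr C n" "Dom C n = Cod C \<pi>" "sheaf C k (Cod C n)"
    "\<forall>Y. separated C k Y \<longrightarrow> orth C \<pi> Y"
    "\<forall>u \<in> Arr C. \<forall>v \<in> Arr C. Dom C u = Dom C v \<longrightarrow> Cod C u = X \<longrightarrow> Cod C v = X \<longrightarrow> \<pi> \<cdot> u = \<pi> \<cdot> v \<longrightarrow>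
      agree C k u v"
proof -
  obtain p q d s where pq: "p \<in> Arr C" "q \<in> Arr C" "Dom C p = Dom C q" "Cod C p = X" "Cod C q = X"
    and d: "dense_mono C k d" "Dom C d = X" "Cod C d = Dom C q" "p \<cdot> d = Ident C X" "q \<cdot> d = Ident C X"
    and s: "s \<in> Arr C" "Dom C s = X" "sheaf C k (Cod C s)"
    and ker: "\<forall>u \<in> Arr C. \<forall>v \<in> Arr C. Dom C u = Dom C v \<longrightarrow> Cod C u = X \<longrightarrow> Cod C v = X \<longrightarrow> s \<cdot> u = s \<cdot> v \<longrightarrow>
      (\<exists>z \<in> Arr C. Dom C z = Dom C u \<and> Cod C z = Dom C q \<and> p \<cdot> z = u \<and> q \<cdot> z = v)"
    using kernel_embedding[OF X] .
  have da: "d \<in> Arr C" using dense_Arr[OF d(1)] .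
  have pq_agree: "agree C k p q" using d pq by (intro agreeI[OF d(1)]) auto
  \<comment> \<open>The arrow \<open>d\<close> is a common section of \<open>p\<close> and
    \<open>q\<close>, so the two legs coincide and this pushout is the coequalizer of
    \<open>p\<close> and \<open>q\<close>.\<close>
  obtain i j where po: "is_pushout C i j p q" using pushout_ex[of p q] pq by auto
  note P = poD[OF po]
  have "i \<cdot> (p \<cdot> d) = j \<cdot> (q \<cdot> d)"
    using P(1-8) da d(2,3) pq by (simp add: P(9)[THEN comp_reassoc] del: d(4,5))
  then have ij: "j = i" using P(1-8) d(4,5) pq by simp
  have ipq: "i \<cdot> p = i \<cdot> q" using P(9) ij by simp
  have epi: "epi_arr C i"
  proof (rule epiI)
    fix f g assume a: "f \<in> Arr C" "g \<in> Arr C" "Cod C f = Cod C g" "Dom C f = Cod C i" "Dom C g = Cod C i"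
      "f \<cdot> i = g \<cdot> i"
    have "f \<cdot> j = g \<cdot> j" using a ij by simp
    then show "f = g" using a P(6) by - (rule po_uniq[OF po], auto)
  qed (use P in simp)
  have lift: "\<exists>v. v \<in> Arr C \<and> Dom C v = Cod C i \<and> Cod C v = Cod C u \<and> v \<cdot> i = u"
    if u: "u \<in> Arr C" "Dom C u = X" "separated C k (Cod C u)" for u
  proof -
    obtain m where m: "dense_mono C k m" "Cod C m = Dom C p" "p \<cdot> m = q \<cdot> m"
      using pq_agree by (auto simp: agree_def)
    have ma: "m \<in> Arr C" using dense_Arr[OF m(1)] .
    have "u \<cdot> p \<cdot> m = u \<cdot> q \<cdot> m" using u pq m(2,3) ma by simp
    then have "agree C k (u \<cdot> p) (u \<cdot> q)" using u pq m by (intro agreeI[OF m(1)]) auto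
    then have "u \<cdot> p = u \<cdot> q" using u pq by - (rule separated_agree[OF u(3)], auto)
    then obtain w where "w \<in> Arr C" "Cod C w = Cod C u" "Dom C w = Cod C j" "w \<cdot> i = u" "w \<cdot> j = u"
      using po_lift[OF po, of u u] u pq by auto
    then show ?thesis using ij by auto
  qed
  obtain n where n: "n \<in> Arr C" "Dom C n = Cod C i" "Cod C n = Cod C s" "n \<cdot> i = s"
    using lift[OF s(1,2) sheaf_imp_separated[OF s(3)]] by blast
  \<comment> \<open>Over successive covers \<open>e1\<close> and \<open>e2\<close> the arrows
    \<open>x\<close> and \<open>y\<close> lift through \<open>i\<close>. The lifts have the same
    image under \<open>s\<close>, so they are related by \<open>p\<close> and \<open>q\<close>, and
    \<open>i\<close> identifies them.\<close>
  have mono: "mono_arr C n"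
  proof (rule monoI)
    fix x y assume x: "x \<in> Arr C" "y \<in> Arr C" "Dom C x = Dom C y" "Cod C x = Dom C n" "Cod C y = Dom C n"
      "n \<cdot> x = n \<cdot> y"
    obtain e1 a where e1: "epi_arr C e1" "e1 \<in> Arr C" "Cod C e1 = Dom C x" "a \<in> Arr C" "Dom C a = Dom C e1"
      "Cod C a = Dom C i" "i \<cdot> a = x \<cdot> e1"
      using epi_cover[OF epi x(1)] x n by auto
    obtain e2 b where e2: "epi_arr C e2" "e2 \<in> Arr C" "Cod C e2 = Dom C (y \<cdot> e1)" "b \<in> Arr C" "Dom C b = Dom C e2"
      "Cod C b = Dom C i" "i \<cdot> b = y \<cdot> e1 \<cdot> e2"
      using epi_cover[OF epi, of "y \<cdot> e1"] x n e1 by auto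
    have e2c: "Cod C e2 = Dom C e1" using e2(3) e1(1-3) x by simp
    have iX: "i \<in> Arr C" "Dom C i = X" using P pq by auto
    have ia: "i \<cdot> (a \<cdot> e2) = x \<cdot> (e1 \<cdot> e2)"
      using e1(2-6) e2(2) e2c x iX by (simp add: e1(7)[THEN comp_reassoc])
    have ib: "i \<cdot> b = y \<cdot> (e1 \<cdot> e2)" using e2(7) e1(2,3) e2(2) e2c x by simp
    have "s \<cdot> (a \<cdot> e2) = n \<cdot> (x \<cdot> (e1 \<cdot> e2))"
      using ia n(1-3) e1(2-6) e2(2) e2c iX by (simp flip: n(4))
    also have "\<dots> = n \<cdot> (y \<cdot> (e1 \<cdot> e2))"
      using x(1-5) n(1-3) e1(2,3) e2(2) e2c by (simp add: x(6)[THEN comp_reassoc])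
    also have "\<dots> = s \<cdot> b"
      using ib n(1-3) e1(2-6) e2(2-6) e2c iX by (simp flip: n(4))
    finally have "s \<cdot> (a \<cdot> e2) = s \<cdot> b" .
    then obtain z where z: "z \<in> Arr C" "Cod C z = Dom C q" "p \<cdot> z = a \<cdot> e2" "q \<cdot> z = b"
      using ker[rule_format, of "a \<cdot> e2" b] e1(2-6) e2(2-6) e2c iX by auto
    have "i \<cdot> (p \<cdot> z) = i \<cdot> (q \<cdot> z)" using z(1,2) pq iX by (simp add: ipq[THEN comp_reassoc])
    then have "x \<cdot> (e1 \<cdot> e2) = y \<cdot> (e1 \<cdot> e2)" using z ia ib by simp
    then show "x = y"
      using x e1(1-3) e2(1,2) e2c
      by - (rule epi_cancel[OF epi_comp[OF e2(1) e1(1) e2c]], auto)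
  qed (use n in simp)
  show ?thesis
  proof (rule that[of i n])
    have "orth C i Y" if Y: "separated C k Y" for Y
      using lift Y P pq by - (rule orthI, auto intro: epi_cancel[OF epi])
    then show "\<forall>Y. separated C k Y \<longrightarrow> orth C i Y" by blast
  next
    have iX: "i \<in> Arr C" "Dom C i = X" using P pq by auto
    have "agree C k u v"
      if u: "u \<in> Arr C" "v \<in> Arr C" "Dom C u = Dom C v" "Cod C u = X" "Cod C v = X" "i \<cdot> u = i \<cdot> v" for u v
    proof -
      have "n \<cdot> i \<cdot> u = n \<cdot> i \<cdot> v" using u n(1-3) iX by simp
      then obtain z where z: "z \<in> Arr C" "Dom C z = Dom C u" "Cod C z = Dom C q" "p \<cdot> z = u" "q \<cdot> z = v"
        using ker[rule_format, OF u(1-5)] n by auto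
      have "agree C k (p \<cdot> z) (q \<cdot> z)" using agree_comp[OF pq_agree pq(1,2,3) z(1)] z pq by simp
      then show "agree C k u v" using z by simp
    qed
    then show "\<forall>u \<in> Arr C. \<forall>v \<in> Arr C. Dom C u = Dom C v \<longrightarrow> Cod C u = X \<longrightarrow> Cod C v = X \<longrightarrow> i \<cdot> u = i \<cdot> v \<longrightarrow>
      agree C k u v" by blast
  qed (use epi mono n P pq s in auto)
qed

end

section \<open>Reflective subcategories\<close>

context category
begin

text \<open>The extensions along \<open>m\<close> into the two legs form a cone because
  \<open>m\<close> cancels at the base.\<close>

lemma orth_pullback:
  assumes pb: "is_pullback C p q f g" and m: "m \<in> Arr C"
    and o: "orth C m (Dom C f)" "orth C m (Dom C g)" "cancels C m (Cod C g)"
  shows "orth C m (Dom C q)"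
proof (rule orthI)
  note b = pbD[OF pb]
  fix u assume u: "u \<in> Arr C" "Dom C u = Dom C m" "Cod C u = Dom C q"
  obtain x where x: "x \<in> Arr C" "Dom C x = Cod C m" "Cod C x = Dom C f" "x \<cdot> m = p \<cdot> u"
    using orthE[OF o(1), of "p \<cdot> u"] u b by auto
  obtain y where y: "y \<in> Arr C" "Dom C y = Cod C m" "Cod C y = Dom C g" "y \<cdot> m = q \<cdot> u"
    using orthE[OF o(2), of "q \<cdot> u"] u b by auto
  have "f \<cdot> x = g \<cdot> y"
    using x y u m b(1-8)
    by - (rule cancelsD[OF o(3)], auto simp: b(9)[THEN comp_reassoc])
  then obtain w where w: "w \<in> Arr C" "Dom C w = Dom C y" "Cod C w = Dom C q" "p \<cdot> w = x" "q \<cdot> w = y"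
    using pb_lift[OF pb, of x y] x y by auto
  have "w \<cdot> m = u"
    using w(1-3) x y u m b(1-8)
    by - (rule pb_uniq[OF pb], auto simp: w(4,5)[THEN comp_reassoc])
  then show "\<exists>v. v \<in> Arr C \<and> Dom C v = Cod C m \<and> Cod C v = Dom C q \<and> v \<cdot> m = u" using w y by auto
next
  note b = pbD[OF pb]
  fix u v assume a: "u \<in> Arr C" "Dom C u = Cod C m" "Cod C u = Dom C q"
    "v \<in> Arr C" "Dom C v = Cod C m" "Cod C v = Dom C q" "u \<cdot> m = v \<cdot> m"
  have "p \<cdot> u = p \<cdot> v" using a b m by - (rule orth_cancel[OF o(1) m], auto)
  moreover have "q \<cdot> u = q \<cdot> v" using a b m by - (rule orth_cancel[OF o(2) m], auto)
  ultimately show "u = v" using a by - (rule pb_uniq[OF pb], auto)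
qed

lemma pb_mono_post:
  assumes pb: "is_pullback C p q f g" and m: "mono_arr C m" "Dom C m = Cod C g"
  shows "is_pullback C p q (m \<cdot> f) (m \<cdot> g)"
proof -
  note b = pbD[OF pb]
  have ma: "m \<in> Arr C" using mono_Arr[OF m(1)] .
  show ?thesis
  proof (rule pbI)
    fix u v assume u: "u \<in> Arr C" "v \<in> Arr C" "Dom C u = Dom C v" "Cod C u = Dom C (m \<cdot> f)"
      "Cod C v = Dom C (m \<cdot> g)" "m \<cdot> f \<cdot> u = m \<cdot> g \<cdot> v"
    have "f \<cdot> u = g \<cdot> v" using u b(1-8) ma m by - (rule mono_cancel[OF m(1)], auto)
    then show "\<exists>w. w \<in> Arr C \<and> Dom C w = Dom C v \<and> Cod C w = Dom C q \<and> p \<cdot> w = u \<and> q \<cdot> w = v"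
      using pb_lift[OF pb, of u v] u(1-5) b(1-8) ma m by auto
  next
    fix x y assume "x \<in> Arr C" "y \<in> Arr C" "Dom C x = Dom C y" "Cod C x = Dom C q" "Cod C y = Dom C q"
      "p \<cdot> x = p \<cdot> y" "q \<cdot> x = q \<cdot> y"
    then show "x = y" by - (rule pb_uniq[OF pb], auto)
  qed (use b ma m in auto)
qed

lemma pb_iso:
  assumes pb: "is_pullback C p q f g" and z: "iso_arr C z" "Cod C z = Dom C q"
  shows "is_pullback C (p \<cdot> z) (q \<cdot> z) f g"
proof -
  note b = pbD[OF pb]
  obtain y where y: "z \<in> Arr C" "y \<in> Arr C" "Dom C y = Cod C z" "Cod C y = Dom C z"
    "y \<cdot> z = Ident C (Dom C z)" "z \<cdot> y = Ident C (Cod C z)"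
    using isoE[OF z(1)] .
  show ?thesis
  proof (rule pbI)
    show "f \<cdot> (p \<cdot> z) = g \<cdot> (q \<cdot> z)" using b(1-8) y z by (simp add: b(9)[THEN comp_reassoc])
  next
    fix u v assume u: "u \<in> Arr C" "v \<in> Arr C" "Dom C u = Dom C v" "Cod C u = Dom C f"
      "Cod C v = Dom C g" "f \<cdot> u = g \<cdot> v"
    obtain w where w: "w \<in> Arr C" "Dom C w = Dom C v" "Cod C w = Dom C q" "p \<cdot> w = u" "q \<cdot> w = v"
      using pb_lift[OF pb u] .
    show "\<exists>w. w \<in> Arr C \<and> Dom C w = Dom C v \<and> Cod C w = Dom C (q \<cdot> z) \<and> p \<cdot> z \<cdot> w = u \<and> q \<cdot> z \<cdot> w = v"
      using w b(1-8) y(1-4) z(2) by (intro exI[of _ "y \<cdot> w"]) (auto simp: y(6)[THEN comp_reassoc])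
  next
    fix u v assume a: "u \<in> Arr C" "v \<in> Arr C" "Dom C u = Dom C v" "Cod C u = Dom C (q \<cdot> z)"
      "Cod C v = Dom C (q \<cdot> z)" "p \<cdot> z \<cdot> u = p \<cdot> z \<cdot> v" "q \<cdot> z \<cdot> u = q \<cdot> z \<cdot> v"
    have "z \<cdot> u = z \<cdot> v" using a b(1-8) y(1) z by - (rule pb_uniq[OF pb], auto)
    then have "y \<cdot> z \<cdot> u = y \<cdot> z \<cdot> v" using a b(1-8) y(1-4) z(2) by simp
    then show "u = v" unfolding y(5) using a b(1-8) y(1) z(2) by simp
  qed (use b y z in auto)
qed

end

locale reflective_subcategory = category C for C :: "('o, 'a) cat" (structure) +
  fixes X :: "'o set" and L :: "('o, 'a, 'o, 'a) functor_data" and \<eta> :: "'o \<Rightarrow> 'a"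
  assumes X_Obj: "X \<subseteq> Obj C" and reflection: "is_reflection C (full_sub C X) L \<eta>"
begin

lemma L_obj: "A \<in> Obj C \<Longrightarrow> on_obj L A \<in> X"
  using reflection by (auto simp: is_reflection_def is_functor_def)

lemma L_obj_Obj: "A \<in> Obj C \<Longrightarrow> on_obj L A \<in> Obj C"
  using L_obj X_Obj by blast

lemma L_arr:
  assumes "f \<in> Arr C"
  shows "on_arr L f \<in> Arr C" "Dom C (on_arr L f) = on_obj L (Dom C f)" "Cod C (on_arr L f) = on_obj L (Cod C f)"
proof -
  have "is_functor C (full_sub C X) L" using reflection unfolding is_reflection_def by blast
  then have "on_arr L f \<in> hom (full_sub C X) (on_obj L (Dom C f)) (on_obj L (Cod C f))"
    using assms unfolding is_functor_def by blast
  then show "on_arr L f \<in> Arr C" "Dom C (on_arr L f) = on_obj L (Dom C f)"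
    "Cod C (on_arr L f) = on_obj L (Cod C f)" by simp_all
qed

lemma L_comp:
  assumes "f \<in> Arr C" "g \<in> Arr C" "Cod C f = Dom C g"
  shows "on_arr L (g \<cdot> f) = on_arr L g \<cdot> on_arr L f"
proof -
  have "is_functor C (full_sub C X) L" using reflection unfolding is_reflection_def by blast
  then have "on_arr L (g \<cdot> f) = on_arr L g \<cdot>\<^bsub>full_sub C X\<^esub> on_arr L f"
    using assms unfolding is_functor_def by blast
  then show ?thesis by simp
qed

lemma \<eta>_arr:
  assumes "A \<in> Obj C"
  shows "\<eta> A \<in> Arr C" "Dom C (\<eta> A) = A" "Cod C (\<eta> A) = on_obj L A"
proof -
  have "\<forall>X \<in> Obj C. \<eta> X \<in> hom C X (on_obj L X)" using reflection unfolding is_reflection_def by blast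
  then have "\<eta> A \<in> hom C A (on_obj L A)" using assms by blast
  then show "\<eta> A \<in> Arr C" "Dom C (\<eta> A) = A" "Cod C (\<eta> A) = on_obj L A" by simp_all
qed

lemma \<eta>_natural:
  assumes "f \<in> Arr C" shows "on_arr L f \<cdot> \<eta> (Dom C f) = \<eta> (Cod C f) \<cdot> f"
  using reflection assms unfolding is_reflection_def by blast

lemma \<eta>_orth:
  assumes "A \<in> Obj C" "Y \<in> X" shows "orth C (\<eta> A) Y"
proof -
  have *: "\<forall>A \<in> Obj C. \<forall>Y \<in> X. \<forall>f \<in> hom C A Y. \<exists>!g. g \<in> hom (full_sub C X) (on_obj L A) Y \<and> g \<cdot> \<eta> A = f"
    using reflection unfolding is_reflection_def by simp
  show ?thesis
    unfolding orth_def \<eta>_arr(2,3)[OF assms(1)]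
  proof
    fix f assume "f \<in> hom C A Y"
    then have "\<exists>!g. g \<in> hom (full_sub C X) (on_obj L A) Y \<and> g \<cdot> \<eta> A = f"
      using * assms by blast
    then show "\<exists>!g. g \<in> hom C (on_obj L A) Y \<and> g \<cdot> \<eta> A = f"
      unfolding hom_full_sub[OF L_obj[OF assms(1)] assms(2)] .
  qed
qed

lemma \<eta>_iso:
  assumes "A \<in> X" shows "iso_arr C (\<eta> A)"
proof -
  have A: "A \<in> Obj C" using assms X_Obj by blast
  note e = \<eta>_arr[OF A] and o = \<eta>_orth[OF A]
  obtain r where r: "r \<in> Arr C" "Dom C r = Cod C (\<eta> A)" "Cod C r = A" "r \<cdot> \<eta> A = Ident C A"
    using orthE[OF o[OF assms], of "Ident C A"] A e by auto
  have "\<eta> A \<cdot> r = Ident C (Cod C (\<eta> A))"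
    using r(1-3) e A L_obj_Obj[OF A] by - (rule orth_cancel[OF o[OF L_obj[OF A]] e(1)], auto simp: r(4))
  then show ?thesis using e r by (intro isoI[of "\<eta> A" r]) auto
qed

lemma L_orth_ext:
  assumes "A \<in> Obj C" "Y \<in> X" "u \<in> Arr C" "v \<in> Arr C" "Dom C u = on_obj L A" "Dom C v = on_obj L A"
    "Cod C u = Y" "Cod C v = Y" "u \<cdot> \<eta> A = v \<cdot> \<eta> A"
  shows "u = v"
  using assms(3-) \<eta>_arr[OF assms(1)] by - (rule orth_cancel[OF \<eta>_orth[OF assms(1,2)]], auto)

text \<open>A unit is recognised up to isomorphism by orthogonality: \<open>w\<close> ends in an
  object of \<open>X\<close> and is orthogonal to all of \<open>X\<close>, so it differs from the
  unit by the isomorphism \<open>z\<close>. Along \<open>z\<close> the given projections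
  \<open>p'\<close> and \<open>q'\<close> become \<open>L p\<close> and \<open>L q\<close>.\<close>

lemma stable_unitI:
  assumes pb: "is_pullback C p q f g"
    and pb': "is_pullback C p' q' (on_arr L f) (on_arr L g)" and X': "Dom C q' \<in> X"
    and w: "w \<in> Arr C" "Dom C w = Dom C q" "Cod C w = Dom C q'" "\<And>Y. Y \<in> X \<Longrightarrow> orth C w Y"
      "p' \<cdot> w = \<eta> (Dom C f) \<cdot> p" "q' \<cdot> w = \<eta> (Dom C g) \<cdot> q"
  shows "is_pullback C (on_arr L p) (on_arr L q) (on_arr L f) (on_arr L g)"
proof -
  note b = pbD[OF pb] and b' = pbD[OF pb']
  let ?A = "Dom C q"
  have A: "?A \<in> Obj C" using b by simp
  note e = \<eta>_arr[OF A]
  obtain z where z: "z \<in> Arr C" "Dom C z = Cod C (\<eta> ?A)" "Cod C z = Dom C q'" "z \<cdot> \<eta> ?A = w"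
    using orthE[OF \<eta>_orth[OF A X'], of w] w e by auto
  obtain y where y: "y \<in> Arr C" "Dom C y = Cod C w" "Cod C y = Cod C (\<eta> ?A)" "y \<cdot> w = \<eta> ?A"
    using orthE[OF w(4)[OF L_obj[OF A]], of "\<eta> ?A"] w e by auto
  have "y \<cdot> z = Ident C (Dom C z)"
    using y z e w(1-3) A L_obj[OF A] L_obj_Obj[OF A]
    by - (rule L_orth_ext[OF A L_obj[OF A]], auto)
  moreover have "z \<cdot> y = Ident C (Cod C z)"
    using y z e w(1-3) subsetD[OF X_Obj X'] by - (rule orth_cancel[OF w(4)[OF X'] w(1)], auto)
  ultimately have iso: "iso_arr C z" using y z w(3) by (intro isoI[of z y]) auto
  have 1: "p' \<cdot> z \<cdot> \<eta> ?A = on_arr L p \<cdot> \<eta> ?A"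
    using \<eta>_natural[OF b(3)] b(1-8) b'(1-8) z e w(5) by simp
  have "p' \<cdot> z = on_arr L p"
    using z e b(1-8) b'(1-8) L_arr[OF b(1)] L_arr[OF b(3)] A L_obj[OF dom_obj[OF b(1)]]
    by - (rule L_orth_ext[OF A _ _ _ _ _ _ _ 1], auto)
  moreover have 2: "q' \<cdot> z \<cdot> \<eta> ?A = on_arr L q \<cdot> \<eta> ?A"
    using \<eta>_natural[OF b(4)] b(1-8) b'(1-8) z e w(6) by simp
  have "q' \<cdot> z = on_arr L q"
    using z e b(1-8) b'(1-8) L_arr[OF b(2)] L_arr[OF b(4)] A L_obj[OF dom_obj[OF b(2)]]
    by - (rule L_orth_ext[OF A _ _ _ _ _ _ _ 2], auto)
  ultimately show ?thesis using pb_iso[OF pb' iso z(3)] by simp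
qed

end

lemma (in category) reflection_ex:
  assumes X: "X \<subseteq> Obj C"
    and \<eta>: "\<And>A. A \<in> Obj C \<Longrightarrow> \<eta> A \<in> Arr C" "\<And>A. A \<in> Obj C \<Longrightarrow> Dom C (\<eta> A) = A"
      "\<And>A. A \<in> Obj C \<Longrightarrow> Cod C (\<eta> A) \<in> X" "\<And>A Y. A \<in> Obj C \<Longrightarrow> Y \<in> X \<Longrightarrow> orth C (\<eta> A) Y"
  obtains L where "is_reflection C (full_sub C X) L \<eta>" "\<And>A. on_obj L A = Cod C (\<eta> A)"
proof -
  define Lf where "Lf f = (THE g. g \<in> hom C (Cod C (\<eta> (Dom C f))) (Cod C (\<eta> (Cod C f))) \<and>
    g \<cdot> \<eta> (Dom C f) = \<eta> (Cod C f) \<cdot> f)" for f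
  have Lf: "Lf f \<in> hom C (Cod C (\<eta> (Dom C f))) (Cod C (\<eta> (Cod C f)))"
    "Lf f \<cdot> \<eta> (Dom C f) = \<eta> (Cod C f) \<cdot> f" if f: "f \<in> Arr C" for f
  proof -
    have d: "Dom C f \<in> Obj C" "Cod C f \<in> Obj C" using f by auto
    have "orth C (\<eta> (Dom C f)) (Cod C (\<eta> (Cod C f)))" using \<eta> d by blast
    moreover have "\<eta> (Cod C f) \<cdot> f \<in> hom C (Dom C (\<eta> (Dom C f))) (Cod C (\<eta> (Cod C f)))"
      using \<eta>(1-3) d f by simp
    ultimately have "\<exists>!g. g \<in> hom C (Cod C (\<eta> (Dom C f))) (Cod C (\<eta> (Cod C f))) \<and>
      g \<cdot> \<eta> (Dom C f) = \<eta> (Cod C f) \<cdot> f" unfolding orth_def by blast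
    from theI'[OF this] show "Lf f \<in> hom C (Cod C (\<eta> (Dom C f))) (Cod C (\<eta> (Cod C f)))"
      "Lf f \<cdot> \<eta> (Dom C f) = \<eta> (Cod C f) \<cdot> f" unfolding Lf_def by blast+
  qed
  have Lfa: "Lf f \<in> Arr C" "Dom C (Lf f) = Cod C (\<eta> (Dom C f))" "Cod C (Lf f) = Cod C (\<eta> (Cod C f))"
    if "f \<in> Arr C" for f using Lf(1)[OF that] by simp_all
  have uniq: "u = v" if "A \<in> Obj C" "u \<in> Arr C" "v \<in> Arr C" "Dom C u = Cod C (\<eta> A)" "Dom C v = Cod C (\<eta> A)"
    "Cod C u = Cod C v" "Cod C v \<in> X" "u \<cdot> \<eta> A = v \<cdot> \<eta> A" for A u v
    using that \<eta>(1)[OF that(1)] by - (rule orth_cancel[OF \<eta>(4)[OF that(1,7)]], auto)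
  let ?L = "\<lparr>on_obj = \<lambda>A. Cod C (\<eta> A), on_arr = Lf\<rparr>"
  have "is_reflection C (full_sub C X) ?L \<eta>"
    unfolding is_reflection_def is_functor_def
  proof (intro conjI ballI impI)
    fix A assume A: "A \<in> Obj C"
    show "on_obj ?L A \<in> Obj (full_sub C X)" using \<eta>(3) A by simp
    have CA: "Cod C (\<eta> A) \<in> Obj C" using \<eta>(1) A by simp
    have IA: "Ident C A \<in> Arr C" "Dom C (Ident C A) = A" "Cod C (Ident C A) = A" using A by auto
    have "Lf (Ident C A) = Ident C (Cod C (\<eta> A))"
      using Lfa[OF IA(1)] Lf(2)[OF IA(1)] IA \<eta>(1-3)[OF A] CA A
      by - (rule uniq[OF A], auto)
    then show "on_arr ?L (Ident C A) = Ident (full_sub C X) (on_obj ?L A)" by simp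
    show "\<eta> A \<in> hom C A (on_obj ?L A)" using \<eta> A by simp
  next
    fix f assume f: "f \<in> Arr C"
    show "on_arr ?L f \<in> hom (full_sub C X) (on_obj ?L (Dom C f)) (on_obj ?L (Cod C f))"
      using Lfa[OF f] \<eta>(3) f by simp
    show "on_arr ?L f \<cdot> \<eta> (Dom C f) = \<eta> (Cod C f) \<cdot> f" using Lf(2)[OF f] by simp
  next
    fix f g assume fg: "f \<in> Arr C" "g \<in> Arr C" "Cod C f = Dom C g"
    have gf: "g \<cdot> f \<in> Arr C" "Dom C (g \<cdot> f) = Dom C f" "Cod C (g \<cdot> f) = Cod C g" using fg by auto
    have d: "Dom C f \<in> Obj C" "Dom C g \<in> Obj C" "Cod C g \<in> Obj C" using fg by auto
    have "Lf (g \<cdot> f) = Lf g \<cdot> Lf f"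
    proof (rule uniq[OF d(1)])
      show "Lf (g \<cdot> f) \<cdot> \<eta> (Dom C f) = Lf g \<cdot> Lf f \<cdot> \<eta> (Dom C f)"
        using Lf(2)[OF gf(1)] Lf(2)[OF fg(1)] Lf(2)[OF fg(2), THEN comp_reassoc, of f] Lfa[OF fg(1)] Lfa[OF fg(2)]
          gf fg d \<eta>(1,2) by simp
    qed (use Lfa[OF gf(1)] Lfa[OF fg(1)] Lfa[OF fg(2)] gf fg \<eta>(3)[OF d(3)] in auto)
    then show "on_arr ?L (g \<cdot> f) = on_arr ?L g \<cdot>\<^bsub>full_sub C X\<^esub> on_arr ?L f" by simp
  next
    fix A Y f assume a: "A \<in> Obj C" "Y \<in> Obj (full_sub C X)" "f \<in> hom C A Y"
    have Y: "Y \<in> X" "Cod C (\<eta> A) \<in> X" using a \<eta>(3) by auto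
    have "\<exists>!g. g \<in> hom C (Cod C (\<eta> A)) Y \<and> g \<cdot> \<eta> A = f"
      using \<eta>(4)[OF a(1) Y(1)] a(3) \<eta>(2)[OF a(1)] unfolding orth_def by (simp del: hom_iff)
    then show "\<exists>!g. g \<in> hom (full_sub C X) (on_obj ?L A) Y \<and> g \<cdot> \<eta> A = f"
      using hom_full_sub[OF Y(2,1), of C] by (simp del: hom_iff)
  qed
  then show ?thesis by (rule that) simp
qed

section \<open>The subquasitopos of a pair of closure operators\<close>

locale closure_pair_quasitopos = strict_closure_quasitopos C k for C :: "('o, 'a) cat" (structure) and k +
  fixes h :: "'a set \<Rightarrow> 'a set"
  assumes universal_h: "universal_closure (Sep C k) h"
    and h_dense_imp: "dense_mono (Sep C k) h m \<Longrightarrow> dense_mono C k m"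
begin

abbreviation Spt where "Spt \<equiv> {A \<in> Obj C. separated C k A}"

sublocale sep: pullback_closed C Spt
  by unfold_locales (auto intro: separated_pullback dest: pbD)

abbreviation S where "S \<equiv> full_sub C Spt"

lemma Sep_eq: "Sep C k = S"
  by (simp add: Sep_def)

sublocale h: closure_category S h
proof -
  interpret pullback_category S by (rule sep.pullback_category_D)
  show "closure_category S h"
    by unfold_locales (use universal_h in \<open>simp add: Sep_eq\<close>)
qed

definition Shv where "Shv = {A \<in> Spt. sheaf S h A}"

lemma Sh_eq: "Sh (Sep C k) h = full_sub C Shv"
  unfolding Sh_def Sep_eq Shv_def by (auto simp: full_sub_def)

lemma Shv_D: "A \<in> Shv \<Longrightarrow> A \<in> Obj C" "A \<in> Shv \<Longrightarrow> separated C k A" "A \<in> Shv \<Longrightarrow> A \<in> Spt"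
  by (auto simp: Shv_def)

lemma h_denseD:
  assumes "dense_mono S h m"
  shows "mono_arr C m" "m \<in> Arr C" "Dom C m \<in> Spt" "Cod C m \<in> Spt" "dense_mono C k m"
proof -
  have "mono_arr S m" using assms by (simp add: dense_mono_def)
  then have "mono_arr C m" "m \<in> Arr S" using sep.mono_D_iff by blast+
  then show "mono_arr C m" "m \<in> Arr C" "Dom C m \<in> Spt" "Cod C m \<in> Spt" by simp_all
  show "dense_mono C k m" using h_dense_imp assms by (simp add: Sep_eq)
qed

lemma Shv_iff: "A \<in> Shv \<longleftrightarrow> A \<in> Spt \<and> (\<forall>m. dense_mono S h m \<longrightarrow> orth C m A)"
proof -
  have "orth S m A \<longleftrightarrow> orth C m A" if "A \<in> Spt" "dense_mono S h m" for m
    using orth_full_sub[of m C Spt A] that h_denseD[OF that(2)] by simp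
  then show ?thesis unfolding Shv_def h.sheaf_iff by blast
qed

lemma h_dense_orth: "dense_mono S h m \<Longrightarrow> Y \<in> Shv \<Longrightarrow> orth C m Y"
  by (simp add: Shv_iff)

text \<open>An \<open>h\<close>-dense monomorphism is \<open>k\<close>-dense, so being a sheaf for
  \<open>k\<close> is the stronger condition. This makes the power of the closed classifier a sheaf
  in which quotients can be embedded.\<close>

lemma k_sheaf_Shv: "sheaf C k A \<Longrightarrow> A \<in> Obj C \<Longrightarrow> A \<in> Shv"
  unfolding Shv_iff using sheaf_imp_separated h_denseD by (auto simp: sheaf_iff)

lemma h_dense_pullback:
  assumes "dense_mono S h d" "is_pullback C n q f d" "f \<in> Arr S"
  shows "dense_mono S h n"
proof -
  note p = pbD[OF assms(2)] and d = h_denseD[OF assms(1)]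
  have f: "Dom C f \<in> Spt" using assms(3) by simp
  have "Dom C q \<in> Spt" using sep.pullback_closed[OF assms(2) f d(3,4)] .
  then have "is_pullback S n q f d"
    using assms(2,3) p d f unfolding sep.pullback_D_iff by simp
  then show ?thesis using h.dense_pullback[OF assms(1)] by blast
qed

lemma Shv_pullback:
  assumes "is_pullback C p q f g" "Dom C f \<in> Shv" "Dom C g \<in> Shv" "Cod C g \<in> Shv"
  shows "Dom C q \<in> Shv"
proof -
  have "separated C k (Dom C q)" using separated_pullback[OF assms(1)] assms Shv_D by blast
  moreover have "orth C m (Dom C q)" if "dense_mono S h m" for m
    using that assms(2-4) h_denseD(2)[OF that]
    by (intro orth_pullback[OF assms(1)] orth_imp_cancels) (auto simp: h_dense_orth)
  ultimately show ?thesis using pbD[OF assms(1)] unfolding Shv_iff by simp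
qed

sublocale sh: pullback_closed C Shv
  by unfold_locales (auto intro: Shv_pullback dest: Shv_D)

text \<open>The unit at \<open>A\<close> is \<open>d \<cdot> \<pi>\<close>. Its factors are kept
  apart because they are handled by different means: the quotient \<open>\<pi>\<close> through
  covers and its kernel relation, the embedding \<open>d\<close> through
  \<open>h\<close>-density.\<close>

definition is_unit :: "'o \<Rightarrow> 'a \<Rightarrow> 'a \<Rightarrow> bool" where
  "is_unit A \<pi> d \<longleftrightarrow> epi_arr C \<pi> \<and> Dom C \<pi> = A \<and> Cod C \<pi> = Dom C d \<and> dense_mono S h d \<and> Cod C d \<in> Shv \<and>
     (\<forall>Y. separated C k Y \<longrightarrow> orth C \<pi> Y) \<and>
     (\<forall>u \<in> Arr C. \<forall>v \<in> Arr C. Dom C u = Dom C v \<longrightarrow> Cod C u = A \<longrightarrow> Cod C v = A \<longrightarrow> \<pi> \<cdot> u = \<pi> \<cdot> v \<longrightarrow>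
      agree C k u v)"

lemma unit_ex:
  assumes A: "A \<in> Obj C"
  obtains \<pi> d where "is_unit A \<pi> d"
proof -
  obtain \<pi> n where \<pi>: "epi_arr C \<pi>" "Dom C \<pi> = A" and n: "mono_arr C n" "Dom C n = Cod C \<pi>" "sheaf C k (Cod C n)"
    and "\<forall>Y. separated C k Y \<longrightarrow> orth C \<pi> Y"
    "\<forall>u \<in> Arr C. \<forall>v \<in> Arr C. Dom C u = Dom C v \<longrightarrow> Cod C u = A \<longrightarrow> Cod C v = A \<longrightarrow> \<pi> \<cdot> u = \<pi> \<cdot> v \<longrightarrow>
      agree C k u v"
    using separated_reflection_ex[OF A] .
  have na: "n \<in> Arr C" using mono_Arr[OF n(1)] .
  have M: "Cod C n \<in> Shv" using k_sheaf_Shv[OF n(3)] na by simp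
  have "Dom C n \<in> Spt" using separated_mono[OF n(1) sheaf_imp_separated[OF n(3)]] na by simp
  then have nS: "mono_arr S n" using n na Shv_D[OF M] unfolding sep.mono_D_iff by simp
  obtain c d where c: "closed_mono S h c" "dense_mono S h d" "Cod S d = Dom S c" "Dom S d = Dom S n"
    "Cod S c = Cod S n" using h.factorization[OF nS] .
  have "sheaf S h (Dom S c)" using h.sheaf_closed_mono[OF c(1)] c(5) M by (simp add: Shv_def)
  moreover have "Cod C d \<in> Spt" using h_denseD[OF c(2)] by simp
  ultimately have "Cod C d \<in> Shv" using c(3) by (simp add: Shv_def)
  then have "is_unit A \<pi> d" unfolding is_unit_def using \<pi> n c \<open>\<forall>Y. _ Y\<close> \<open>\<forall>u \<in> Arr C. _ u\<close> by simp
  then show ?thesis by (rule that)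
qed

lemma unit_arr:
  assumes "is_unit A \<pi> d"
  shows "d \<cdot> \<pi> \<in> Arr C" "Dom C (d \<cdot> \<pi>) = A" "Cod C (d \<cdot> \<pi>) = Cod C d" "\<pi> \<in> Arr C" "Dom C \<pi> = A"
    "Cod C \<pi> = Dom C d" "d \<in> Arr C" "Cod C d \<in> Shv" "Dom C d \<in> Spt"
  using assms h_denseD[of d] epi_Arr[of C \<pi>] by (auto simp: is_unit_def)

lemma unit_orth:
  assumes "is_unit A \<pi> d" "Y \<in> Shv" shows "orth C (d \<cdot> \<pi>) Y"
proof (rule orth_comp)
  show "orth C \<pi> Y" "orth C d Y"
    using assms Shv_D(2) h_dense_orth by (auto simp: is_unit_def)
qed (use unit_arr[OF assms(1)] in auto)

text \<open>Two arrows into \<open>A\<close> identified by \<open>\<pi>\<close> agree on a \<open>k\<close>-dense subobject, so monomorphisms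
  into \<open>A\<close> reflect this relation. Arrows into the codomain of \<open>d\<close> are compared by restricting
  them along \<open>d\<close> and lifting them along the epimorphism \<open>\<pi>\<close>.\<close>

lemma reflect_mono:
  assumes m: "mono_arr C m" and A: "is_unit (Dom C m) \<pi> d" and B: "is_unit (Cod C m) \<pi>' d'"
    and l: "l \<in> Arr C" "Dom C l = Cod C d" "Cod C l = Cod C d'" "l \<cdot> (d \<cdot> \<pi>) = d' \<cdot> \<pi>' \<cdot> m"
    and u: "u \<in> Arr C" "Cod C u = Cod C d" and v: "v \<in> Arr C" "Cod C v = Cod C d"
    and uv: "Dom C u = Dom C v" "Dom C v \<in> Spt" and eq: "l \<cdot> u = l \<cdot> v"
  shows "u = v"
proof -
  have ma: "m \<in> Arr C" using mono_Arr[OF m] .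
  note a = unit_arr[OF A] and b = unit_arr[OF B]
  have d: "dense_mono S h d" "epi_arr C \<pi>" using A by (auto simp: is_unit_def)
  have d': "mono_arr C d'" using B h_denseD(1) by (auto simp: is_unit_def)
  obtain n1 q1 where pb1: "is_pullback C n1 q1 u d" using pb_exists[of u d] u a by auto
  note p1 = pbD[OF pb1]
  have "u \<in> Arr S" using u uv Shv_D(3)[OF a(8)] by simp
  then have dn1: "dense_mono S h n1" using h_dense_pullback[OF d(1) pb1] by blast
  note n1 = h_denseD[OF dn1]
  have vn: "v \<cdot> n1 \<in> Arr C" "Dom C (v \<cdot> n1) = Dom C n1" "Cod C (v \<cdot> n1) = Cod C d"
    using v uv p1(1-8) by auto
  obtain n2 q2 where pb2: "is_pullback C n2 q2 (v \<cdot> n1) d" using pb_exists[of "v \<cdot> n1" d] vn a by auto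
  note p2 = pbD[OF pb2]
  have "v \<cdot> n1 \<in> Arr S" using vn n1 Shv_D(3)[OF a(8)] by simp
  then have dn2: "dense_mono S h n2" using h_dense_pullback[OF d(1) pb2] by blast
  \<comment> \<open>On this \<open>h\<close>-dense subobject both \<open>u\<close> and
    \<open>v\<close> factor through \<open>d\<close>. Their codomain is a sheaf, so equality may be
    tested there.\<close>
  have dn: "dense_mono S h (n1 \<cdot> n2)"
    using h.dense_comp[OF dn2 dn1] p2(7) vn(2) by simp
  let ?n = "n1 \<cdot> n2"
  have un: "u \<cdot> ?n = d \<cdot> (q1 \<cdot> n2)"
    using p1(1-8) p2(1-8) vn(2) u a by (simp add: p1(9)[THEN comp_reassoc])
  have vn': "v \<cdot> ?n = d \<cdot> q2"
    using p2(9) p1(1-8) p2(1-8) vn(2) v uv by simp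
  have x: "q1 \<cdot> n2 \<in> Arr C" "Dom C (q1 \<cdot> n2) = Dom C q2" "Cod C (q1 \<cdot> n2) = Dom C d"
    using p1(1-8) p2(1-8) vn(2) by auto
  have y: "q2 \<in> Arr C" "Cod C q2 = Dom C d" using p2 by auto
  \<comment> \<open>The covers \<open>e1\<close> and \<open>e2\<close> lift the two arrows into the
    quotient, namely \<open>q1 \<cdot> n2\<close> and \<open>q2\<close>, to arrows into the domain
    of \<open>m\<close>.\<close>
  obtain e1 s where e1: "epi_arr C e1" "e1 \<in> Arr C" "Cod C e1 = Dom C q2" "s \<in> Arr C" "Dom C s = Dom C e1"
    "Cod C s = Dom C \<pi>" "\<pi> \<cdot> s = q1 \<cdot> n2 \<cdot> e1"
    using epi_cover[OF d(2), of "q1 \<cdot> n2"] x a by auto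
  have qe: "q2 \<cdot> e1 \<in> Arr C" "Dom C (q2 \<cdot> e1) = Dom C e1" "Cod C (q2 \<cdot> e1) = Cod C \<pi>"
    using y e1(2,3) a by auto
  obtain e2 t where e2: "epi_arr C e2" "e2 \<in> Arr C" "Cod C e2 = Dom C (q2 \<cdot> e1)" "t \<in> Arr C" "Dom C t = Dom C e2"
    "Cod C t = Dom C \<pi>" "\<pi> \<cdot> t = q2 \<cdot> e1 \<cdot> e2"
    using epi_cover[OF d(2) qe(1)] qe by auto
  have e2c: "Cod C e2 = Dom C e1" using e2(3) qe by simp
  let ?s = "s \<cdot> e2"
  have s: "?s \<in> Arr C" "Dom C ?s = Dom C e2" "Cod C ?s = Dom C m" using e1(2-6) e2(2) e2c a by auto
  have t: "t \<in> Arr C" "Dom C t = Dom C e2" "Cod C t = Dom C m" using e2 a by auto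
  have ps: "\<pi> \<cdot> ?s = q1 \<cdot> n2 \<cdot> (e1 \<cdot> e2)"
  proof -
    have "\<pi> \<cdot> s \<cdot> e2 = q1 \<cdot> n2 \<cdot> e1 \<cdot> e2" by (simp only: e1(7))
    then show ?thesis
      using e1(2-6) e2(2) e2c a x p1(1-8) p2(1-8) vn(2) by simp
  qed
  have pt: "\<pi> \<cdot> t = q2 \<cdot> (e1 \<cdot> e2)" using e2(7) y e1(2,3) e2(2) e2c by simp
  let ?e = "e1 \<cdot> e2"
  have e: "?e \<in> Arr C" "Dom C ?e = Dom C e2" "Cod C ?e = Dom C q2" "epi_arr C ?e"
    using e1(1-3) e2(1,2) e2c epi_comp by auto
  have ne: "?n \<in> Arr C" "Dom C ?n = Dom C q2" "Cod C ?n = Dom C v"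
    using p1(1-8) p2(1-8) vn(2) uv by auto
  have lm: "l \<cdot> (d \<cdot> (\<pi> \<cdot> r)) = d' \<cdot> (\<pi>' \<cdot> (m \<cdot> r))" if "r \<in> Arr C" "Cod C r = Dom C m" for r
  proof -
    have "l \<cdot> (d \<cdot> \<pi>) \<cdot> r = d' \<cdot> \<pi>' \<cdot> m \<cdot> r" by (simp only: l(4))
    then show ?thesis using that a b l(1-3) ma by simp
  qed
  have "d' \<cdot> (\<pi>' \<cdot> (m \<cdot> ?s)) = l \<cdot> (u \<cdot> ?n \<cdot> ?e)"
    using lm[OF s(1,3)] ps un x e a by simp
  also have "\<dots> = l \<cdot> u \<cdot> (?n \<cdot> ?e)" using u l(1,2) ne e uv by simp
  also have "\<dots> = l \<cdot> v \<cdot> (?n \<cdot> ?e)" by (simp only: eq)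
  also have "\<dots> = l \<cdot> (v \<cdot> ?n \<cdot> ?e)" using v l(1,2) ne e uv by simp
  also have "\<dots> = d' \<cdot> (\<pi>' \<cdot> (m \<cdot> t))"
    using lm[OF t(1,3)] pt vn' y e a by simp
  finally have "\<pi>' \<cdot> (m \<cdot> ?s) = \<pi>' \<cdot> (m \<cdot> t)"
    using s t ma b by - (rule mono_cancel[OF d'], auto)
  \<comment> \<open>Identification by \<open>\<pi>'\<close> is agreement on a dense
    \<open>w\<close>, and there \<open>m\<close> can be cancelled. So the lifts themselves agree on
    \<open>w\<close>, which becomes an equality after \<open>\<pi>\<close>, as \<open>Dom d\<close>
    is separated.\<close>
  then have "agree C k (m \<cdot> ?s) (m \<cdot> t)"
    using B s t ma unfolding is_unit_def by simp
  then obtain w where w: "dense_mono C k w" "Cod C w = Dom C e2" "m \<cdot> ?s \<cdot> w = m \<cdot> t \<cdot> w"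
    using s ma by (auto simp: agree_def)
  have wa: "w \<in> Arr C" using dense_Arr[OF w(1)] .
  have sw: "?s \<cdot> w = t \<cdot> w"
    using w(2,3) wa s t ma by - (rule mono_cancel[OF m], simp_all)
  have "agree C k (\<pi> \<cdot> ?s) (\<pi> \<cdot> t)"
  proof (rule agreeI[OF w(1)])
    have "\<pi> \<cdot> (?s \<cdot> w) = \<pi> \<cdot> (t \<cdot> w)" by (simp only: sw)
    then show "\<pi> \<cdot> ?s \<cdot> w = \<pi> \<cdot> t \<cdot> w" using wa w(2) s t a by simp
  qed (use s a w in simp)
  then have "\<pi> \<cdot> ?s = \<pi> \<cdot> t"
    using a s t by - (rule separated_agree[of k "Dom C d"], auto)
  then have "q1 \<cdot> n2 \<cdot> ?e = q2 \<cdot> ?e" using ps pt by simp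
  then have "q1 \<cdot> n2 = q2" using x y e by - (rule epi_cancel[OF e(4)], auto)
  then have "u \<cdot> ?n = v \<cdot> ?n" using un vn' by simp
  then show "u = v"
    using u v uv ne by - (rule orth_cancel[OF h_dense_orth[OF dn a(8)]], auto)
qed

section \<open>Stable units of the sheaf reflection\<close>

lemma unit_mono:
  assumes "is_unit A \<pi> d" "A \<in> Shv" shows "mono_arr C (d \<cdot> \<pi>)"
proof -
  note a = unit_arr[OF assms(1)]
  obtain r where "r \<in> Arr C" "Dom C r = Cod C (d \<cdot> \<pi>)" "Cod C r = A" "r \<cdot> (d \<cdot> \<pi>) = Ident C A"
    using orthE[OF unit_orth[OF assms], of "Ident C A"] a Shv_D(1)[OF assms(2)] by auto
  then show ?thesis using a by - (rule mono_split[of _ r], auto)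
qed

text \<open>One factor \<open>a\<close> is stripped from a leg of the cospan; the comparison between
  the two fibred products is then itself a pullback of \<open>a\<close>. Four such steps, for the
  two quotients and the two dense embeddings, build the reflection of a fibred product.\<close>

lemma pullback_step:
  assumes pb: "is_pullback C p q (f \<cdot> a) g" and a: "a \<in> Arr C" "f \<in> Arr C" "Cod C a = Dom C f"
  obtains p' q' b where "is_pullback C p' q' f g" "b \<in> Arr C" "Dom C b = Dom C q" "Cod C b = Dom C q'"
    "q' \<cdot> b = q" "p' \<cdot> b = a \<cdot> p" "is_pullback C b p p' a"
proof -
  note P = pbD[OF pb]
  obtain p' q' where pb': "is_pullback C p' q' f g" using pb_exists[of f g] P a by auto
  note P' = pbD[OF pb']
  obtain b where "b \<in> Arr C" "Dom C b = Dom C p" "Cod C b = Dom C p'" "q' \<cdot> b = q" "p' \<cdot> b = a \<cdot> p"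
    "is_pullback C b p p' a"
    using pb_paste[OF is_pullback_sym[OF pb] is_pullback_sym[OF pb'] a(1,3)] .
  then show ?thesis using that[OF pb'] P P' by auto
qed

text \<open>\<open>rp_orth_fibre\<close> converts orthogonality of \<open>\<pi>\<close> to
  \<open>Dom e\<close> and \<open>Cod g\<close>, both separated, into orthogonality of its pullback
  \<open>b\<close> to \<open>Y\<close>.\<close>

lemma separated_part_orth:
  assumes A: "is_unit A \<pi> d" and pb: "is_pullback C p q f g" and f: "Dom C f = Dom C d"
    and g: "separated C k (Cod C g)" and pb': "is_pullback C b r p \<pi>" and Y: "separated C k Y" "Y \<in> Obj C"
  shows "orth C b Y"
proof -
  note a = unit_arr[OF A] and P = pbD[OF pb]
  obtain e K where rp: "represents_partial C g Y e K" using represents_partial_ex[OF P(2) Y(2)] .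
  note R = rpD[OF rp]
  have "cancels C m (Dom C e)" if m: "dense_mono C k m" for m
  proof (rule rp_cancels[OF rp dense_Arr[OF m]])
    show "cancels C m (Cod C g)" using g m by (simp add: separated_iff)
    show "cancels C b Y" if "is_pullback C b r' r m" for r b r'
      using dense_pullback[OF m that] Y by (simp add: separated_iff)
  qed
  then have "separated C k (Dom C e)" by (simp add: separated_iff)
  then have "orth C \<pi> (Cod C g)" "orth C \<pi> (Dom C e)" using A g by (auto simp: is_unit_def)
  then show ?thesis
    using rp_orth_fibre[OF rp a(4) _ _ P(1) _ pb pb'] a f by simp
qed

lemma unit_pullback:
  assumes pb: "is_pullback C p q f g" and B: "Cod C g \<in> Shv"
    and A: "is_unit (Dom C f) \<pi> d" and D: "is_unit (Dom C g) \<pi>' d'"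
  obtains f' g' p' q' w where "f' \<in> Arr C" "Dom C f' = Cod C d" "Cod C f' = Cod C g" "f' \<cdot> (d \<cdot> \<pi>) = f"
    "g' \<in> Arr C" "Dom C g' = Cod C d'" "Cod C g' = Cod C g" "g' \<cdot> (d' \<cdot> \<pi>') = g"
    "is_pullback C p' q' f' g'" "w \<in> Arr C" "Dom C w = Dom C q" "Cod C w = Dom C q'"
    "p' \<cdot> w = d \<cdot> \<pi> \<cdot> p" "q' \<cdot> w = d' \<cdot> \<pi>' \<cdot> q" "\<forall>Y \<in> Shv. orth C w Y"
proof -
  note P = pbD[OF pb] and a = unit_arr[OF A] and a' = unit_arr[OF D]
  have dd: "dense_mono S h d" "dense_mono S h d'" using A D by (auto simp: is_unit_def)
  obtain f' where f': "f' \<in> Arr C" "Dom C f' = Cod C d" "Cod C f' = Cod C g" "f' \<cdot> (d \<cdot> \<pi>) = f"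
    using orthE[OF unit_orth[OF A B], of f] a P by auto
  obtain g' where g': "g' \<in> Arr C" "Dom C g' = Cod C d'" "Cod C g' = Cod C g" "g' \<cdot> (d' \<cdot> \<pi>') = g"
    using orthE[OF unit_orth[OF D B], of g] a' P by auto
  have pb0: "is_pullback C p q (f' \<cdot> d \<cdot> \<pi>) g" using pb f' a by simp
  obtain p1 q1 b1 where pb1: "is_pullback C p1 q1 (f' \<cdot> d) g"
    and b1: "b1 \<in> Arr C" "Dom C b1 = Dom C q" "Cod C b1 = Dom C q1"
    "q1 \<cdot> b1 = q" "p1 \<cdot> b1 = \<pi> \<cdot> p" "is_pullback C b1 p p1 \<pi>"
    using pullback_step[OF pb0 a(4)] f' a by auto
  have pb1': "is_pullback C q1 p1 (g' \<cdot> d' \<cdot> \<pi>') (f' \<cdot> d)" using is_pullback_sym[OF pb1] g' a' by simp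
  obtain q2 p2 b2 where pb2: "is_pullback C q2 p2 (g' \<cdot> d') (f' \<cdot> d)"
    and b2: "b2 \<in> Arr C" "Dom C b2 = Dom C p1" "Cod C b2 = Dom C p2"
    "p2 \<cdot> b2 = p1" "q2 \<cdot> b2 = \<pi>' \<cdot> q1" "is_pullback C b2 q1 q2 \<pi>'"
    using pullback_step[OF pb1' a'(4)] g' a' by auto
  obtain p3 q3 b3 where pb3: "is_pullback C p3 q3 f' (g' \<cdot> d')"
    and b3: "b3 \<in> Arr C" "Dom C b3 = Dom C q2" "Cod C b3 = Dom C q3"
    "q3 \<cdot> b3 = q2" "p3 \<cdot> b3 = d \<cdot> p2" "is_pullback C b3 p2 p3 d"
    using pullback_step[OF is_pullback_sym[OF pb2] a(7)] f' by auto
  obtain q4 p4 b4 where pb4: "is_pullback C q4 p4 g' f'"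
    and b4: "b4 \<in> Arr C" "Dom C b4 = Dom C p3" "Cod C b4 = Dom C p4"
    "p4 \<cdot> b4 = p3" "q4 \<cdot> b4 = d' \<cdot> q3" "is_pullback C b4 q3 q4 d'"
    using pullback_step[OF is_pullback_sym[OF pb3] a'(7)] g' by auto
  note P1 = pbD[OF pb1] and P2 = pbD[OF pb2] and P3 = pbD[OF pb3] and P4 = pbD[OF pb4]
  note Bs = Shv_D(3)[OF B] Shv_D(3)[OF a(8)] Shv_D(3)[OF a'(8)]
  have "Dom C q3 \<in> Spt"
    using sep.pullback_closed[OF pb3] Bs f' g' a a' by simp
  then have p3S: "p3 \<in> Arr S" using P3(1-8) Bs f' by simp
  have "Dom C p4 \<in> Spt"
    using sep.pullback_closed[OF pb4] Bs f' g' a a' by simp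
  then have q4S: "q4 \<in> Arr S" using P4(1-8) Bs g' by simp
  \<comment> \<open>Stripping both quotients first leaves \<open>b3\<close> and \<open>b4\<close> as
    pullbacks of \<open>h\<close>-dense monomorphisms along arrows between separated objects, where
    universality of \<open>h\<close> applies.\<close>
  have o: "orth C b1 Y" "orth C b2 Y" "orth C b3 Y" "orth C b4 Y" if Y: "Y \<in> Shv" for Y
  proof -
    show "orth C b1 Y"
      using separated_part_orth[OF A pb1 _ _ b1(6)] Shv_D(1,2)[OF Y] Shv_D(2)[OF B] f' a by simp
    show "orth C b2 Y"
      using separated_part_orth[OF D pb2 _ _ b2(6)] Shv_D(1,2)[OF Y] Shv_D(2)[OF B] f' g' a a' by simp
    show "orth C b3 Y"
      using h_dense_orth[OF h_dense_pullback[OF dd(1) b3(6) p3S] Y] .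
    show "orth C b4 Y"
      using h_dense_orth[OF h_dense_pullback[OF dd(2) b4(6) q4S] Y] .
  qed
  have c: "Cod C b1 = Dom C b2" "Cod C b2 = Dom C b3" "Cod C b3 = Dom C b4"
    using b1 b2 b3 b4 P1(6) P2(6) P3(6) by auto
  let ?w = "b4 \<cdot> (b3 \<cdot> (b2 \<cdot> b1))"
  have w: "?w \<in> Arr C" "Dom C ?w = Dom C q" "Cod C ?w = Dom C p4"
    using b1(1-3) b2(1-3) b3(1-3) b4(1-3) c by auto
  have ow: "\<forall>Y \<in> Shv. orth C ?w Y"
    using o b1(1) b2(1) b3(1) b4(1) c by (intro ballI orth_comp) auto
  have "p4 \<cdot> ?w = p3 \<cdot> (b3 \<cdot> (b2 \<cdot> b1))"
    using b1(1-3) b2(1-3) b3(1-3) b4(1-3) c P4(1-8) by (simp add: b4(4)[THEN comp_reassoc])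
  also have "\<dots> = d \<cdot> (p2 \<cdot> (b2 \<cdot> b1))"
    using b1(1-3) b2(1-3) b3(1-3) c P2(1-8) P3(1-8) a f' by (simp add: b3(5)[THEN comp_reassoc])
  also have "\<dots> = d \<cdot> (\<pi> \<cdot> p)"
    using b1(1-3,5) b2(1-3) c P2(1-8) P1(1-8) by (simp add: b2(4)[THEN comp_reassoc])
  also have "\<dots> = d \<cdot> \<pi> \<cdot> p" using a P(1-8) by simp
  finally have pw: "p4 \<cdot> ?w = d \<cdot> \<pi> \<cdot> p" .
  have W: "b3 \<cdot> (b2 \<cdot> b1) \<in> Arr C" "Cod C (b3 \<cdot> (b2 \<cdot> b1)) = Dom C b4"
    using b1(1-3) b2(1-3) b3(1-3) c by auto
  have "Cod C q3 = Dom C d'" "Cod C (b3 \<cdot> (b2 \<cdot> b1)) = Dom C q3" "Dom C q4 = Cod C b4"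
    using P3(8) a' g' W(2) c(3) b3(3) b4(3) P4(6) by auto
  then have "d' \<cdot> (q3 \<cdot> (b3 \<cdot> (b2 \<cdot> b1))) = d' \<cdot> q3 \<cdot> (b3 \<cdot> (b2 \<cdot> b1))"
    "q4 \<cdot> ?w = q4 \<cdot> b4 \<cdot> (b3 \<cdot> (b2 \<cdot> b1))"
    using comp_assoc[of "b3 \<cdot> (b2 \<cdot> b1)" _ _ q3 _ d'] comp_assoc[of "b3 \<cdot> (b2 \<cdot> b1)" _ _ b4 _ q4]
      W a'(7) P3(4) P4(3) b4(1) by simp_all
  then have "q4 \<cdot> ?w = d' \<cdot> (q3 \<cdot> (b3 \<cdot> (b2 \<cdot> b1)))" by (simp only: b4(5))
  also have "\<dots> = d' \<cdot> (q2 \<cdot> (b2 \<cdot> b1))"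
    using b1(1-3) b2(1-3) b3(1-3) c P2(1-8) P3(1-8) by (simp add: b3(4)[THEN comp_reassoc])
  also have "\<dots> = d' \<cdot> (\<pi>' \<cdot> (q1 \<cdot> b1))"
    using b1(1-3) b2(1-3) c P2(1-8) P1(1-8) a' g' by (simp add: b2(5)[THEN comp_reassoc])
  also have "\<dots> = d' \<cdot> \<pi>' \<cdot> q" using a' P(1-8) b1(4) by simp
  finally have qw: "q4 \<cdot> ?w = d' \<cdot> \<pi>' \<cdot> q" .
  have "Cod C ?w = Dom C q4" using w(3) P4(6) by (simp only:)
  then show ?thesis
    by (rule that[OF f' g' is_pullback_sym[OF pb4] w(1,2) _ pw qw ow])
qed

lemma subquasitopos_Shv: "subquasitopos (full_sub C Shv) C"
proof -
  have sub: "Shv \<subseteq> Obj C" using Shv_D by blast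
  have "\<forall>A \<in> Obj C. \<exists>x. is_unit A (fst x) (snd x)"
  proof
    fix A assume "A \<in> Obj C"
    then obtain \<pi> d where "is_unit A \<pi> d" by (rule unit_ex)
    then show "\<exists>x. is_unit A (fst x) (snd x)" by (intro exI[of _ "(\<pi>, d)"]) simp
  qed
  from bchoice[OF this] obtain x where x: "\<forall>A \<in> Obj C. is_unit A (fst (x A)) (snd (x A))" by blast
  define \<rho> \<delta> where "\<rho> A = fst (x A)" and "\<delta> A = snd (x A)" for A
  have u: "is_unit A (\<rho> A) (\<delta> A)" if "A \<in> Obj C" for A using x that by (simp add: \<rho>_def \<delta>_def)
  define \<eta> where "\<eta> A = \<delta> A \<cdot> \<rho> A" for A
  have \<eta>: "\<eta> A \<in> Arr C" "Dom C (\<eta> A) = A" "Cod C (\<eta> A) \<in> Shv" "Cod C (\<eta> A) = Cod C (\<delta> A)"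
    if "A \<in> Obj C" for A
    using unit_arr[OF u[OF that]] by (auto simp: \<eta>_def)
  have o: "orth C (\<eta> A) Y" if "A \<in> Obj C" "Y \<in> Shv" for A Y
    unfolding \<eta>_def by (rule unit_orth[OF u[OF that(1)] that(2)])
  obtain L where L: "is_reflection C (full_sub C Shv) L \<eta>" and Lo: "\<And>A. on_obj L A = Cod C (\<eta> A)"
    using reflection_ex[OF sub, of \<eta>] \<eta> o by blast
  interpret R: reflective_subcategory C Shv L \<eta> by unfold_locales (use sub L in auto)
  have "preserves_monos C (full_sub C Shv) L"
    unfolding preserves_monos_def
  proof (intro allI impI)
    fix m assume m: "mono_arr C m"
    have ma: "m \<in> Arr C" using mono_Arr[OF m] .
    have d: "Dom C m \<in> Obj C" "Cod C m \<in> Obj C" using ma by auto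
    note l = R.L_arr[OF ma]
    have la: "Dom C (on_arr L m) = Cod C (\<delta> (Dom C m))" "Cod C (on_arr L m) = Cod C (\<delta> (Cod C m))"
      using l Lo \<eta> d by auto
    have ln: "on_arr L m \<cdot> (\<delta> (Dom C m) \<cdot> \<rho> (Dom C m)) = \<delta> (Cod C m) \<cdot> \<rho> (Cod C m) \<cdot> m"
      using R.\<eta>_natural[OF ma] by (simp only: \<eta>_def)
    show "mono_arr (full_sub C Shv) (on_arr L m)"
    proof (rule monoI)
      show "on_arr L m \<in> Arr (full_sub C Shv)" using l R.L_obj d by simp
      fix x y assume "x \<in> Arr (full_sub C Shv)" "y \<in> Arr (full_sub C Shv)"
        "Dom (full_sub C Shv) x = Dom (full_sub C Shv) y"
        "Cod (full_sub C Shv) x = Dom (full_sub C Shv) (on_arr L m)"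
        "Cod (full_sub C Shv) y = Dom (full_sub C Shv) (on_arr L m)"
        "on_arr L m \<cdot>\<^bsub>full_sub C Shv\<^esub> x = on_arr L m \<cdot>\<^bsub>full_sub C Shv\<^esub> y"
      then show "x = y"
        using la Shv_D(3)[of "Dom C y"]
        by - (rule reflect_mono[OF m u[OF d(1)] u[OF d(2)] l(1) la ln], auto)
    qed
  qed
  moreover have "has_stable_units C (full_sub C Shv) L"
    unfolding has_stable_units_def
  proof (intro allI impI, elim conjE)
    fix p q f g assume pb: "is_pullback C p q f g" and "Cod C f \<in> Obj (full_sub C Shv)"
    then have B: "Cod C g \<in> Shv" using pbD[OF pb] by simp
    note P = pbD[OF pb]
    have d: "Dom C f \<in> Obj C" "Dom C g \<in> Obj C" "Cod C g \<in> Obj C" using P by auto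
    obtain f' g' p' q' w where f': "f' \<in> Arr C" "Dom C f' = Cod C (\<delta> (Dom C f))" "Cod C f' = Cod C g"
      "f' \<cdot> (\<delta> (Dom C f) \<cdot> \<rho> (Dom C f)) = f"
      and g': "g' \<in> Arr C" "Dom C g' = Cod C (\<delta> (Dom C g))" "Cod C g' = Cod C g"
      "g' \<cdot> (\<delta> (Dom C g) \<cdot> \<rho> (Dom C g)) = g"
      and pb': "is_pullback C p' q' f' g'" and w: "w \<in> Arr C" "Dom C w = Dom C q" "Cod C w = Dom C q'"
      "p' \<cdot> w = \<delta> (Dom C f) \<cdot> \<rho> (Dom C f) \<cdot> p" "q' \<cdot> w = \<delta> (Dom C g) \<cdot> \<rho> (Dom C g) \<cdot> q"
      "\<forall>Y \<in> Shv. orth C w Y"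
      using unit_pullback[OF pb B u[OF d(1)] u[OF d(2)]] .
    \<comment> \<open>\<open>L f\<close> and \<open>L g\<close> end at the reflection of the base,
      whereas \<open>f'\<close> and \<open>g'\<close> end at the base itself. The base being a
      sheaf, its unit is monic, and postcomposing both legs with a monomorphism keeps a
      pullback.\<close>
    let ?b = "\<eta> (Cod C g)"
    have mb: "mono_arr C ?b" unfolding \<eta>_def by (rule unit_mono[OF u[OF d(3)] B])
    have "on_arr L f = ?b \<cdot> f'"
      using R.L_arr[OF P(1)] R.\<eta>_natural[OF P(1)] \<eta>[OF d(1)] \<eta>[OF d(3)] f' P(5) Lo
      by - (rule R.L_orth_ext[OF d(1) \<eta>(3)[OF d(3)]], auto simp: \<eta>_def)
    moreover have "on_arr L g = ?b \<cdot> g'"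
      using R.L_arr[OF P(2)] R.\<eta>_natural[OF P(2)] \<eta>[OF d(2)] \<eta>[OF d(3)] g' P(5) Lo
      by - (rule R.L_orth_ext[OF d(2) \<eta>(3)[OF d(3)]], auto simp: \<eta>_def)
    ultimately have pbL: "is_pullback C p' q' (on_arr L f) (on_arr L g)"
      using pb_mono_post[OF pb' mb] \<eta>[OF d(3)] g' by simp
    have "Dom C q' \<in> Shv"
      using Shv_pullback[OF pb'] f' g' \<eta>(3,4)[OF d(1)] \<eta>(3,4)[OF d(2)] B by simp
    then have "is_pullback C (on_arr L p) (on_arr L q) (on_arr L f) (on_arr L g)"
      using R.stable_unitI[OF pb pbL _ w(1-3)] w(4-6) by (simp add: \<eta>_def)
    then show "is_pullback (full_sub C Shv) (on_arr L p) (on_arr L q) (on_arr L f) (on_arr L g)"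
      unfolding sh.pullback_D_iff using R.L_arr R.L_obj P by simp
  qed
  moreover have "replete (full_sub C Shv) C"
    unfolding replete_def
  proof (intro allI impI, elim conjE)
    fix f assume f: "iso_arr C f" and "Dom C f \<in> Obj (full_sub C Shv)"
    then have D: "Dom C f \<in> Shv" by simp
    obtain g where g: "f \<in> Arr C" "g \<in> Arr C" "Dom C g = Cod C f" "Cod C g = Dom C f"
      "g \<cdot> f = Ident C (Dom C f)" "f \<cdot> g = Ident C (Cod C f)"
      using isoE[OF f] .
    have "mono_arr C g" using g by - (rule mono_split[of g f], auto)
    then have "separated C k (Cod C f)" using separated_mono[of g] g Shv_D(2)[OF D] by simp
    moreover have "orth C m (Cod C f)" if "dense_mono S h m" for m
      using orth_codomain_iso[OF h_dense_orth[OF that D] f] h_denseD[OF that] by simp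
    ultimately show "Cod C f \<in> Obj (full_sub C Shv)" using g(1) by (simp add: Shv_iff)
  qed
  moreover have "full_subcategory (full_sub C Shv) C"
    using sub by (simp add: full_subcategory_def)
  ultimately show ?thesis unfolding subquasitopos_def using L by blast
qed

text \<open>The closed classifier has a sheaf as codomain. If a closed \<open>c\<close> contains
  \<open>m\<close>, the classifying maps of \<open>c\<close> and of the whole object agree on
  \<open>m\<close>; when \<open>m\<close> cancels at that sheaf they are equal, and \<open>c\<close>
  is everything.\<close>

lemma k_dense_iff: "dense_mono C k m \<longleftrightarrow> mono_arr C m \<and> (\<forall>Y \<in> Shv. cancels C m Y)"
proof
  assume "dense_mono C k m"
  then show "mono_arr C m \<and> (\<forall>Y \<in> Shv. cancels C m Y)"
    using Shv_D(2) by (auto simp: dense_mono_def separated_iff)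
next
  assume R: "mono_arr C m \<and> (\<forall>Y \<in> Shv. cancels C m Y)"
  then have m: "mono_arr C m" "m \<in> Arr C" by (auto simp: mono_Arr)
  obtain t where cc: "closed_classifier C k t" using closed_classifier_ex .
  note t = closed_classifierD[OF cc]
  have \<Omega>: "cancels C m (Cod C t)"
    using R k_sheaf_Shv[OF closed_classifier_sheaf[OF cc]] t by simp
  show "dense_mono C k m"
    unfolding dense_iff[OF m(1)]
  proof (intro allI impI)
    fix c assume c: "closed_mono C k c" "fac C m c"
    have ca: "c \<in> Arr C" "Cod C c = Cod C m"
      using closed_mono_Arr[OF c(1)] facD_Cod[OF c(2)] by auto
    let ?I = "Ident C (Cod C m)"
    obtain \<chi> where \<chi>: "classifies C t c \<chi>" using t(3)[OF c(1)] by blast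
    obtain \<tau> where \<tau>: "classifies C t ?I \<tau>" using t(3)[OF closed_Ident, of "Cod C m"] m by auto
    have \<chi>a: "\<chi> \<in> Arr C" "Dom C \<chi> = Cod C m" "Cod C \<chi> = Cod C t"
      and \<tau>a: "\<tau> \<in> Arr C" "Dom C \<tau> = Cod C m" "Cod C \<tau> = Cod C t"
      using \<chi> \<tau> ca m by (auto simp: classifies_def)
    have 1: "fac C (\<chi> \<cdot> y) t \<longleftrightarrow> fac C y c" "fac C (\<tau> \<cdot> y) t \<longleftrightarrow> fac C y ?I" if "y \<in> Arr C" "Cod C y = Cod C m" for y
      using \<chi> \<tau> ca that m by (auto simp: classifies_def)
    have top: "fac C y ?I" if "y \<in> Arr C" "Cod C y = Cod C m" for y
      using that m by (intro facI[of y]) auto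
    have "\<chi> \<cdot> m = \<tau> \<cdot> m"
    proof (rule t(4)[OF closed_Ident])
      show "classifies C t (Ident C (Dom C m)) (\<chi> \<cdot> m)" "classifies C t (Ident C (Dom C m)) (\<tau> \<cdot> m)"
        using \<chi>a \<tau>a m 1[of "m \<cdot> _"] top[of "m \<cdot> _"] fac_comp_right[OF c(2) m(2) ca(1)]
        by (auto simp: classifies_def intro: facI)
    qed (use m in simp)
    then have "\<chi> = \<tau>" using \<chi>a \<tau>a by - (rule cancelsD[OF \<Omega>], auto)
    then show "fac C ?I c" using 1[of ?I] top[of ?I] m by simp
  qed
qed

text \<open>A closed subobject of a sheaf is a sheaf, and an arrow between sheaves that is
  orthogonal to all sheaves is invertible. To use this, the closed part \<open>c\<close> of
  \<open>m\<close> is composed with the unit of its codomain, monic because that codomain is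
  separated. The closed part \<open>c2\<close> of the composite is then invertible, so the composite
  is dense, and with it \<open>c\<close>.\<close>

lemma h_dense_iff: "dense_mono S h m \<longleftrightarrow> mono_arr C m \<and> m \<in> Arr S \<and> (\<forall>Y \<in> Shv. orth C m Y)"
proof
  assume "dense_mono S h m"
  then show "mono_arr C m \<and> m \<in> Arr S \<and> (\<forall>Y \<in> Shv. orth C m Y)"
    using h_denseD[of m] h_dense_orth by simp
next
  assume R: "mono_arr C m \<and> m \<in> Arr S \<and> (\<forall>Y \<in> Shv. orth C m Y)"
  then have m: "mono_arr S m" unfolding sep.mono_D_iff by blast
  obtain c e where ce: "closed_mono S h c" "dense_mono S h e" "Cod S e = Dom S c" "Dom S e = Dom S m"
    "Cod S c = Cod S m" "c \<cdot>\<^bsub>S\<^esub> e = m" using h.factorization[OF m] .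
  note e = h_denseD[OF ce(2)]
  have cS: "mono_arr S c" using ce(1) by (rule h.closed_monoD)
  then have c: "mono_arr C c" "c \<in> Arr C" "Dom C c \<in> Spt" "Cod C c \<in> Spt"
    using sep.mono_D_iff[of c] by auto
  have co: "orth C c Y" if Y: "Y \<in> Shv" for Y
  proof (rule orth_right_factor)
    show "orth C (c \<cdot> e) Y" using R ce(6) Y by simp
    show "orth C e Y" using h_dense_orth[OF ce(2) Y] .
  qed (use c e ce in auto)
  let ?A = "Cod C c"
  obtain \<pi> d where u: "is_unit ?A \<pi> d" using unit_ex[OF cod_obj[OF c(2)]] .
  note a = unit_arr[OF u]
  have d: "dense_mono S h d" using u by (simp add: is_unit_def)
  have "orth C \<pi> ?A" using u c by (simp add: is_unit_def)
  then obtain r where r: "r \<in> Arr C" "Dom C r = Cod C \<pi>" "Cod C r = ?A" "r \<cdot> \<pi> = Ident C ?A"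
    using orthE[of C \<pi> ?A "Ident C ?A"] a c by auto
  have "mono_arr C \<pi>" using r a by - (rule mono_split[of \<pi> r], auto)
  then have "mono_arr C (d \<cdot> \<pi>)" using mono_comp h_denseD(1)[OF d] a by simp
  then have uS: "mono_arr S (d \<cdot> \<pi>)" using a c Shv_D(3)[OF a(8)] unfolding sep.mono_D_iff by simp
  let ?n = "d \<cdot> \<pi> \<cdot> c"
  have nS: "mono_arr S ?n" using h.mono_comp[OF cS uS] a by simp
  obtain c2 e2 where c2: "closed_mono S h c2" "dense_mono S h e2" "Cod S e2 = Dom S c2" "Dom S e2 = Dom S ?n"
    "Cod S c2 = Cod S ?n" "c2 \<cdot>\<^bsub>S\<^esub> e2 = ?n" using h.factorization[OF nS] .
  note e2 = h_denseD[OF c2(2)]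
  have c2a: "mono_arr C c2" "c2 \<in> Arr C" "Dom C c2 \<in> Spt" "Cod C c2 \<in> Spt"
    using h.closed_monoD[OF c2(1)] sep.mono_D_iff[of c2] by auto
  have Z: "Cod C c2 \<in> Shv" using c2(5) a c by simp
  have W: "Dom C c2 \<in> Shv"
    using h.sheaf_closed_mono[OF c2(1)] Z c2a by (simp add: Shv_def)
  have c2o: "orth C c2 Y" if Y: "Y \<in> Shv" for Y
  proof (rule orth_right_factor)
    have "orth C ?n Y" using orth_comp[OF co[OF Y] unit_orth[OF u Y]] a c by simp
    then show "orth C (c2 \<cdot> e2) Y" using c2(6) by simp
    show "orth C e2 Y" using h_dense_orth[OF c2(2) Y] .
  qed (use c2a e2 c2 in auto)
  obtain s where s: "s \<in> Arr C" "Dom C s = Cod C c2" "Cod C s = Dom C c2" "s \<cdot> c2 = Ident C (Dom C c2)"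
    using orthE[OF c2o[OF W], of "Ident C (Dom C c2)"] c2a by auto
  have c2s: "c2 \<cdot> s = Ident C (Cod C c2)"
    using s c2a by - (rule orth_cancel[OF c2o[OF Z]], auto)
  have "dense_mono S h ?n"
    unfolding h.dense_iff[OF nS]
  proof (intro allI impI)
    fix b assume b: "closed_mono S h b" "fac S ?n b"
    have bS: "b \<in> Arr S" using h.closed_mono_Arr[OF b(1)] .
    have "Cod S ?n = Cod S b" using h.facD_Cod[OF b(2) bS] .
    have "fac S c2 b"
    proof (rule h.dense_fac_closed[OF c2(2) b(1)])
      show "fac S (c2 \<cdot>\<^bsub>S\<^esub> e2) b" using b(2) unfolding c2(6) .
      show "Cod S c2 = Cod S b" using c2(5) \<open>Cod S ?n = Cod S b\<close> by (rule trans)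
    qed (use c2(3) c2a in simp_all)
    then have "fac S (c2 \<cdot>\<^bsub>S\<^esub> s) b"
      using h.fac_comp_right[of c2 b s] bS s c2a by simp
    then show "fac S (Ident S (Cod S ?n)) b" using c2s c2(5) by simp
  qed
  then have "dense_mono S h c"
    using h.dense_left[of "d \<cdot> \<pi>" c] uS a c by simp
  then show "dense_mono S h m" using h.dense_comp[OF ce(2), of c] ce by simp
qed

end

text \<open>The operator \<open>k\<close> is recovered first, because its separated objects form the
  category on which \<open>h\<close> acts. Each operator is determined by its dense monomorphisms,
  which are described in terms of the sheaves.\<close>

lemma closure_pair_unique:
  assumes "closure_pair_quasitopos C k h" "closure_pair_quasitopos C k' h'"
    "Sh (Sep C k) h = Sh (Sep C k') h'"
  shows "h = h'" "k = k'"
proof -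
  interpret K: closure_pair_quasitopos C k h by fact
  interpret K': closure_pair_quasitopos C k' h' by fact
  have "Obj (Sh (Sep C k) h) = Obj (Sh (Sep C k') h')" using assms(3) by simp
  then have eq: "K.Shv = K'.Shv" unfolding K.Sh_eq K'.Sh_eq by simp
  show kk: "k = k'"
    by (rule K.universal_closure_unique[OF K.universal K'.universal])
      (simp only: K.k_dense_iff K'.k_dense_iff eq)
  show "h = h'"
  proof (rule K.h.universal_closure_unique[OF K.h.universal])
    show "universal_closure K.S h'" using K'.h.universal kk by simp
    show "dense_mono K.S h m \<longleftrightarrow> dense_mono K.S h' m" for m
      using K.h_dense_iff[of m] K'.h_dense_iff[of m] eq kk by simp
  qed
qed

section \<open>The pair of closure operators of a subquasitopos\<close>

locale subquasitopos_data = quasitopos_category C + reflective_subcategory C X L \<eta>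
  for C :: "('o, 'a) cat" (structure) and X L \<eta> +
  assumes L_preserves_monos: "preserves_monos C (full_sub C X) L"
    and L_stable: "has_stable_units C (full_sub C X) L"
    and X_replete: "replete (full_sub C X) C"
begin

section \<open>Transferring the properties of the reflection from the subcategory to the
  quasitopos\<close>

lemma extend:
  assumes "u \<in> Arr C" "Cod C u \<in> X"
  obtains v where "v \<in> Arr C" "Dom C v = on_obj L (Dom C u)" "Cod C v = Cod C u" "v \<cdot> \<eta> (Dom C u) = u"
proof -
  have d: "Dom C u \<in> Obj C" using assms by simp
  show ?thesis
    using orthE[OF \<eta>_orth[OF d assms(2)], of u] assms \<eta>_arr[OF d] that by auto
qed

text \<open>Preservation is given only for test arrows within the subcategory. An arrow from
  elsewhere into an object of \<open>X\<close> extends along the unit of its domain, which reduces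
  the general case to that one; \<open>pullback_reflect\<close> proceeds likewise.\<close>

lemma L_mono:
  assumes "mono_arr C m" shows "mono_arr C (on_arr L m)"
proof (rule monoI)
  have m: "m \<in> Arr C" using mono_Arr[OF assms] .
  note l = L_arr[OF m]
  have d: "Dom C m \<in> Obj C" "Cod C m \<in> Obj C" using m by auto
  have E: "mono_arr (full_sub C X) (on_arr L m)"
    using L_preserves_monos assms unfolding preserves_monos_def by blast
  show "on_arr L m \<in> Arr C" using l by simp
  fix f g assume a: "f \<in> Arr C" "g \<in> Arr C" "Dom C f = Dom C g" "Cod C f = Dom C (on_arr L m)"
    "Cod C g = Dom C (on_arr L m)" "on_arr L m \<cdot> f = on_arr L m \<cdot> g"
  have c: "Cod C f \<in> X" "Cod C g \<in> X" using a l L_obj[OF d(1)] by auto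
  obtain f' where f': "f' \<in> Arr C" "Dom C f' = on_obj L (Dom C f)" "Cod C f' = Cod C f" "f' \<cdot> \<eta> (Dom C f) = f"
    using extend[OF a(1) c(1)] .
  obtain g' where g': "g' \<in> Arr C" "Dom C g' = on_obj L (Dom C g)" "Cod C g' = Cod C g" "g' \<cdot> \<eta> (Dom C g) = g"
    using extend[OF a(2) c(2)] .
  have A: "Dom C g \<in> Obj C" using a by simp
  have "on_arr L m \<cdot> f' = on_arr L m \<cdot> g'"
    using a f' g' l \<eta>_arr[OF A] L_obj[OF d(2)]
    by - (rule L_orth_ext[OF A L_obj[OF d(2)]], auto)
  then have "f' = g'"
    using a f' g' l L_obj[OF d(1)] L_obj[OF A] by - (rule mono_cancel[OF E], auto)
  then show "f = g" using f'(4) g'(4) a(3) by metis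
qed

lemma pullback_reflect:
  assumes "is_pullback (full_sub C X) p q f g"
  shows "is_pullback C p q f g"
proof -
  interpret E: category "full_sub C X" by (rule category_full_sub[OF category_axioms X_Obj])
  note P = pbD[OF assms, simplified]
  show ?thesis
  proof (rule pbI)
    fix u v assume u: "u \<in> Arr C" "v \<in> Arr C" "Dom C u = Dom C v" "Cod C u = Dom C f" "Cod C v = Dom C g"
      "f \<cdot> u = g \<cdot> v"
    have A: "Dom C v \<in> Obj C" using u by simp
    note e = \<eta>_arr[OF A]
    obtain u' where u': "u' \<in> Arr C" "Dom C u' = on_obj L (Dom C u)" "Cod C u' = Cod C u" "u' \<cdot> \<eta> (Dom C u) = u"
      using extend[OF u(1)] u P by auto
    obtain v' where v': "v' \<in> Arr C" "Dom C v' = on_obj L (Dom C v)" "Cod C v' = Cod C v" "v' \<cdot> \<eta> (Dom C v) = v"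
      using extend[OF u(2)] u P by auto
    have "f \<cdot> u' = g \<cdot> v'"
    proof (rule L_orth_ext[OF A])
      have "f \<cdot> u' \<cdot> \<eta> (Dom C v) = f \<cdot> u" using u(1-5) u' P e by simp
      also have "\<dots> = g \<cdot> v' \<cdot> \<eta> (Dom C v)" using u(2-6) v' P e by simp
      finally show "f \<cdot> u' \<cdot> \<eta> (Dom C v) = g \<cdot> v' \<cdot> \<eta> (Dom C v)" .
      show "Cod C g \<in> X" using P by simp
    qed (use u(1-5) u'(1-3) v'(1-3) P in auto)
    then obtain w where w: "w \<in> Arr C" "Dom C w = Dom C v'" "Cod C w = Dom C q" "p \<cdot> w = u'" "q \<cdot> w = v'"
      using pb_lift[OF assms, of u' v'] u(1-5) u'(1-3) v'(1-3) P L_obj[OF A] by auto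
    show "\<exists>w. w \<in> Arr C \<and> Dom C w = Dom C v \<and> Cod C w = Dom C q \<and> p \<cdot> w = u \<and> q \<cdot> w = v"
      using w u(1-5) u' v' P e by (intro exI[of _ "w \<cdot> \<eta> (Dom C v)"]) (auto simp: w(4,5)[THEN comp_reassoc])
  next
    fix x y assume a: "x \<in> Arr C" "y \<in> Arr C" "Dom C x = Dom C y" "Cod C x = Dom C q" "Cod C y = Dom C q"
      "p \<cdot> x = p \<cdot> y" "q \<cdot> x = q \<cdot> y"
    have A: "Dom C y \<in> Obj C" using a by simp
    note e = \<eta>_arr[OF A]
    obtain x' where x': "x' \<in> Arr C" "Dom C x' = on_obj L (Dom C x)" "Cod C x' = Cod C x" "x' \<cdot> \<eta> (Dom C x) = x"
      using extend[OF a(1)] a P by auto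
    obtain y' where y': "y' \<in> Arr C" "Dom C y' = on_obj L (Dom C y)" "Cod C y' = Cod C y" "y' \<cdot> \<eta> (Dom C y) = y"
      using extend[OF a(2)] a P by auto
    have "p \<cdot> x' = p \<cdot> y'"
    proof (rule L_orth_ext[OF A])
      have "p \<cdot> x' \<cdot> \<eta> (Dom C y) = p \<cdot> x" "p \<cdot> y' \<cdot> \<eta> (Dom C y) = p \<cdot> y" using a(1-5) x' y' P e by simp_all
      then show "p \<cdot> x' \<cdot> \<eta> (Dom C y) = p \<cdot> y' \<cdot> \<eta> (Dom C y)" using a(6) by simp
      show "Cod C p \<in> X" using P by simp
    qed (use a(1-5) x'(1-3) y'(1-3) P in auto)
    moreover have "q \<cdot> x' = q \<cdot> y'"
    proof (rule L_orth_ext[OF A])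
      have "q \<cdot> x' \<cdot> \<eta> (Dom C y) = q \<cdot> x" "q \<cdot> y' \<cdot> \<eta> (Dom C y) = q \<cdot> y" using a(1-5) x' y' P e by simp_all
      then show "q \<cdot> x' \<cdot> \<eta> (Dom C y) = q \<cdot> y' \<cdot> \<eta> (Dom C y)" using a(7) by simp
      show "Cod C q \<in> X" using P by simp
    qed (use a(1-5) x'(1-3) y'(1-3) P in auto)
    ultimately have "x' = y'"
      using a(1-5) x'(1-3) y'(1-3) P L_obj[OF A] by - (rule E.pb_uniq[OF assms], auto)
    then show "x = y" using x'(4) y'(4) a(3) by metis
  qed (use P in auto)
qed

lemma L_pullback:
  assumes "is_pullback C p q f g" "Cod C g \<in> X"
  shows "is_pullback C (on_arr L p) (on_arr L q) (on_arr L f) (on_arr L g)"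
proof -
  have "Cod C f \<in> Obj (full_sub C X)" using assms pbD[OF assms(1)] by simp
  then show ?thesis
    using L_stable assms(1) pullback_reflect unfolding has_stable_units_def by blast
qed

lemma terminal_in_X:
  assumes T: "is_terminal C T" shows "T \<in> X"
proof -
  have To: "T \<in> Obj C" using T by (simp add: is_terminal_def)
  note e = \<eta>_arr[OF To]
  obtain r where r: "r \<in> Arr C" "Dom C r = on_obj L T" "Cod C r = T"
    using terminal_arrow[OF T L_obj_Obj[OF To]] .
  have r1: "r \<cdot> \<eta> T = Ident C T" using r e To by - (rule terminal_uniq[OF T], auto)
  have "\<eta> T \<cdot> r = Ident C (on_obj L T)"
    using r e To L_obj_Obj[OF To] r1 by - (rule L_orth_ext[OF To L_obj[OF To]], auto)
  then have "iso_arr C r" using r r1 e by (intro isoI[of r "\<eta> T"]) auto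
  moreover have "Dom C r \<in> X" using r L_obj[OF To] by simp
  ultimately show ?thesis using X_replete r unfolding replete_def by auto
qed

text \<open>The product of the two codomains is a pullback over the terminal object, which lies in
  \<open>X\<close>, so \<open>L\<close> preserves it; \<open>L\<close> also preserves the
  monomorphism \<open>m = (p, q)\<close> into it. Hence equality after the units of the two factors
  lifts to equality after the unit of the source.\<close>

lemma \<eta>_jointly_mono:
  assumes p: "p \<in> Arr C" and q: "q \<in> Arr C" "Dom C p = Dom C q"
    and joint: "\<And>x y. x \<in> Arr C \<Longrightarrow> y \<in> Arr C \<Longrightarrow> Dom C x = Dom C y \<Longrightarrow> Cod C x = Dom C q \<Longrightarrow> Cod C y = Dom C q \<Longrightarrow>
      p \<cdot> x = p \<cdot> y \<Longrightarrow> q \<cdot> x = q \<cdot> y \<Longrightarrow> x = y"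
    and x: "x \<in> Arr C" "Cod C x = Dom C q" and y: "y \<in> Arr C" "Cod C y = Dom C q" "Dom C x = Dom C y"
    and eq: "\<eta> (Cod C p) \<cdot> (p \<cdot> x) = \<eta> (Cod C p) \<cdot> (p \<cdot> y)" "\<eta> (Cod C q) \<cdot> (q \<cdot> x) = \<eta> (Cod C q) \<cdot> (q \<cdot> y)"
  shows "\<eta> (Dom C q) \<cdot> x = \<eta> (Dom C q) \<cdot> y"
proof -
  obtain T where T: "is_terminal C T" using terminal_ex .
  obtain a where a: "a \<in> Arr C" "Dom C a = Cod C p" "Cod C a = T" using terminal_arrow[OF T cod_obj[OF p]] .
  obtain b where b: "b \<in> Arr C" "Dom C b = Cod C q" "Cod C b = T" using terminal_arrow[OF T cod_obj[OF q(1)]] .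
  obtain p1 q1 where pb: "is_pullback C p1 q1 a b" using pb_exists[of a b] a b by auto
  note P = pbD[OF pb]
  have "a \<cdot> p = b \<cdot> q" using a b p q by - (rule terminal_uniq[OF T], auto)
  then obtain m where m: "m \<in> Arr C" "Dom C m = Dom C q" "Cod C m = Dom C q1" "p1 \<cdot> m = p" "q1 \<cdot> m = q"
    using pb_lift[OF pb, of p q] a b p q by auto
  have "mono_arr C m"
  proof (rule monoI)
    fix f g assume f: "f \<in> Arr C" "g \<in> Arr C" "Dom C f = Dom C g" "Cod C f = Dom C m" "Cod C g = Dom C m"
      "m \<cdot> f = m \<cdot> g"
    have "p1 \<cdot> (m \<cdot> f) = p1 \<cdot> (m \<cdot> g)" "q1 \<cdot> (m \<cdot> f) = q1 \<cdot> (m \<cdot> g)" using f(6) by simp_all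
    then show "f = g"
      using f(1-5) m(1-3) P(1-8) by - (rule joint, auto simp: m(4,5)[THEN comp_reassoc])
  qed (use m in simp)
  then have mono: "mono_arr C (on_arr L m)" by (rule L_mono)
  have pbL: "is_pullback C (on_arr L p1) (on_arr L q1) (on_arr L a) (on_arr L b)"
    using L_pullback[OF pb] b terminal_in_X[OF T] by simp
  note PL = pbD[OF pbL]
  have d: "Dom C q \<in> Obj C" "Dom C q1 \<in> Obj C" "Cod C p \<in> Obj C" "Cod C q \<in> Obj C" using p q P by auto
  note e = \<eta>_arr[OF d(1)] \<eta>_arr[OF d(2)] \<eta>_arr[OF d(3)] \<eta>_arr[OF d(4)]
  note l = L_arr[OF m(1)] L_arr[OF P(3)] L_arr[OF P(4)]
  have Lm: "on_arr L m \<cdot> (\<eta> (Dom C q) \<cdot> z) = \<eta> (Dom C q1) \<cdot> (m \<cdot> z)" if "z \<in> Arr C" "Cod C z = Dom C q" for z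
  proof -
    have "on_arr L m \<cdot> \<eta> (Dom C q) = \<eta> (Dom C q1) \<cdot> m" using \<eta>_natural[OF m(1)] m by simp
    then show ?thesis using that e l m by (simp add: comp_reassoc[where f = "on_arr L m"])
  qed
  have Lp: "on_arr L p1 \<cdot> (\<eta> (Dom C q1) \<cdot> (m \<cdot> z)) = \<eta> (Cod C p) \<cdot> (p \<cdot> z)" if "z \<in> Arr C" "Cod C z = Dom C q" for z
  proof -
    have n: "on_arr L p1 \<cdot> \<eta> (Dom C q1) = \<eta> (Cod C p) \<cdot> p1" using \<eta>_natural[OF P(3)] P(6,7) a by simp
    have "on_arr L p1 \<cdot> (\<eta> (Dom C q1) \<cdot> (m \<cdot> z)) = \<eta> (Cod C p) \<cdot> (p1 \<cdot> (m \<cdot> z))"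
      using that e l m P(3,6,7) a by (simp add: n[THEN comp_reassoc])
    also have "\<dots> = \<eta> (Cod C p) \<cdot> (p \<cdot> z)" using that m(1-3) P(3,6) by (simp add: m(4)[THEN comp_reassoc])
    finally show ?thesis .
  qed
  have Lq: "on_arr L q1 \<cdot> (\<eta> (Dom C q1) \<cdot> (m \<cdot> z)) = \<eta> (Cod C q) \<cdot> (q \<cdot> z)" if "z \<in> Arr C" "Cod C z = Dom C q" for z
  proof -
    have n: "on_arr L q1 \<cdot> \<eta> (Dom C q1) = \<eta> (Cod C q) \<cdot> q1" using \<eta>_natural[OF P(4)] P(8) b by simp
    have "on_arr L q1 \<cdot> (\<eta> (Dom C q1) \<cdot> (m \<cdot> z)) = \<eta> (Cod C q) \<cdot> (q1 \<cdot> (m \<cdot> z))"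
      using that e l m P(4,8) b by (simp add: n[THEN comp_reassoc])
    also have "\<dots> = \<eta> (Cod C q) \<cdot> (q \<cdot> z)" using that m(1-3) P(4) by (simp add: m(5)[THEN comp_reassoc])
    finally show ?thesis .
  qed
  have "\<eta> (Dom C q1) \<cdot> (m \<cdot> x) = \<eta> (Dom C q1) \<cdot> (m \<cdot> y)"
    using Lp[OF x] Lp[OF y(1,2)] Lq[OF x] Lq[OF y(1,2)] eq x y e m l
    by - (rule pb_uniq[OF pbL], auto)
  then have "on_arr L m \<cdot> (\<eta> (Dom C q) \<cdot> x) = on_arr L m \<cdot> (\<eta> (Dom C q) \<cdot> y)"
    using Lm x y by simp
  then show ?thesis using x y e l m by - (rule mono_cancel[OF mono], auto)
qed

text \<open>These are the generalized elements of the \<open>k\<close>-closure, stated with all test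
  pairs instead of the one universal pair obtained from the cokernel pair. In this form monotonicity
  and idempotence are immediate.\<close>

definition coarse_closure :: "'a \<Rightarrow> 'a \<Rightarrow> bool" where
  "coarse_closure m x \<longleftrightarrow> (\<forall>u \<in> Arr C. \<forall>v \<in> Arr C. Dom C u = Cod C m \<longrightarrow> Dom C v = Cod C m \<longrightarrow>
     Cod C u = Cod C v \<longrightarrow> Cod C v \<in> X \<longrightarrow> u \<cdot> m = v \<cdot> m \<longrightarrow> u \<cdot> x = v \<cdot> x)"

lemma coarse_closureD:
  assumes "coarse_closure m x" "u \<in> Arr C" "v \<in> Arr C" "Dom C u = Cod C m" "Dom C v = Cod C m"
    "Cod C u = Cod C v" "Cod C v \<in> X" "u \<cdot> m = v \<cdot> m"
  shows "u \<cdot> x = v \<cdot> x"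
  using assms unfolding coarse_closure_def by blast

lemma coarse_closureI:
  assumes "\<And>u v. \<lbrakk>u \<in> Arr C; v \<in> Arr C; Dom C u = Cod C m; Dom C v = Cod C m;
    Cod C u = Cod C v; Cod C v \<in> X; u \<cdot> m = v \<cdot> m\<rbrakk> \<Longrightarrow> u \<cdot> x = v \<cdot> x"
  shows "coarse_closure m x"
  unfolding coarse_closure_def by (intro ballI impI) (rule assms)

lemma coarse_closure_rep:
  assumes m: "mono_arr C m"
  obtains c where "strong_mono C c" "Cod C c = Cod C m"
    "\<forall>x \<in> Arr C. Cod C x = Cod C m \<longrightarrow> (fac C x c \<longleftrightarrow> coarse_closure m x)"
proof -
  have ma: "m \<in> Arr C" using mono_Arr[OF m] .
  obtain i j where po: "is_pushout C i j m m" using pushout_ex[OF ma ma] by auto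
  note P = poD[OF po]
  have d: "Cod C j \<in> Obj C" using P by simp
  note e = \<eta>_arr[OF d]
  let ?i = "\<eta> (Cod C j) \<cdot> i" and ?j = "\<eta> (Cod C j) \<cdot> j"
  have ij: "?i \<in> Arr C" "?j \<in> Arr C" "Dom C ?i = Cod C m" "Dom C ?j = Cod C m"
    "Cod C ?i = on_obj L (Cod C j)" "Cod C ?j = on_obj L (Cod C j)" using P(1-8) e by auto
  obtain c where c: "mono_arr C c" "Cod C c = Dom C ?i" "?i \<cdot> c = ?j \<cdot> c"
    "\<And>x. x \<in> Arr C \<Longrightarrow> Cod C x = Dom C ?i \<Longrightarrow> ?i \<cdot> x = ?j \<cdot> x \<Longrightarrow> fac C x c"
    using equalizer_ex[of ?i ?j] ij by auto
  have ca: "c \<in> Arr C" "Cod C c = Cod C m" using c mono_Arr ij by auto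
  have iff: "fac C x c \<longleftrightarrow> coarse_closure m x" if x: "x \<in> Arr C" "Cod C x = Cod C m" for x
  proof
    assume "fac C x c"
    then obtain y where y: "y \<in> Arr C" "Dom C y = Dom C x" "Cod C y = Dom C c" "c \<cdot> y = x" by (elim facE)
    show "coarse_closure m x"
    proof (rule coarse_closureI)
      fix u v assume u: "u \<in> Arr C" "v \<in> Arr C" "Dom C u = Cod C m" "Dom C v = Cod C m"
        "Cod C u = Cod C v" "Cod C v \<in> X" "u \<cdot> m = v \<cdot> m"
      \<comment> \<open>Any test pair factors through the pushout and, its target lying in
        \<open>X\<close>, through the reflection of the pushout. So \<open>?i\<close> and
        \<open>?j\<close> form the universal test pair.\<close>
      obtain w where w: "w \<in> Arr C" "Cod C w = Cod C v" "Dom C w = Cod C j" "w \<cdot> i = u" "w \<cdot> j = v"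
        using po_lift[OF po u(1,2,5) u(3,4,7)] .
      obtain w' where w': "w' \<in> Arr C" "Dom C w' = on_obj L (Dom C w)" "Cod C w' = Cod C w" "w' \<cdot> \<eta> (Dom C w) = w"
        using extend[OF w(1)] w u by auto
      have n: "w' \<cdot> \<eta> (Cod C j) = w" using w'(4) w(3) by simp
      have "w' \<cdot> ?i = u" "w' \<cdot> ?j = v"
        using w w'(1-3) e P(1-8) by (simp_all add: n[THEN comp_reassoc])
      moreover have "w' \<cdot> (?i \<cdot> c) = w' \<cdot> (?j \<cdot> c)" by (simp only: c(3))
      ultimately have "u \<cdot> c = v \<cdot> c"
        using comp_assoc[of c _ _ ?i _ w'] comp_assoc[of c _ _ ?j _ w'] ca ij w' w(3) by simp
      then show "u \<cdot> x = v \<cdot> x"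
        unfolding y(4)[symmetric] using u(1-5) ca y(1-3) by (simp add: comp_reassoc[where f = u and p = c])
    qed
  next
    assume x': "coarse_closure m x"
    have "?i \<cdot> m = ?j \<cdot> m" using P e by simp
    then have "?i \<cdot> x = ?j \<cdot> x"
      using ij L_obj[OF d] by - (rule coarse_closureD[OF x'], auto)
    then show "fac C x c" using c(4) x ij by simp
  qed
  \<comment> \<open>An equalizer is strong: \<open>?i \<cdot> v\<close> and
    \<open>?j \<cdot> v\<close> agree because they agree after an epimorphism, so \<open>v\<close>
    factors through \<open>c\<close>.\<close>
  have "strong_mono C c"
    unfolding strong_mono_def
  proof (intro conjI allI impI; (elim conjE)?)
    fix \<epsilon> u v assume a: "epi_arr C \<epsilon>" "u \<in> hom C (Dom C \<epsilon>) (Dom C c)" "v \<in> hom C (Cod C \<epsilon>) (Cod C c)"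
      "c \<cdot> u = v \<cdot> \<epsilon>"
    have \<epsilon>a: "\<epsilon> \<in> Arr C" using epi_Arr[OF a(1)] .
    have v: "v \<in> Arr C" "Dom C v = Cod C \<epsilon>" "Cod C v = Cod C c" using a(3) by auto
    have "?i \<cdot> v \<cdot> \<epsilon> = ?i \<cdot> c \<cdot> u"
      using comp_assoc[of \<epsilon> _ _ v _ ?i] comp_assoc[of u _ _ c _ ?i] a ca v \<epsilon>a ij by simp
    also have "\<dots> = ?j \<cdot> c \<cdot> u" by (simp only: c(3))
    also have "\<dots> = ?j \<cdot> v \<cdot> \<epsilon>"
      using comp_assoc[of \<epsilon> _ _ v _ ?j] comp_assoc[of u _ _ c _ ?j] a ca v \<epsilon>a ij by simp
    finally have "?i \<cdot> v = ?j \<cdot> v"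
      using v ca ij \<epsilon>a by - (rule epi_cancel[OF a(1)], auto simp del: arr_simps(9))
    then have "fac C v c" using c(4)[of v] v ca ij by simp
    then obtain d where d: "d \<in> Arr C" "Dom C d = Dom C v" "Cod C d = Dom C c" "c \<cdot> d = v" by (elim facE)
    show "\<exists>!d. d \<in> hom C (Cod C \<epsilon>) (Dom C c) \<and> d \<cdot> \<epsilon> = u \<and> c \<cdot> d = v"
    proof (rule ex1I)
      have "c \<cdot> (d \<cdot> \<epsilon>) = c \<cdot> u" using a(4) d(1-3) ca v \<epsilon>a by (simp add: d(4)[THEN comp_reassoc])
      then have "d \<cdot> \<epsilon> = u" using a(2) d(1-3) v \<epsilon>a by - (rule mono_cancel[OF c(1)], auto)
      then show "d \<in> hom C (Cod C \<epsilon>) (Dom C c) \<and> d \<cdot> \<epsilon> = u \<and> c \<cdot> d = v" using d v by auto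
      fix d' assume "d' \<in> hom C (Cod C \<epsilon>) (Dom C c) \<and> d' \<cdot> \<epsilon> = u \<and> c \<cdot> d' = v"
      then show "d' = d" using d v by - (rule mono_cancel[OF c(1)], auto)
    qed
  qed (use c in simp)
  then show ?thesis using that ca iff by blast
qed

lemma coarse_closure_pullback:
  assumes m: "mono_arr C m" and pb: "is_pullback C n q f m" and y: "y \<in> Arr C" "Cod C y = Dom C f"
  shows "coarse_closure n y \<longleftrightarrow> coarse_closure m (f \<cdot> y)"
proof
  note b = pbD[OF pb]
  assume *: "coarse_closure n y"
  show "coarse_closure m (f \<cdot> y)"
  proof (rule coarse_closureI)
    fix u v assume u: "u \<in> Arr C" "v \<in> Arr C" "Dom C u = Cod C m" "Dom C v = Cod C m"
        "Cod C u = Cod C v" "Cod C v \<in> X" "u \<cdot> m = v \<cdot> m"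
    have "u \<cdot> (f \<cdot> n) = v \<cdot> (f \<cdot> n)"
      unfolding b(9) using u(1-6) b(1-8) by (simp add: u(7)[THEN comp_reassoc])
    then have "u \<cdot> f \<cdot> y = v \<cdot> f \<cdot> y"
      using u(1-6) b(1-8) by - (rule coarse_closureD[OF *], auto)
    then show "u \<cdot> (f \<cdot> y) = v \<cdot> (f \<cdot> y)" using u(1-6) b(1-8) y by simp
  qed
next
  note b = pbD[OF pb]
  assume *: "coarse_closure m (f \<cdot> y)"
  show "coarse_closure n y"
  proof (rule coarse_closureI)
    fix u v assume u: "u \<in> Arr C" "v \<in> Arr C" "Dom C u = Cod C n" "Dom C v = Cod C n"
        "Cod C u = Cod C v" "Cod C v \<in> X" "u \<cdot> n = v \<cdot> n"
    have ma: "m \<in> Arr C" using b by simp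
    obtain i j where po: "is_pushout C i j m m" using pushout_ex[OF ma ma] by auto
    note P = poD[OF po]
    have d: "Cod C j \<in> Obj C" using P by simp
    note e = \<eta>_arr[OF d]
    \<comment> \<open>The codiagonal makes the pushout an object over \<open>Cod m\<close>. Its
      pullback along \<open>f\<close> has vertex \<open>Dom s\<close>, and \<open>x1\<close>,
      \<open>y1\<close> are the pulled-back coprojections.\<close>
    obtain c where c: "c \<in> Arr C" "Cod C c = Cod C m" "Dom C c = Cod C j" "c \<cdot> i = Ident C (Cod C m)"
      "c \<cdot> j = Ident C (Cod C m)"
      using po_lift[OF po, of "Ident C (Cod C m)" "Ident C (Cod C m)"] ma by auto
    obtain r s where pbc: "is_pullback C r s c f" using pb_exists[of c f] c b by auto
    note R = pbD[OF pbc]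
    have cif: "c \<cdot> (i \<cdot> f) = f \<cdot> Ident C (Dom C f)" "c \<cdot> (j \<cdot> f) = f \<cdot> Ident C (Dom C f)"
      using c(1-3) P(1-8) b(1-8) by (simp_all add: c(4,5)[THEN comp_reassoc])
    obtain x1 where x1: "x1 \<in> Arr C" "Dom C x1 = Dom C f" "Cod C x1 = Dom C s" "r \<cdot> x1 = i \<cdot> f" "s \<cdot> x1 = Ident C (Dom C f)"
      using pb_lift[OF pbc, of "i \<cdot> f" "Ident C (Dom C f)"] cif c P(1-8) b(1-8) by auto
    obtain y1 where y1: "y1 \<in> Arr C" "Dom C y1 = Dom C f" "Cod C y1 = Dom C s" "r \<cdot> y1 = j \<cdot> f" "s \<cdot> y1 = Ident C (Dom C f)"
      using pb_lift[OF pbc, of "j \<cdot> f" "Ident C (Dom C f)"] cif c P(1-8) b(1-8) by auto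
    have uf: "Dom C u = Dom C f" "Dom C v = Dom C f" using u b by auto
    have ci: "Dom C c = Cod C i" using c(3) P(6) by simp
    \<comment> \<open>Stability of the pushout glues \<open>u\<close> and \<open>v\<close> to
      \<open>\<phi>\<close>. The target of \<open>\<phi>\<close> lies in \<open>X\<close>, so
      \<open>\<phi>\<close> factors through a unit, and it remains to compare
      \<open>x1 \<cdot> y\<close> with \<open>y1 \<cdot> y\<close> after that unit.\<close>
    obtain \<phi> where \<phi>: "\<phi> \<in> Arr C" "Dom C \<phi> = Dom C s" "Cod C \<phi> = Cod C v" "\<phi> \<cdot> x1 = u" "\<phi> \<cdot> y1 = v"
      using pushout_stable[OF po c(1) ci c(4,5) pb pbc x1 y1 u(1) uf(1) u(2) uf(2) u(5,7)] .
    obtain \<psi> where \<psi>: "\<psi> \<in> Arr C" "Dom C \<psi> = on_obj L (Dom C \<phi>)" "Cod C \<psi> = Cod C \<phi>" "\<psi> \<cdot> \<eta> (Dom C \<phi>) = \<phi>"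
      using extend[OF \<phi>(1)] \<phi> u by auto
    have "\<eta> (Cod C j) \<cdot> i \<cdot> m = \<eta> (Cod C j) \<cdot> j \<cdot> m" using P e by simp
    then have "\<eta> (Cod C j) \<cdot> i \<cdot> (f \<cdot> y) = \<eta> (Cod C j) \<cdot> j \<cdot> (f \<cdot> y)"
      using P(1-8) e L_obj[OF d] by - (rule coarse_closureD[OF *], auto)
    then have \<eta>ij: "\<eta> (Cod C j) \<cdot> (i \<cdot> (f \<cdot> y)) = \<eta> (Cod C j) \<cdot> (j \<cdot> (f \<cdot> y))"
      using P(1-8) e b(1-8) y by simp
    \<comment> \<open>The jointly monic \<open>r\<close> and \<open>s\<close> separate the question:
      the \<open>r\<close>-components agree after the unit by the hypothesis for the universal test
      pair, and the \<open>s\<close>-components are both \<open>y\<close>.\<close>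
    have "\<eta> (Dom C s) \<cdot> (x1 \<cdot> y) = \<eta> (Dom C s) \<cdot> (y1 \<cdot> y)"
    proof (rule \<eta>_jointly_mono[of r s])
      show "r \<in> Arr C" "s \<in> Arr C" "Dom C r = Dom C s" using R by auto
      show "x = x'" if "x \<in> Arr C" "x' \<in> Arr C" "Dom C x = Dom C x'" "Cod C x = Dom C s" "Cod C x' = Dom C s"
        "r \<cdot> x = r \<cdot> x'" "s \<cdot> x = s \<cdot> x'" for x x' by (rule pb_uniq[OF pbc that])
      show "x1 \<cdot> y \<in> Arr C" "y1 \<cdot> y \<in> Arr C" "Dom C (x1 \<cdot> y) = Dom C (y1 \<cdot> y)" "Cod C (x1 \<cdot> y) = Dom C s"
        "Cod C (y1 \<cdot> y) = Dom C s" using x1(1-3) y1(1-3) y by auto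
      have "r \<cdot> (x1 \<cdot> y) = i \<cdot> (f \<cdot> y)" "r \<cdot> (y1 \<cdot> y) = j \<cdot> (f \<cdot> y)"
        using x1(1-3) y1(1-3) R(1-8) y P(1-8) b(1-8)
        by (simp_all add: x1(4)[THEN comp_reassoc] y1(4)[THEN comp_reassoc])
      then show "\<eta> (Cod C r) \<cdot> (r \<cdot> (x1 \<cdot> y)) = \<eta> (Cod C r) \<cdot> (r \<cdot> (y1 \<cdot> y))"
        using \<eta>ij R(7) c(3) by simp
      have "s \<cdot> (x1 \<cdot> y) = y" "s \<cdot> (y1 \<cdot> y) = y"
        using x1(1-3) y1(1-3) R(1-8) y by (simp_all add: x1(5)[THEN comp_reassoc] y1(5)[THEN comp_reassoc])
      then show "\<eta> (Cod C s) \<cdot> (s \<cdot> (x1 \<cdot> y)) = \<eta> (Cod C s) \<cdot> (s \<cdot> (y1 \<cdot> y))" by simp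
    qed
    moreover have "\<phi> \<cdot> (z \<cdot> y) = \<psi> \<cdot> (\<eta> (Dom C s) \<cdot> (z \<cdot> y))" if "z \<in> Arr C" "Dom C z = Dom C f" "Cod C z = Dom C s" for z
      using \<psi> \<phi>(1-3) \<eta>_arr[of "Dom C s"] R that y by (simp add: comp_reassoc[OF \<psi>(4)[unfolded \<phi>(2)]])
    ultimately have "\<phi> \<cdot> (x1 \<cdot> y) = \<phi> \<cdot> (y1 \<cdot> y)" using x1(1-3) y1(1-3) by simp
    then show "u \<cdot> y = v \<cdot> y"
      using \<phi>(1-3) x1(1-3) y1(1-3) y by (simp add: \<phi>(4,5)[THEN comp_reassoc])
  qed
qed

lemma coarse_operator_ex:
  obtains k where "universal_closure C k" "strict_closure C k"
    "\<And>m. dense_mono C k m \<longleftrightarrow> mono_arr C m \<and> (\<forall>Y \<in> X. cancels C m Y)"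
proof -
  obtain k where k: "universal_closure C k" and kc: "\<And>m c. \<lbrakk>mono_arr C m; mono_arr C c; Cod C c = Cod C m\<rbrakk> \<Longrightarrow>
      k (subobj_of C m) = subobj_of C c \<longleftrightarrow> (\<forall>x \<in> Arr C. Cod C x = Cod C m \<longrightarrow> (fac C x c \<longleftrightarrow> coarse_closure m x))"
  proof (rule universal_closure_ex[of coarse_closure])
    fix m assume m: "mono_arr C m"
    show "\<exists>c. mono_arr C c \<and> Cod C c = Cod C m \<and> (\<forall>x \<in> Arr C. Cod C x = Cod C m \<longrightarrow> (fac C x c \<longleftrightarrow> coarse_closure m x))"
      using coarse_closure_rep[OF m] unfolding strong_mono_def by metis
    show "coarse_closure m m" by (rule coarse_closureI)
  next
    fix m n x assume m: "mono_arr C m" "mono_arr C n" "fac C m n" "coarse_closure m x"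
    obtain w where w: "w \<in> Arr C" "Cod C w = Dom C n" "n \<cdot> w = m" using m(3) by (auto elim: facE)
    have n: "n \<in> Arr C" using mono_Arr[OF m(2)] .
    show "coarse_closure n x"
    proof (rule coarse_closureI)
      fix u v assume u: "u \<in> Arr C" "v \<in> Arr C" "Dom C u = Cod C n" "Dom C v = Cod C n"
        "Cod C u = Cod C v" "Cod C v \<in> X" "u \<cdot> n = v \<cdot> n"
      have "u \<cdot> m = v \<cdot> m"
        unfolding w(3)[symmetric] using u(1-6) w(1,2) n by (simp add: u(7)[THEN comp_reassoc])
      moreover have "Cod C m = Cod C n" using w n by auto
      ultimately show "u \<cdot> x = v \<cdot> x" using u by - (rule coarse_closureD[OF m(4)], auto)
    qed
  next
    fix m c x assume m: "mono_arr C m" "mono_arr C c" "Cod C c = Cod C m"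
      "\<forall>x \<in> Arr C. Cod C x = Cod C m \<longrightarrow> (fac C x c \<longleftrightarrow> coarse_closure m x)" "coarse_closure c x"
    have c: "coarse_closure m c" using m mono_Arr[OF m(2)] fac_refl by blast
    show "coarse_closure m x"
    proof (rule coarse_closureI)
      fix u v assume u: "u \<in> Arr C" "v \<in> Arr C" "Dom C u = Cod C m" "Dom C v = Cod C m"
        "Cod C u = Cod C v" "Cod C v \<in> X" "u \<cdot> m = v \<cdot> m"
      have "u \<cdot> c = v \<cdot> c" by (rule coarse_closureD[OF c u])
      then show "u \<cdot> x = v \<cdot> x" using u m(3) by - (rule coarse_closureD[OF m(5)], auto)
    qed
  next
    fix m n q f y assume "mono_arr C m" "is_pullback C n q f m" "y \<in> Arr C" "Cod C y = Dom C f"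
    then show "coarse_closure n y \<longleftrightarrow> coarse_closure m (f \<cdot> y)" by (rule coarse_closure_pullback)
  qed blast
  have "strict_closure C k"
    unfolding strict_closure_def
  proof (intro ballI)
    fix A x assume "x \<in> Sub C A"
    then obtain m where m: "mono_arr C m" "x = subobj_of C m" by (auto simp: Sub_def)
    obtain c where c: "strong_mono C c" "Cod C c = Cod C m"
      "\<forall>x \<in> Arr C. Cod C x = Cod C m \<longrightarrow> (fac C x c \<longleftrightarrow> coarse_closure m x)"
      using coarse_closure_rep[OF m(1)] .
    have cm: "mono_arr C c" using c(1) by (simp add: strong_mono_def)
    then have "k x = subobj_of C c" using kc[OF m(1) cm c(2)] c(3) m(2) by blast
    moreover have "c \<in> subobj_of C c" using cm by (simp add: subobj_of_iff fac_refl mono_Arr)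
    ultimately show "strong_subobj C (k x)" using c(1) unfolding strong_subobj_def by blast
  qed
  moreover have "dense_mono C k m \<longleftrightarrow> mono_arr C m \<and> (\<forall>Y \<in> X. cancels C m Y)" for m
  proof (cases "mono_arr C m")
    case True
    have ma: "m \<in> Arr C" using mono_Arr[OF True] .
    let ?I = "Ident C (Cod C m)"
    have I: "mono_arr C ?I" "Cod C ?I = Cod C m" using ma by (auto simp: mono_Ident)
    have "fac C x ?I" if "x \<in> Arr C" "Cod C x = Cod C m" for x
      using that ma by (intro facI[of x]) auto
    then have "dense_mono C k m \<longleftrightarrow> (\<forall>x \<in> Arr C. Cod C x = Cod C m \<longrightarrow> coarse_closure m x)"
      unfolding dense_mono_def using kc[OF True I] True by auto
    also have "\<dots> \<longleftrightarrow> (\<forall>Y \<in> X. cancels C m Y)"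
    proof
      assume "\<forall>x \<in> Arr C. Cod C x = Cod C m \<longrightarrow> coarse_closure m x"
      then have c: "coarse_closure m ?I" using ma by simp
      show "\<forall>Y \<in> X. cancels C m Y"
      proof (intro ballI cancelsI)
        fix Y u v assume Y: "Y \<in> X" "u \<in> Arr C" "Dom C u = Cod C m" "Cod C u = Y" "v \<in> Arr C"
          "Dom C v = Cod C m" "Cod C v = Y" "u \<cdot> m = v \<cdot> m"
        have "u \<cdot> ?I = v \<cdot> ?I" using Y by - (rule coarse_closureD[OF c], auto)
        then show "u = v" using Y by simp
      qed
    next
      assume *: "\<forall>Y \<in> X. cancels C m Y"
      show "\<forall>x \<in> Arr C. Cod C x = Cod C m \<longrightarrow> coarse_closure m x"
      proof (intro ballI impI coarse_closureI)
        fix x u v assume u: "u \<in> Arr C" "v \<in> Arr C" "Dom C u = Cod C m" "Dom C v = Cod C m"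
          "Cod C u = Cod C v" "Cod C v \<in> X" "u \<cdot> m = v \<cdot> m"
        have "cancels C m (Cod C v)" using * u by blast
        then have "u = v" using u by - (rule cancelsD, auto)
        then show "u \<cdot> x = v \<cdot> x" by simp
      qed
    qed
    finally show ?thesis using True by simp
  qed (simp add: dense_mono_def)
  ultimately show ?thesis using that k by blast
qed

section \<open>Separated objects via the unit, and the construction of \<open>h\<close>\<close>

lemma L_\<eta>:
  assumes A: "A \<in> Obj C" shows "on_arr L (\<eta> A) = \<eta> (on_obj L A)"
proof -
  note e = \<eta>_arr[OF A] and e' = \<eta>_arr[OF L_obj_Obj[OF A]]
  show ?thesis
    using L_arr[OF e(1)] e e' \<eta>_natural[OF e(1)] L_obj[OF L_obj_Obj[OF A]]
    by - (rule L_orth_ext[OF A L_obj[OF L_obj_Obj[OF A]]], auto)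
qed

text \<open>Let \<open>p\<close>, \<open>q\<close> be the kernel pair of the unit and
  \<open>\<delta>\<close> its diagonal. \<open>L\<close> preserves this pullback and inverts the
  unit, so \<open>L p\<close> and \<open>L q\<close> coincide with inverse
  \<open>L \<delta>\<close>. Hence objects of \<open>X\<close> cancel \<open>\<delta>\<close>, so it
  is \<open>k\<close>-dense, and a separated object forces \<open>p = q\<close>. Conversely, a monic
  unit embeds the object in one of \<open>X\<close>, where dense monomorphisms cancel.\<close>

lemma separated_iff_mono_\<eta>:
  assumes dense: "\<And>m. dense_mono C k m \<longleftrightarrow> mono_arr C m \<and> (\<forall>Y \<in> X. cancels C m Y)"
    and A: "A \<in> Obj C"
  shows "separated C k A \<longleftrightarrow> mono_arr C (\<eta> A)"
proof
  note e = \<eta>_arr[OF A]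
  have LA: "on_obj L A \<in> X" using L_obj[OF A] .
  assume mono: "mono_arr C (\<eta> A)"
  show "separated C k A"
    unfolding separated_iff
  proof (intro allI impI cancelsI)
    fix m u v assume m: "dense_mono C k m" and u: "u \<in> Arr C" "Dom C u = Cod C m" "Cod C u = A"
      "v \<in> Arr C" "Dom C v = Cod C m" "Cod C v = A" "u \<cdot> m = v \<cdot> m"
    have ma: "m \<in> Arr C" using dense_Arr[OF m] .
    have "cancels C m (on_obj L A)" using dense m LA by blast
    then have "\<eta> A \<cdot> u = \<eta> A \<cdot> v"
      using u e ma by - (rule cancelsD[of C m], auto)
    then show "u = v" using u e by - (rule mono_cancel[OF mono], auto)
  qed
next
  note e = \<eta>_arr[OF A]
  assume sep: "separated C k A"
  obtain p q where pb: "is_pullback C p q (\<eta> A) (\<eta> A)" using pb_exists[OF e(1) e(1)] by blast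
  note P = pbD[OF pb]
  obtain \<delta> where \<delta>: "\<delta> \<in> Arr C" "Dom C \<delta> = A" "Cod C \<delta> = Dom C q" "p \<cdot> \<delta> = Ident C A" "q \<cdot> \<delta> = Ident C A"
    using pb_lift[OF pb, of "Ident C A" "Ident C A"] A e by auto
  have m\<delta>: "mono_arr C \<delta>" using \<delta> P e by - (rule mono_split[of \<delta> p], auto)
  have Lpb: "is_pullback C (on_arr L p) (on_arr L q) (on_arr L (\<eta> A)) (on_arr L (\<eta> A))"
    using L_pullback[OF pb] e L_obj[OF A] by simp
  have K: "Dom C q \<in> Obj C" using P by simp
  note eK = \<eta>_arr[OF K] and lp = L_arr[OF P(3)] and lq = L_arr[OF P(4)] and l\<delta> = L_arr[OF \<delta>(1)]
  have "mono_arr C (on_arr L (\<eta> A))"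
    unfolding L_\<eta>[OF A] using \<eta>_iso[OF L_obj[OF A]]
    by (elim isoE) (auto intro: mono_split)
  then have pq: "on_arr L p = on_arr L q"
    using pbD[OF Lpb] by - (rule mono_cancel, auto)
  have n\<delta>: "on_arr L \<delta> \<cdot> \<eta> A = \<eta> (Dom C q) \<cdot> \<delta>" using \<eta>_natural[OF \<delta>(1)] \<delta> by simp
  have np: "on_arr L p \<cdot> \<eta> (Dom C q) = \<eta> A \<cdot> p" using \<eta>_natural[OF P(3)] P e by simp
  have "on_arr L p \<cdot> on_arr L \<delta> \<cdot> \<eta> A = on_arr L p \<cdot> (\<eta> (Dom C q) \<cdot> \<delta>)"
    using n\<delta> lp l\<delta> e \<delta> P(6) by simp
  also have "\<dots> = \<eta> A \<cdot> (p \<cdot> \<delta>)" using eK lp P(3,6,7) e \<delta>(1-3) by (simp add: np[THEN comp_reassoc])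
  finally have *: "on_arr L p \<cdot> on_arr L \<delta> \<cdot> \<eta> A = Ident C (on_obj L A) \<cdot> \<eta> A" using \<delta>(4) e by simp
  have p\<delta>: "on_arr L p \<cdot> on_arr L \<delta> = Ident C (on_obj L A)"
    using lp l\<delta> \<delta> P(6,7) e L_obj_Obj[OF A] by - (rule L_orth_ext[OF A L_obj[OF A] _ _ _ _ _ _ *], auto)
  have t: "on_arr L \<delta> \<cdot> on_arr L p \<in> Arr C" "Dom C (on_arr L \<delta> \<cdot> on_arr L p) = on_obj L (Dom C q)"
    "Cod C (on_arr L \<delta> \<cdot> on_arr L p) = on_obj L (Dom C q)"
    using lp l\<delta> \<delta> P(6,7) e by auto
  have "on_arr L p \<cdot> (on_arr L \<delta> \<cdot> on_arr L p) = on_arr L p"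
    using lp l\<delta> \<delta> P(6,7) e by (simp add: p\<delta>[THEN comp_reassoc])
  then have \<delta>p: "on_arr L \<delta> \<cdot> on_arr L p = Ident C (on_obj L (Dom C q))"
    using t pq lp P(6) L_obj_Obj[OF K] by - (rule pb_uniq[OF Lpb], auto)
  have "cancels C \<delta> Y" if Y: "Y \<in> X" for Y
  proof (rule cancelsI)
    fix u v assume u: "u \<in> Arr C" "Dom C u = Cod C \<delta>" "Cod C u = Y" and v: "v \<in> Arr C" "Dom C v = Cod C \<delta>" "Cod C v = Y"
      and uv: "u \<cdot> \<delta> = v \<cdot> \<delta>"
    obtain u' where u': "u' \<in> Arr C" "Dom C u' = on_obj L (Dom C u)" "Cod C u' = Cod C u" "u' \<cdot> \<eta> (Dom C u) = u"
      using extend[OF u(1)] u Y by auto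
    obtain v' where v': "v' \<in> Arr C" "Dom C v' = on_obj L (Dom C v)" "Cod C v' = Cod C v" "v' \<cdot> \<eta> (Dom C v) = v"
      using extend[OF v(1)] v Y by auto
    have d: "Dom C u = Dom C q" "Dom C v = Dom C q" using u v \<delta> by auto
    have w: "w' \<cdot> on_arr L \<delta> \<cdot> \<eta> A = w \<cdot> \<delta>"
      if "w' \<in> Arr C" "Dom C w' = on_obj L (Dom C q)" "w' \<cdot> \<eta> (Dom C q) = w" for w w'
      using that(1,2) n\<delta> l\<delta> e eK \<delta>(1-3) by (simp add: that(3)[THEN comp_reassoc])
    have "u' \<cdot> on_arr L \<delta> \<cdot> \<eta> A = v' \<cdot> on_arr L \<delta> \<cdot> \<eta> A"
      using w[of u' u] w[of v' v] u' v' d uv by simp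
    then have eq: "u' \<cdot> on_arr L \<delta> = v' \<cdot> on_arr L \<delta>"
      using u' v' d l\<delta> \<delta> u v Y by - (rule L_orth_ext[OF A Y], auto)
    have "u' \<cdot> (on_arr L \<delta> \<cdot> on_arr L p) = v' \<cdot> (on_arr L \<delta> \<cdot> on_arr L p)"
      using eq[THEN comp_reassoc] u'(1-3) v'(1-3) d l\<delta> lp \<delta> P(6,7) e by simp
    then have "u' = v'" using \<delta>p u'(1-3) v'(1-3) d by simp
    then show "u = v" using u' v' d by simp
  qed
  then have "dense_mono C k \<delta>" using dense m\<delta> by blast
  then have "cancels C \<delta> A" using sep unfolding separated_iff by blast
  then have pq': "p = q" using P e \<delta> by - (rule cancelsD, auto)
  show "mono_arr C (\<eta> A)"
  proof (rule monoI)
    fix f g assume f: "f \<in> Arr C" "g \<in> Arr C" "Dom C f = Dom C g" "Cod C f = Dom C (\<eta> A)" "Cod C g = Dom C (\<eta> A)"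
      "\<eta> A \<cdot> f = \<eta> A \<cdot> g"
    obtain w where "p \<cdot> w = f" "q \<cdot> w = g" using pb_lift[OF pb f] by blast
    then show "f = g" using pq' by simp
  qed (use e in simp)
qed

lemma closure_pair_ex:
  obtains h k where "closure_pair C (h, k)" "Sh (Sep C k) h = full_sub C X"
proof -
  obtain k where k: "universal_closure C k" "strict_closure C k"
    and k_dense: "\<And>m. dense_mono C k m \<longleftrightarrow> mono_arr C m \<and> (\<forall>Y \<in> X. cancels C m Y)"
    using coarse_operator_ex by blast
  interpret strict_closure_quasitopos C k by unfold_locales (use k in auto)
  let ?Spt = "{A \<in> Obj C. separated C k A}"
  interpret sep: pullback_closed C ?Spt
    by unfold_locales (auto intro: separated_pullback dest: pbD)
  let ?S = "full_sub C ?Spt"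
  interpret S: pullback_category ?S by (rule sep.pullback_category_D)
  have Sep: "Sep C k = ?S" by (simp add: Sep_def)
  have \<eta>_mono: "mono_arr C (\<eta> A)" if "A \<in> ?Spt" for A
    using that separated_iff_mono_\<eta>[OF k_dense, of A] by blast
  \<comment> \<open>Membership in the pullback of \<open>L m\<close> along the unit of the
    codomain.\<close>
  define F where "F m x \<longleftrightarrow> fac C (\<eta> (Cod C m) \<cdot> x) (on_arr L m)" for m x
  have fac_mono: "fac C (m \<cdot> a) (m \<cdot> b) \<longleftrightarrow> fac C a b"
    if "mono_arr C m" "a \<in> Arr C" "b \<in> Arr C" "Cod C a = Dom C m" "Cod C b = Dom C m" for m a b
  proof
    have m: "m \<in> Arr C" using mono_Arr[OF that(1)] .
    assume "fac C (m \<cdot> a) (m \<cdot> b)"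
    then obtain u where u: "u \<in> Arr C" "Dom C u = Dom C (m \<cdot> a)" "Cod C u = Dom C (m \<cdot> b)" "m \<cdot> b \<cdot> u = m \<cdot> a"
      by (elim facE)
    then have "b \<cdot> u = a" using that m by - (rule mono_cancel[OF that(1)], auto)
    then show "fac C a b" using u that m by (intro facI[of u]) auto
  next
    have m: "m \<in> Arr C" using mono_Arr[OF that(1)] .
    assume "fac C a b"
    then obtain u where "u \<in> Arr C" "Dom C u = Dom C a" "Cod C u = Dom C b" "b \<cdot> u = a" by (elim facE)
    then show "fac C (m \<cdot> a) (m \<cdot> b)" using that m by (intro facI[of u]) auto
  qed
  have monoS: "mono_arr C m" "m \<in> Arr C" "Dom C m \<in> ?Spt" "Cod C m \<in> ?Spt" if "mono_arr ?S m" for m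
    using that unfolding sep.mono_D_iff by simp_all
  obtain h where h: "universal_closure ?S h" and hc: "\<And>m c. \<lbrakk>mono_arr ?S m; mono_arr ?S c; Cod ?S c = Cod ?S m\<rbrakk> \<Longrightarrow>
      h (subobj_of ?S m) = subobj_of ?S c \<longleftrightarrow> (\<forall>x \<in> Arr ?S. Cod ?S x = Cod ?S m \<longrightarrow> (fac ?S x c \<longleftrightarrow> F m x))"
  proof (rule S.universal_closure_ex[of F])
    fix m assume m: "mono_arr ?S m"
    note a = monoS[OF m]
    have A: "Cod C m \<in> Obj C" using a by simp
    note e = \<eta>_arr[OF A] and l = L_arr[OF a(2)]
    obtain c q where pb: "is_pullback C c q (\<eta> (Cod C m)) (on_arr L m)"
      using pb_exists[of "\<eta> (Cod C m)" "on_arr L m"] e l by auto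
    note P = pbD[OF pb]
    have c: "mono_arr C c" by (rule mono_pullback[OF pb L_mono[OF a(1)]])
    have cS: "mono_arr ?S c"
      using separated_mono[OF c] c P e a unfolding sep.mono_D_iff by simp
    have "fac ?S x c \<longleftrightarrow> F m x" if x: "x \<in> Arr ?S" "Cod ?S x = Cod ?S m" for x
    proof -
      have "fac ?S x c \<longleftrightarrow> fac C x c" by (rule fac_full_sub[OF x(1) mono_Arr[OF cS]])
      then show ?thesis using pb_fac[OF pb, of x] x e unfolding F_def by simp
    qed
    moreover have "Cod ?S c = Cod ?S m" using P e by simp
    ultimately show "\<exists>c. mono_arr ?S c \<and> Cod ?S c = Cod ?S m \<and>
        (\<forall>x \<in> Arr ?S. Cod ?S x = Cod ?S m \<longrightarrow> (fac ?S x c \<longleftrightarrow> F m x))"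
      using cS by blast
    show "F m m"
      unfolding F_def using \<eta>_natural[OF a(2)] l \<eta>_arr[OF dom_obj[OF a(2)]] e a(2)
      by (intro facI[of "\<eta> (Dom C m)"]) auto
  next
    fix m n x assume mn: "mono_arr ?S m" "mono_arr ?S n" "fac ?S m n" "F m x"
      and x: "x \<in> Arr ?S" "Cod ?S x = Cod ?S m"
    note a = monoS[OF mn(1)] and b = monoS[OF mn(2)]
    obtain u where u: "u \<in> Arr C" "Dom C u = Dom C m" "Cod C u = Dom C n" "n \<cdot> u = m"
      using mn(3) by (auto simp: fac_def)
    have "on_arr L n \<cdot> on_arr L u = on_arr L m" using L_comp[OF u(1) b(2) u(3)] u(4) by simp
    then have "fac C (on_arr L m) (on_arr L n)"
      using L_arr[OF u(1)] L_arr[OF a(2)] L_arr[OF b(2)] u by (intro facI[of "on_arr L u"]) auto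
    moreover have "Cod C m = Cod C n" using u b by auto
    ultimately show "F n x"
      using mn(4) fac_trans L_arr(1)[OF a(2)] L_arr(1)[OF b(2)] unfolding F_def by metis
  next
    fix m c x assume mc: "mono_arr ?S m" "mono_arr ?S c" "Cod ?S c = Cod ?S m"
      "\<forall>x \<in> Arr ?S. Cod ?S x = Cod ?S m \<longrightarrow> (fac ?S x c \<longleftrightarrow> F m x)" "F c x"
      and x: "x \<in> Arr ?S" "Cod ?S x = Cod ?S m"
    note a = monoS[OF mc(1)] and b = monoS[OF mc(2)]
    have cm: "Cod C c = Cod C m" using mc(3) by simp
    have A: "Cod C m \<in> Obj C" using a by simp
    have B: "Dom C c \<in> Obj C" "Dom C m \<in> Obj C" using b a by auto
    note e = \<eta>_arr[OF A] and l = L_arr[OF a(2)] and lc = L_arr[OF b(2)] and eB = \<eta>_arr[OF B(1)]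
    \<comment> \<open>Idempotence: the closure \<open>c\<close> satisfies \<open>F m c\<close> by
      definition. Extending the resulting factor \<open>t\<close> along the unit gives
      \<open>t'\<close> with \<open>L m \<cdot> t' = L c\<close>, so \<open>L c\<close> is contained
      in \<open>L m\<close>.\<close>
    have "F m c" using mc(3,4) mono_Arr[OF mc(2)] S.fac_refl[of c] by blast
    then obtain t where t: "t \<in> Arr C" "Dom C t = Dom C c" "Cod C t = on_obj L (Dom C m)"
      "on_arr L m \<cdot> t = \<eta> (Cod C m) \<cdot> c"
      unfolding F_def using l e b cm by (elim facE) auto
    obtain t' where t': "t' \<in> Arr C" "Dom C t' = on_obj L (Dom C t)" "Cod C t' = Cod C t" "t' \<cdot> \<eta> (Dom C t) = t"
      using extend[OF t(1)] t L_obj[OF B(2)] by auto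
    have "on_arr L m \<cdot> t' \<cdot> \<eta> (Dom C c) = on_arr L m \<cdot> t" using t t' l eB by simp
    also have "\<dots> = on_arr L c \<cdot> \<eta> (Dom C c)" using t(4) \<eta>_natural[OF b(2)] cm by simp
    finally have *: "on_arr L m \<cdot> t' \<cdot> \<eta> (Dom C c) = on_arr L c \<cdot> \<eta> (Dom C c)" .
    have "on_arr L m \<cdot> t' = on_arr L c"
      using t t' l lc cm by - (rule L_orth_ext[OF B(1) L_obj[OF A] _ _ _ _ _ _ *], auto)
    then have "fac C (on_arr L c) (on_arr L m)"
      using t t' l lc by (intro facI[of t']) auto
    then show "F m x" using mc(5) fac_trans l(1) lc(1) cm unfolding F_def by metis
  next
    fix m n q f y assume mn: "mono_arr ?S m" "mono_arr ?S n" "is_pullback ?S n q f m"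
      and y: "y \<in> Arr ?S" "Cod ?S y = Dom ?S f"
    note a = monoS[OF mn(1)] and b = monoS[OF mn(2)]
    have pb: "is_pullback C n q f m" using mn(3) unfolding sep.pullback_D_iff by blast
    note P = pbD[OF pb]
    have A: "Cod C m \<in> Obj C" "Dom C f \<in> Obj C" using a P by auto
    note e = \<eta>_arr[OF A(1)] and ef = \<eta>_arr[OF A(2)]
    \<comment> \<open>Stable units concern only pullbacks over objects of \<open>X\<close>.
      Composing the cospan with the monic unit of \<open>Cod m\<close> moves the square over such an
      object without changing it; the image of that unit under \<open>L\<close> is again monic and
      is cancelled afterwards.\<close>
    have pb': "is_pullback C n q (\<eta> (Cod C m) \<cdot> f) (\<eta> (Cod C m) \<cdot> m)"
      using pb_mono_post[OF pb \<eta>_mono[OF a(4)]] e by simp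
    have pbL: "is_pullback C (on_arr L n) (on_arr L q) (on_arr L (\<eta> (Cod C m) \<cdot> f)) (on_arr L (\<eta> (Cod C m) \<cdot> m))"
      using L_pullback[OF pb'] e a L_obj[OF A(1)] by simp
    note lf = L_arr[OF P(1)] and lm = L_arr[OF a(2)] and ln = L_arr[OF P(3)] and le = L_arr[OF e(1)]
    have comp: "on_arr L (\<eta> (Cod C m) \<cdot> f) = on_arr L (\<eta> (Cod C m)) \<cdot> on_arr L f"
      "on_arr L (\<eta> (Cod C m) \<cdot> m) = on_arr L (\<eta> (Cod C m)) \<cdot> on_arr L m"
      using L_comp[OF P(1) e(1)] L_comp[OF a(2) e(1)] e P(5) by auto
    have mono: "mono_arr C (on_arr L (\<eta> (Cod C m)))" by (rule L_mono[OF \<eta>_mono[OF a(4)]])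
    have ya: "y \<in> Arr C" "Cod C y = Dom C f" using y by auto
    have "F n y \<longleftrightarrow> fac C (\<eta> (Dom C f) \<cdot> y) (on_arr L n)" unfolding F_def using P(7) by simp
    also have "\<dots> \<longleftrightarrow> fac C (on_arr L (\<eta> (Cod C m)) \<cdot> on_arr L f \<cdot> (\<eta> (Dom C f) \<cdot> y))
        (on_arr L (\<eta> (Cod C m)) \<cdot> on_arr L m)"
      using pb_fac[OF pbL, of "\<eta> (Dom C f) \<cdot> y"] comp ya ef lf le e P(5) by simp
    also have "\<dots> \<longleftrightarrow> fac C (on_arr L (\<eta> (Cod C m)) \<cdot> (on_arr L f \<cdot> (\<eta> (Dom C f) \<cdot> y)))
        (on_arr L (\<eta> (Cod C m)) \<cdot> on_arr L m)"
      using ya ef lf le e P(5) by simp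
    also have "\<dots> \<longleftrightarrow> fac C (on_arr L f \<cdot> (\<eta> (Dom C f) \<cdot> y)) (on_arr L m)"
      using ya ef lf lm le e P(5) by (intro fac_mono[OF mono]) auto
    also have "on_arr L f \<cdot> (\<eta> (Dom C f) \<cdot> y) = \<eta> (Cod C m) \<cdot> (f \<cdot> y)"
      using \<eta>_natural[OF P(1), THEN comp_reassoc, of y] ya ef lf e P(1,5) by simp
    finally show "F n y \<longleftrightarrow> F m (f \<cdot>\<^bsub>?S\<^esub> y)" unfolding F_def by simp
  qed blast
  interpret h: closure_category ?S h by unfold_locales (rule h)
  have h_dense: "dense_mono ?S h m \<longleftrightarrow> mono_arr ?S m \<and> fac C (\<eta> (Cod C m)) (on_arr L m)" for m
  proof (cases "mono_arr ?S m")
    case True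
    note a = monoS[OF True]
    have A: "Cod C m \<in> Obj C" using a by simp
    note e = \<eta>_arr[OF A] and l = L_arr[OF a(2)]
    let ?I = "Ident ?S (Cod ?S m)"
    have I: "mono_arr ?S ?I" "Cod ?S ?I = Cod ?S m" "?I \<in> Arr ?S" using S.mono_Ident[of "Cod C m"] a A by auto
    have "fac ?S x ?I" if "x \<in> Arr ?S" "Cod ?S x = Cod ?S m" for x
      using that A a by (intro facI[of x]) auto
    then have "dense_mono ?S h m \<longleftrightarrow> (\<forall>x \<in> Arr ?S. Cod ?S x = Cod ?S m \<longrightarrow> F m x)"
      unfolding dense_mono_def using hc[OF True I(1,2)] True by auto
    also have "\<dots> \<longleftrightarrow> fac C (\<eta> (Cod C m)) (on_arr L m)"
    proof
      assume "\<forall>x \<in> Arr ?S. Cod ?S x = Cod ?S m \<longrightarrow> F m x"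
      then have "F m ?I" using I by blast
      then show "fac C (\<eta> (Cod C m)) (on_arr L m)" unfolding F_def using e by simp
    next
      assume f: "fac C (\<eta> (Cod C m)) (on_arr L m)"
      show "\<forall>x \<in> Arr ?S. Cod ?S x = Cod ?S m \<longrightarrow> F m x"
        unfolding F_def using fac_comp_right[OF f e(1) l(1)] e by simp
    qed
    finally show ?thesis using True by simp
  qed (simp add: dense_mono_def)
  \<comment> \<open>A factorization of the unit through \<open>L m\<close> extends to a section of
    \<open>L m\<close>, which is monic and hence invertible. Two-out-of-three in the naturality
    square of the unit then yields orthogonality of \<open>m\<close>.\<close>
  have h_orth: "orth C m Y" if d: "dense_mono ?S h m" and Y: "Y \<in> X" for m Y
  proof -
    have m: "mono_arr ?S m" "fac C (\<eta> (Cod C m)) (on_arr L m)" using d h_dense by auto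
    note a = monoS[OF m(1)]
    have A: "Cod C m \<in> Obj C" "Dom C m \<in> Obj C" using a by auto
    note e = \<eta>_arr[OF A(1)] and ed = \<eta>_arr[OF A(2)] and l = L_arr[OF a(2)]
    obtain t where t: "t \<in> Arr C" "Dom C t = Cod C m" "Cod C t = on_obj L (Dom C m)"
      "on_arr L m \<cdot> t = \<eta> (Cod C m)"
      using m(2) e l by (elim facE) auto
    obtain t' where t': "t' \<in> Arr C" "Dom C t' = on_obj L (Dom C t)" "Cod C t' = Cod C t" "t' \<cdot> \<eta> (Dom C t) = t"
      using extend[OF t(1)] t L_obj[OF A(2)] by auto
    have "on_arr L m \<cdot> t' = Ident C (on_obj L (Cod C m))"
      using t t' l e L_obj_Obj[OF A(1)] by - (rule L_orth_ext[OF A(1) L_obj[OF A(1)]], auto)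
    then have "iso_arr C (on_arr L m)"
      using t t' l by (intro iso_mono_retract[OF L_mono[OF a(1)], of t']) auto
    then have "orth C (on_arr L m \<cdot> \<eta> (Dom C m)) Y"
      using l ed by (intro orth_comp \<eta>_orth[OF A(2) Y] orth_iso) auto
    then have "orth C (\<eta> (Cod C m) \<cdot> m) Y" using \<eta>_natural[OF a(2)] by simp
    then show ?thesis using \<eta>_orth[OF A(1) Y] a(2) e by - (rule orth_left_factor[of "\<eta> (Cod C m)"], simp_all)
  qed
  have h_k: "dense_mono C k m" if "dense_mono ?S h m" for m
    using that h_orth[OF that] h_dense monoS[of m] orth_imp_cancels k_dense by auto
  have "proper_closure ?S h"
    unfolding proper_closure_def
  proof (intro ballI impI)
    fix A x assume x: "x \<in> Sub ?S A" "strong_subobj ?S x"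
    obtain m0 where m0: "mono_arr ?S m0" "x = subobj_of ?S m0" using x by (auto simp: Sub_def)
    obtain m where m: "m \<in> x" "strong_mono ?S m" using x by (auto simp: strong_subobj_def)
    have mS: "mono_arr ?S m" using m by (simp add: strong_mono_def)
    have xm: "x = subobj_of ?S m"
      using m(1) m0 mS S.subobj_of_iff[OF m0(1), of m] S.subobj_of_eq_iff[OF m0(1) mS] by simp
    obtain c d where c: "closed_mono ?S h c" "dense_mono ?S h d" "Cod ?S d = Dom ?S c" "Dom ?S d = Dom ?S m"
      "Cod ?S c = Cod ?S m" "c \<cdot>\<^bsub>?S\<^esub> d = m" "h (subobj_of ?S m) = subobj_of ?S c"
      using h.factorization[OF mS] .
    have dS: "d \<in> Arr ?S" "c \<in> Arr ?S" "mono_arr ?S c"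
      by (rule S.dense_Arr[OF c(2)], rule h.closed_mono_Arr[OF c(1)], rule h.closed_monoD[OF c(1)])
    \<comment> \<open>A \<open>k\<close>-dense monomorphism cancels into separated objects, so
      \<open>d\<close> is epi among them. The strong \<open>m\<close> therefore fills the square
      \<open>m \<cdot> 1 = c \<cdot> d\<close>, and its closure \<open>c\<close> is contained in
      \<open>m\<close>.\<close>
    have "epi_arr ?S d"
    proof (rule epiI[OF dS(1)])
      fix u v assume u: "u \<in> Arr ?S" "v \<in> Arr ?S" "Cod ?S u = Cod ?S v" "Dom ?S u = Cod ?S d"
        "Dom ?S v = Cod ?S d" "u \<cdot>\<^bsub>?S\<^esub> d = v \<cdot>\<^bsub>?S\<^esub> d"
      have "separated C k (Cod C v)" using u by simp
      then have "cancels C d (Cod C v)" using h_k[OF c(2)] unfolding separated_iff by blast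
      then show "u = v" using u by - (rule cancelsD, auto)
    qed
    moreover have "Ident C (Dom C m) \<in> hom ?S (Dom ?S d) (Dom ?S m)" "c \<in> hom ?S (Cod ?S d) (Cod ?S m)"
      "m \<cdot>\<^bsub>?S\<^esub> Ident C (Dom C m) = c \<cdot>\<^bsub>?S\<^esub> d"
      using c(3-6) dS monoS[OF mS] by auto
    ultimately have "\<exists>!w. w \<in> hom ?S (Cod ?S d) (Dom ?S m) \<and> w \<cdot>\<^bsub>?S\<^esub> d = Ident C (Dom C m) \<and> m \<cdot>\<^bsub>?S\<^esub> w = c"
      using m(2) unfolding strong_mono_def by blast
    then obtain w where w: "w \<in> hom ?S (Cod ?S d) (Dom ?S m)" "m \<cdot>\<^bsub>?S\<^esub> w = c" by blast
    have "fac ?S c m" using w c(3) by (intro facI[of w]) auto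
    moreover have "fac ?S m c" using c dS by (intro facI[of d]) auto
    ultimately have "h x = x" unfolding xm c(7) using S.subobj_of_eq_iff[OF dS(3) mS] by blast
    then show "strong_subobj ?S (h x)" using x by simp
  qed
  then have pair: "closure_pair C (h, k)"
    using k h h_k by (simp add: closure_pair_def Sep)
  interpret closure_pair_quasitopos C k h
    by unfold_locales (use h h_k Sep in auto)
  have "Shv = X"
  proof (intro equalityI subsetI)
    fix A assume A: "A \<in> X"
    then have Ao: "A \<in> Obj C" using X_Obj by blast
    have "mono_arr C (\<eta> A)" using \<eta>_iso[OF A] by (elim isoE) (auto intro: mono_split)
    then show "A \<in> Shv" unfolding Shv_iff using separated_iff_mono_\<eta>[OF k_dense Ao] Ao h_orth A by simp
  next
    fix A assume A: "A \<in> Shv"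
    then have Ao: "A \<in> Obj C" "A \<in> ?Spt" using Shv_D by auto
    note e = \<eta>_arr[OF Ao(1)]
    have "on_obj L A \<in> ?Spt"
      using \<eta>_iso[OF L_obj[OF Ao(1)]] separated_iff_mono_\<eta>[OF k_dense L_obj_Obj[OF Ao(1)]] L_obj_Obj[OF Ao(1)]
      by (elim isoE) (auto intro: mono_split)
    then have "mono_arr ?S (\<eta> A)" using \<eta>_mono[OF Ao(2)] e Ao unfolding sep.mono_D_iff by simp
    \<comment> \<open>The image of the unit under \<open>L\<close> is the unit of
      \<open>L A\<close>, so the density criterion holds trivially. A sheaf \<open>A\<close> is then
      orthogonal to its own unit, which gives the unit a retraction and in fact an inverse.\<close>
    then have "dense_mono ?S h (\<eta> A)"
      unfolding h_dense using L_\<eta>[OF Ao(1)] e fac_refl \<eta>_arr[OF L_obj_Obj[OF Ao(1)]] by simp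
    then have "orth C (\<eta> A) A" using A by (rule h_dense_orth)
    then obtain r where r: "r \<in> Arr C" "Dom C r = Cod C (\<eta> A)" "Cod C r = A" "r \<cdot> \<eta> A = Ident C A"
      using orthE[of C "\<eta> A" A "Ident C A"] e Ao by auto
    have "\<eta> A \<cdot> r = Ident C (on_obj L A)"
      using r e Ao L_obj_Obj[OF Ao(1)] by - (rule L_orth_ext[OF Ao(1) L_obj[OF Ao(1)]], auto)
    then have "iso_arr C r" using r e by (intro isoI[of r "\<eta> A"]) auto
    moreover have "Dom C r \<in> X" using r e L_obj[OF Ao(1)] by simp
    ultimately show "A \<in> X" using X_replete r unfolding replete_def by auto
  qed
  then have "Sh (Sep C k) h = full_sub C X" using Sh_eq by simp
  then show ?thesis using that pair by blast
qed

end

theorem theorem5p2: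
  fixes S :: "('o, 'a) cat"
  assumes "quasitopos S"
  shows "bij_betw (\<lambda>(h, k). Sh (Sep S k) h) {(h, k). closure_pair S (h, k)} {E. subquasitopos E S}"
proof -
  have cat: "category S" using assms by (simp add: quasitopos_def)
  interpret quasitopos_category S
    by (rule quasitopos_category.intro[OF cat]) (unfold_locales, rule assms)
  have pair: "closure_pair_quasitopos S k h" if p: "closure_pair S (h, k)" for h k
  proof -
    have u: "universal_closure S k" "strict_closure S k" "universal_closure (Sep S k) h"
      "\<And>m. dense_mono (Sep S k) h m \<Longrightarrow> dense_mono S k m"
      using p by (auto simp: closure_pair_def)
    show ?thesis by unfold_locales (use u in auto)
  qed
  show ?thesis
    unfolding bij_betw_def
  proof
    show "inj_on (\<lambda>(h, k). Sh (Sep S k) h) {(h, k). closure_pair S (h, k)}"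
      using closure_pair_unique[OF pair pair] by (intro inj_onI) auto
    show "(\<lambda>(h, k). Sh (Sep S k) h) ` {(h, k). closure_pair S (h, k)} = {E. subquasitopos E S}"
    proof (intro equalityI subsetI)
      fix E assume "E \<in> (\<lambda>(h, k). Sh (Sep S k) h) ` {(h, k). closure_pair S (h, k)}"
      then obtain h k where E: "closure_pair S (h, k)" "E = Sh (Sep S k) h" by auto
      interpret P: closure_pair_quasitopos S k h by (rule pair[OF E(1)])
      show "E \<in> {E. subquasitopos E S}" using P.subquasitopos_Shv E(2) P.Sh_eq by simp
    next
      fix E assume "E \<in> {E. subquasitopos E S}"
      then have sub: "Obj E \<subseteq> Obj S" "E = full_sub S (Obj E)" "replete E S"
        and "\<exists>L \<eta>. is_reflection S E L \<eta> \<and> preserves_monos S E L \<and> has_stable_units S E L"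
        unfolding subquasitopos_def full_subcategory_def by blast+
      then obtain L \<eta> where L: "is_reflection S E L \<eta>" "preserves_monos S E L" "has_stable_units S E L"
        by blast
      interpret D: subquasitopos_data S "Obj E" L \<eta>
        by unfold_locales (use sub L in simp_all)
      obtain h k where "closure_pair S (h, k)" "Sh (Sep S k) h = full_sub S (Obj E)"
        using D.closure_pair_ex .
      then show "E \<in> (\<lambda>(h, k). Sh (Sep S k) h) ` {(h, k). closure_pair S (h, k)}"
        using sub(2) by (intro image_eqI[of _ _ "(h, k)"]) auto
    qed
  qed
qed

end
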